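(* Let $\nu>0$, $r>0$, $\ell>0$, and let $O_-=B_r((\ell,0))\cup B_r((-\ell,0))\subset\mathbb{R}^2$. Let $D_0\supset O_-$ be an open set in $\mathbb{R}^2$ such that: (i) $D_0\subset B_R(z)$ for some $z\in\mathbb{R}^2$ and some $R<\nu^{-1}$; (ii) there exists a function $g:[\alpha,\beta]\to\mathbb{R}$ such that $\Gamma:=\{(p,q)\mid q=g(p),\ \alpha\le p\le\beta\}\in\mathcal{L}_\nu$, $(\alpha,g(\alpha))\in B_r((-\ell,0))$, $(\beta,g(\beta))\in B_r((\ell,0))$ and $\Gamma\subset D_0$. Let $\{D_t\}_{t\ge0}$ be the open evolution of $V=-\kappa+\nu$ with initial set $D_0$ and obstacles $O_-$ and $O_+=\mathbb{R}^2$, and let $\{E_t\}_{t\ge0}$ be the closed evolution of $V=-\kappa+\nu$ with initial set $E_0=\overline{D_0}$ and obstacles $C_-=\overline{O_-}$ and $C_+=\mathbb{R}^2$. Set $$A:=\bigcap\big\{\overline{B_{\nu^{-1}}(y)}\ \big|\ O_-\subset\overline{B_{\nu^{-1}}(y)},\ y\in\mathbb{R}^2\big\}$$ and let $A^{int}$ be its interior. Then $$A^{int}\subset\varliminf_{t\to\infty}D_t\subset\varlimsup_{t\to\infty}D_t\subset A$$ and $$A^{int}\subset\varliminf_{t\to\infty}E_t\subset\varlimsup_{t\to\infty}E_t\subset A.$$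
   Context: $B_r(z)$ is the open ball of radius $r$ centered at $z$. $\mathcal{L}_\nu$ is the set of curves $\gamma([0,1])$ with $\gamma\in C^2([0,1];\mathbb{R}^2)$ regular and such that the curvature of $\gamma([0,1])$ at $\gamma(t)$ has absolute value at most $\nu$ for all $t\in(0,1)$. For a family of sets, $\varlimsup_{t\to\infty}D_t:=\bigcap_{\tau>0}\bigcup_{t>\tau}D_t$ and $\varliminf_{t\to\infty}D_t:=\bigcup_{\tau>0}\bigcap_{t>\tau}D_t$. Below $d=2$. Let $\mathbb{S}^d$ be the real symmetric $d\times d$ matrices, and $F(p,X)=-\mathrm{Tr}\big((I-\frac{p\otimes p}{|p|^2})X\big)$ for $p\in\mathbb{R}^d\setminus\{0\}$, $X\in\mathbb{S}^d$. Upper and lower stars denote upper and lower semicontinuous envelopes. For $\nu\in\mathbb{R}$, Lipschitz functions $\Psi_-\le\Psi_+$ on $\mathbb{R}^d$ and $u_0\in C(\mathbb{R}^d)$, consider the obstacle problem (P): $u_t-\nu|Du|+F(Du,D^2u)=0$ in $\mathbb{R}^d\times(0,\infty)$, $u(\cdot,0)=u_0$, $\Psi_-(x)\le u(x,t)\le\Psi_+(x)$ in $\mathbb{R}^d\times(0,\infty)$. $u$ is a viscosity subsolution of (P) if (a) $\Psi_-(x)\le u^*(x,t)\le\Psi_+(x)$ for all $(x,t)\in\mathbb{R}^d\times(0,\infty)$; (b) $u^*(x,0)\le u_0(x)$ for all $x$; (c) whenever $\phi$ is smooth, $u^*-\phi$ has a local maximum at $(x_0,t_0)\in\mathbb{R}^d\times(0,\infty)$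 and $u^*(x_0,t_0)>\Psi_-(x_0)$, one has $\phi_t-\nu|D\phi|+F_*(D\phi,D^2\phi)\le0$ at $(x_0,t_0)$. $u$ is a viscosity supersolution if (a) $\Psi_-(x)\le u_*(x,t)\le\Psi_+(x)$ for all $(x,t)\in\mathbb{R}^d\times(0,\infty)$; (b) $u_*(x,0)\ge u_0(x)$ for all $x$; (c) whenever $\phi$ is smooth, $u_*-\phi$ has a local minimum at $(x_0,t_0)\in\mathbb{R}^d\times(0,\infty)$ and $u_*(x_0,t_0)<\Psi_+(x_0)$, one has $\phi_t-\nu|D\phi|+F^*(D\phi,D^2\phi)\ge0$ at $(x_0,t_0)$. A viscosity solution is both. For a constant $a<0$ let $K_a(\mathbb{R}^d\times[0,\infty))$ be the set of $u\in C(\mathbb{R}^d\times[0,\infty))$ such that for all $T>0$ there is $R>0$ with $u=a$ on $\{|x|\ge R\}\times[0,T]$. Open evolution: for open sets $D_0,O_-,O_+$, a family of open sets $\{D_t\}_{t\ge0}$ is the open evolution of $V=-\kappa+\nu$ with initial set $D_0$ and obstacles $O_-,O_+$ ($O_-\subset D_t\subset O_+$) if there exist Lipschitz $\Psi_\pm$, $u_0\in C(\mathbb{R}^d)$ and a viscosity solution $u\in K_a(\mathbb{R}^d\times[0,\infty))$ of (P) such that $O_\pm=\{\Psi_\pm>0\}$ and $D_t=\{x\mid u(x,t)>0\}$ for all $t\ge0$. Closed evolution: for closed sets $E_0,C_-,C_+$, the family of closed sets $\{E_t\}_{t\ge0}$ is defined in the same way with $C_\pm=\{\Psi_\pm\ge0\}$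 and $E_t=\{x\mid u(x,t)\ge0\}$ for all $t\ge0$. Open and closed evolutions exist and are unique (known result). *)

theory Defs
  imports "HOL-Analysis.Analysis"
begin

text \<open>
  Space-time is the product type \<open>(real^'n) \<times> real\<close>, the second component being time, and functions
  on \<open>\<real>\<^sup>d \<times> [0,\<infinity>)\<close> are total functions of which only the values at nonnegative times matter.
\<close>

abbreviation spacetime :: "((real^'n) \<times> real) set" where
  "spacetime \<equiv> UNIV \<times> {0..}"

abbreviation spacetime_pos :: "((real^'n) \<times> real) set" where
  "spacetime_pos \<equiv> UNIV \<times> {0<..}"

section \<open>Semicontinuous envelopes\<close>

text \<open>
  Envelopes of a function on \<open>S\<close>, evaluated at points of the closure of \<open>S\<close>. The centre of the
  ball is not removed. Values are extended reals, since \<open>f\<close> need not be locally bounded.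
\<close>

definition usc_envelope :: "'a::metric_space set \<Rightarrow> ('a \<Rightarrow> real) \<Rightarrow> 'a \<Rightarrow> ereal" where
  "usc_envelope S f x = (INF r\<in>{0<..}. SUP y\<in>S \<inter> ball x r. ereal (f y))"

definition lsc_envelope :: "'a::metric_space set \<Rightarrow> ('a \<Rightarrow> real) \<Rightarrow> 'a \<Rightarrow> ereal" where
  "lsc_envelope S f x = (SUP r\<in>{0<..}. INF y\<in>S \<inter> ball x r. ereal (f y))"

section \<open>Smooth test functions and their derivatives\<close>

text \<open>To be used for open \<open>S\<close> only, where \<open>frechet_derivative f (at x) v\<close> is the directional derivative.\<close>

primrec Ck_on :: "nat \<Rightarrow> ('a::euclidean_space \<Rightarrow> real) \<Rightarrow> 'a set \<Rightarrow> bool" where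
  "Ck_on 0 f S \<longleftrightarrow> continuous_on S f"
| "Ck_on (Suc k) f S \<longleftrightarrow> (\<forall>x\<in>S. f differentiable (at x)) \<and>
     (\<forall>v. Ck_on k (\<lambda>x. frechet_derivative f (at x) v) S)"

definition smooth_on :: "('a::euclidean_space \<Rightarrow> real) \<Rightarrow> 'a set \<Rightarrow> bool" where
  "smooth_on f S \<longleftrightarrow> (\<forall>k. Ck_on k f S)"

definition time_deriv :: "((real^'n) \<times> real \<Rightarrow> real) \<Rightarrow> (real^'n) \<times> real \<Rightarrow> real" where
  "time_deriv \<phi> z = frechet_derivative \<phi> (at z) (0, 1)"

definition space_partial :: "'n \<Rightarrow> ((real^'n) \<times> real \<Rightarrow> real) \<Rightarrow> (real^'n) \<times> real \<Rightarrow> real" where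
  "space_partial i \<phi> z = frechet_derivative \<phi> (at z) (axis i 1, 0)"

definition space_grad :: "((real^'n) \<times> real \<Rightarrow> real) \<Rightarrow> (real^'n) \<times> real \<Rightarrow> real^'n" where
  "space_grad \<phi> z = (\<chi> i. space_partial i \<phi> z)"

definition space_hessian :: "((real^'n) \<times> real \<Rightarrow> real) \<Rightarrow> (real^'n) \<times> real \<Rightarrow> real^'n^'n" where
  "space_hessian \<phi> z = (\<chi> i j. space_partial i (space_partial j \<phi>) z)"

section \<open>The curvature operator\<close>

definition outer :: "real^'n \<Rightarrow> real^'n \<Rightarrow> real^'n^'n" where
  "outer p q = (\<chi> i j. p $ i * q $ j)"

text \<open>Meaningful for \<open>p \<noteq> 0\<close> only; at \<open>p = 0\<close> only the envelopes below are used.\<close>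

definition curvature_op :: "(real^'n) \<times> (real^'n^'n) \<Rightarrow> real" where
  "curvature_op = (\<lambda>(p, X). - trace ((mat 1 - (1 / (norm p)\<^sup>2) *\<^sub>R outer p p) ** X))"

definition curvature_op_dom :: "((real^'n) \<times> (real^'n^'n)) set" where
  "curvature_op_dom = {(p, X). p \<noteq> 0 \<and> transpose X = X}"

definition curvature_op_lower :: "real^'n \<Rightarrow> real^'n^'n \<Rightarrow> ereal" where
  "curvature_op_lower p X = lsc_envelope curvature_op_dom curvature_op (p, X)"

definition curvature_op_upper :: "real^'n \<Rightarrow> real^'n^'n \<Rightarrow> ereal" where
  "curvature_op_upper p X = usc_envelope curvature_op_dom curvature_op (p, X)"

section \<open>The obstacle problem\<close>

definition viscosity_subsolution ::
  "real \<Rightarrow> (real^'n \<Rightarrow> real) \<Rightarrow> (real^'n \<Rightarrow> real) \<Rightarrow> (real^'n \<Rightarrow> real) \<Rightarrow> ((real^'n) \<times> real \<Rightarrow> real) \<Rightarrow> bool" where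
  "viscosity_subsolution \<nu> \<Psi>m \<Psi>p u0 u \<longleftrightarrow>
    (let us = usc_envelope spacetime u in
      (\<forall>x. \<forall>t>0. ereal (\<Psi>m x) \<le> us (x, t) \<and> us (x, t) \<le> ereal (\<Psi>p x)) \<and>
      (\<forall>x. us (x, 0) \<le> ereal (u0 x)) \<and>
      (\<forall>\<phi> x t. smooth_on \<phi> spacetime_pos \<and> t > 0 \<and>
          (\<forall>\<^sub>F z in nhds (x, t). us z - ereal (\<phi> z) \<le> us (x, t) - ereal (\<phi> (x, t))) \<and>
          us (x, t) > ereal (\<Psi>m x) \<longrightarrow>
        ereal (time_deriv \<phi> (x, t) - \<nu> * norm (space_grad \<phi> (x, t)))
          + curvature_op_lower (space_grad \<phi> (x, t)) (space_hessian \<phi> (x, t)) \<le> 0))"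

definition viscosity_supersolution ::
  "real \<Rightarrow> (real^'n \<Rightarrow> real) \<Rightarrow> (real^'n \<Rightarrow> real) \<Rightarrow> (real^'n \<Rightarrow> real) \<Rightarrow> ((real^'n) \<times> real \<Rightarrow> real) \<Rightarrow> bool" where
  "viscosity_supersolution \<nu> \<Psi>m \<Psi>p u0 u \<longleftrightarrow>
    (let us = lsc_envelope spacetime u in
      (\<forall>x. \<forall>t>0. ereal (\<Psi>m x) \<le> us (x, t) \<and> us (x, t) \<le> ereal (\<Psi>p x)) \<and>
      (\<forall>x. us (x, 0) \<ge> ereal (u0 x)) \<and>
      (\<forall>\<phi> x t. smooth_on \<phi> spacetime_pos \<and> t > 0 \<and>
          (\<forall>\<^sub>F z in nhds (x, t). us z - ereal (\<phi> z) \<ge> us (x, t) - ereal (\<phi> (x, t))) \<and>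
          us (x, t) < ereal (\<Psi>p x) \<longrightarrow>
        ereal (time_deriv \<phi> (x, t) - \<nu> * norm (space_grad \<phi> (x, t)))
          + curvature_op_upper (space_grad \<phi> (x, t)) (space_hessian \<phi> (x, t)) \<ge> 0))"

definition viscosity_solution ::
  "real \<Rightarrow> (real^'n \<Rightarrow> real) \<Rightarrow> (real^'n \<Rightarrow> real) \<Rightarrow> (real^'n \<Rightarrow> real) \<Rightarrow> ((real^'n) \<times> real \<Rightarrow> real) \<Rightarrow> bool" where
  "viscosity_solution \<nu> \<Psi>m \<Psi>p u0 u \<longleftrightarrow>
    viscosity_subsolution \<nu> \<Psi>m \<Psi>p u0 u \<and> viscosity_supersolution \<nu> \<Psi>m \<Psi>p u0 u"

definition K_class :: "real \<Rightarrow> ((real^'n) \<times> real \<Rightarrow> real) set" where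
  "K_class a = {u. continuous_on spacetime u \<and>
     (\<forall>T>0. \<exists>R>0. \<forall>x t. norm x \<ge> R \<and> 0 \<le> t \<and> t \<le> T \<longrightarrow> u (x, t) = a)}"

text \<open>
  The constant \<open>a < 0\<close> is existentially quantified. Its value is immaterial for the resulting level
  sets: the equation is homogeneous of degree one, so all data may be multiplied by a positive
  constant.
\<close>

definition level_set_data ::
  "real \<Rightarrow> (real^'n \<Rightarrow> real) \<Rightarrow> (real^'n \<Rightarrow> real) \<Rightarrow> ((real^'n) \<times> real \<Rightarrow> real) \<Rightarrow> bool" where
  "level_set_data \<nu> \<Psi>m \<Psi>p u \<longleftrightarrow>
     (\<exists>L. L-lipschitz_on UNIV \<Psi>m) \<and> (\<exists>L. L-lipschitz_on UNIV \<Psi>p) \<and> (\<forall>x. \<Psi>m x \<le> \<Psi>p x) \<and>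
     (\<exists>u0. continuous_on UNIV u0 \<and> viscosity_solution \<nu> \<Psi>m \<Psi>p u0 u) \<and>
     (\<exists>a<0. u \<in> K_class a)"

section \<open>Open and closed evolutions\<close>

definition open_evolution ::
  "real \<Rightarrow> (real^'n) set \<Rightarrow> (real^'n) set \<Rightarrow> (real^'n) set \<Rightarrow> (real \<Rightarrow> (real^'n) set) \<Rightarrow> bool" where
  "open_evolution \<nu> D0 Om Op D \<longleftrightarrow>
     open D0 \<and> open Om \<and> open Op \<and> D 0 = D0 \<and>
     (\<forall>t\<ge>0. open (D t) \<and> Om \<subseteq> D t \<and> D t \<subseteq> Op) \<and>
     (\<exists>\<Psi>m \<Psi>p u. level_set_data \<nu> \<Psi>m \<Psi>p u \<and>
        Om = {x. \<Psi>m x > 0} \<and> Op = {x. \<Psi>p x > 0} \<and> (\<forall>t\<ge>0. D t = {x. u (x, t) > 0}))"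

definition closed_evolution ::
  "real \<Rightarrow> (real^'n) set \<Rightarrow> (real^'n) set \<Rightarrow> (real^'n) set \<Rightarrow> (real \<Rightarrow> (real^'n) set) \<Rightarrow> bool" where
  "closed_evolution \<nu> E0 Cm Cp E \<longleftrightarrow>
     closed E0 \<and> closed Cm \<and> closed Cp \<and> E 0 = E0 \<and>
     (\<forall>t\<ge>0. closed (E t) \<and> Cm \<subseteq> E t \<and> E t \<subseteq> Cp) \<and>
     (\<exists>\<Psi>m \<Psi>p u. level_set_data \<nu> \<Psi>m \<Psi>p u \<and>
        Cm = {x. \<Psi>m x \<ge> 0} \<and> Cp = {x. \<Psi>p x \<ge> 0} \<and> (\<forall>t\<ge>0. E t = {x. u (x, t) \<ge> 0}))"

definition set_limsup :: "(real \<Rightarrow> 'a set) \<Rightarrow> 'a set" where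
  "set_limsup D = (\<Inter>\<tau>\<in>{0<..}. \<Union>t\<in>{\<tau><..}. D t)"

definition set_liminf :: "(real \<Rightarrow> 'a set) \<Rightarrow> 'a set" where
  "set_liminf D = (\<Union>\<tau>\<in>{0<..}. \<Inter>t\<in>{\<tau><..}. D t)"

section \<open>Planar curves of bounded curvature\<close>

text \<open>Signed curvature at a point with velocity \<open>v \<noteq> 0\<close> and acceleration \<open>w\<close>, in any regular parametrisation.\<close>

definition planar_curvature :: "real^2 \<Rightarrow> real^2 \<Rightarrow> real" where
  "planar_curvature v w = (v $ 1 * w $ 2 - v $ 2 * w $ 1) / norm v ^ 3"

text \<open>Derivatives at the end points \<open>0\<close> and \<open>1\<close> are one-sided.\<close>

definition curves_curvature_le :: "real \<Rightarrow> (real^2) set set" where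
  "curves_curvature_le \<nu> = {\<gamma> ` {0..1} | \<gamma>. \<exists>\<gamma>' \<gamma>''.
     (\<forall>t\<in>{0..1}. (\<gamma> has_vector_derivative \<gamma>' t) (at t within {0..1})) \<and>
     (\<forall>t\<in>{0..1}. (\<gamma>' has_vector_derivative \<gamma>'' t) (at t within {0..1})) \<and>
     continuous_on {0..1} \<gamma>'' \<and>
     (\<forall>t\<in>{0..1}. \<gamma>' t \<noteq> 0) \<and>
     (\<forall>t\<in>{0<..<1}. \<bar>planar_curvature (\<gamma>' t) (\<gamma>'' t)\<bar> \<le> \<nu>)}"

end

theory Submission
  imports Defs
begin

text \<open>
  The superlevel sets of a solution move with normal velocity \<open>V = \<nu> - \<kappa>\<close>. Hence a disc of radius
  less than \<open>1 / \<nu>\<close> shrinks and a disc of radius greater than \<open>1 / \<nu>\<close> grows, and both statements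
  survive a sufficiently slow motion of the disc. All comparisons below are of this kind, with test
  functions that are steep functions of \<open>\<rho> - |x - c|\<^sup>2\<close>, so that the definition of viscosity
  solutions applies directly and takes the place of a general comparison principle.

  Upper bound. A point outside \<open>A\<close> lies outside a disc of radius \<open>1 / \<nu>\<close> that contains the
  lower obstacle, and the initial set lies in a disc of radius less than \<open>1 / \<nu>\<close>. Discs between these two
  still contain the obstacle and have radius less than \<open>1 / \<nu>\<close>, so that the evolution remains
  inside while the first disc is slowly deformed almost into the second
  (\<open>subsolution_vanishes_outside_moving_disc\<close>, \<open>subsolution_eventually_outside_hull\<close>).

  Lower bound. First, the evolution never leaves the curve \<open>\<Gamma>\<close>. Its curvature is at most \<open>\<nu>\<close>, so
  the boundary of a tube around it has curvature less than \<open>\<nu>\<close> and tends to expand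
  (\<open>supersolution_persists_on_curve\<close>). Next, the region above \<open>\<Gamma>\<close> is filled by a disc of radius
  slightly greater than \<open>1 / \<nu>\<close> that is slowly pushed upwards. What sticks out of this region does not matter:
  the sides of the region are rays on which, outside the two obstacle discs, the disc never arrives. In
  its final position the disc nearly is the one of radius \<open>1 / \<nu>\<close> whose boundary touches both obstacle
  discs (\<open>supersolution_fills_moving_disc\<close>, \<open>supersolution_fills_above_graph\<close>). The same holds below
  \<open>\<Gamma>\<close>. In the limit these two discs, cut off by the rays, and the obstacle cover the interior of \<open>A\<close>
  (\<open>hull_of_two_discs\<close>, \<open>supersolution_eventually_inside_hull\<close>).

  The only topological fact about the region above \<open>\<Gamma>\<close> is \<open>above_graph_locally_constant\<close>. It is
  stated for an explicit region, in place of a separation theorem of Jordan type.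
\<close>

section \<open>Smooth functions of space and time\<close>

lemma Ck_on_SucI:
  assumes "\<And>x. x \<in> S \<Longrightarrow> (f has_derivative f' x) (at x)"
    and "open S" and "\<And>v. Ck_on k (\<lambda>x. f' x v) S"
    and cong: "\<And>f g. (\<And>x. x \<in> S \<Longrightarrow> f x = g x) \<Longrightarrow> Ck_on k f S \<Longrightarrow> Ck_on k g S"
  shows "Ck_on (Suc k) f S"
proof -
  have "f' x = frechet_derivative f (at x)" if "x \<in> S" for x
    using assms(1)[OF that] by (rule frechet_derivative_at)
  then have "Ck_on k (\<lambda>x. frechet_derivative f (at x) v) S" for v
    using cong[OF _ assms(3)[of v]] by auto
  then show ?thesis using assms(1) by (auto simp: differentiable_def)
qed

lemma Ck_on_cong:
  assumes "open S" and "\<And>x. x \<in> S \<Longrightarrow> f x = g x" and "Ck_on k f S"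
  shows "Ck_on k g S"
  using assms(2,3)
proof (induction k arbitrary: f g)
  case 0
  then show ?case by (simp cong: continuous_on_cong)
next
  case (Suc k)
  have "(g has_derivative frechet_derivative f (at x)) (at x)" if "x \<in> S" for x
    using Suc.prems that assms(1)
    by (auto simp: frechet_derivative_works intro: has_derivative_transform_within_open[of f _ x UNIV S])
  moreover have "Ck_on k (\<lambda>x. frechet_derivative f (at x) v) S" for v
    using Suc.prems by simp
  ultimately show ?case
    by (rule Ck_on_SucI[OF _ assms(1) _ Suc.IH])
qed

lemma Ck_on_Suc_derivI:
  assumes "open S" and "\<And>x. x \<in> S \<Longrightarrow> (f has_derivative f' x) (at x)"
    and "\<And>v. Ck_on k (\<lambda>x. f' x v) S"
  shows "Ck_on (Suc k) f S"
  using assms by (intro Ck_on_SucI) (auto intro: Ck_on_cong)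

lemma Ck_on_Suc_derivD:
  assumes "Ck_on (Suc k) f S" and "x \<in> S"
  shows "(f has_derivative frechet_derivative f (at x)) (at x)"
  using assms by (auto simp: frechet_derivative_works)

lemma Ck_on_Suc_imp: "Ck_on (Suc k) f S \<Longrightarrow> Ck_on k f S"
proof (induction k arbitrary: f)
  case 0
  then show ?case
    by (auto intro!: continuous_at_imp_continuous_on differentiable_imp_continuous_within)
next
  case (Suc k)
  then show ?case by auto
qed

lemma Ck_on_const: "open S \<Longrightarrow> Ck_on k (\<lambda>x. a) S"
proof (induction k arbitrary: a)
  case (Suc k)
  show ?case by (rule Ck_on_Suc_derivI[OF Suc.prems has_derivative_const]) (simp add: Suc)
qed simp

lemma Ck_on_linear:
  assumes "open S" "bounded_linear f"
  shows "Ck_on k f S"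
proof (cases k)
  case 0
  then show ?thesis using assms by (simp add: linear_continuous_on)
next
  case (Suc j)
  show ?thesis unfolding Suc
    by (rule Ck_on_Suc_derivI[OF assms(1) bounded_linear_imp_has_derivative[OF assms(2)]])
      (simp add: Ck_on_const assms)
qed

lemma Ck_on_add:
  assumes "open S"
  shows "Ck_on k f S \<Longrightarrow> Ck_on k g S \<Longrightarrow> Ck_on k (\<lambda>x. f x + g x) S"
proof (induction k arbitrary: f g)
  case 0
  then show ?case by (simp add: continuous_on_add)
next
  case (Suc k)
  show ?case
    by (rule Ck_on_Suc_derivI[OF assms has_derivative_add[OF Ck_on_Suc_derivD[OF Suc.prems(1)]
            Ck_on_Suc_derivD[OF Suc.prems(2)]]])
      (use Suc in auto)
qed

lemma Ck_on_mult:
  assumes "open S"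
  shows "Ck_on k f S \<Longrightarrow> Ck_on k g S \<Longrightarrow> Ck_on k (\<lambda>x. f x * g x) S"
proof (induction k arbitrary: f g)
  case 0
  then show ?case by (simp add: continuous_on_mult)
next
  case (Suc k)
  note low = Suc.prems[THEN Ck_on_Suc_imp]
  show ?case
    by (rule Ck_on_Suc_derivI[OF assms has_derivative_mult[OF Ck_on_Suc_derivD[OF Suc.prems(1)]
            Ck_on_Suc_derivD[OF Suc.prems(2)]]])
      (use Suc low in \<open>auto intro!: Ck_on_add assms\<close>)
qed

lemma Ck_on_exp:
  assumes "open S"
  shows "Ck_on k f S \<Longrightarrow> Ck_on k (\<lambda>x. exp (f x)) S"
proof (induction k arbitrary: f)
  case 0
  then show ?case by (simp add: continuous_on_exp)
next
  case (Suc k)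
  have low: "Ck_on k (\<lambda>x. exp (f x)) S"
    by (rule Suc.IH[OF Ck_on_Suc_imp[OF Suc.prems]])
  show ?case
    by (rule Ck_on_Suc_derivI[OF assms has_derivative_exp[OF Ck_on_Suc_derivD[OF Suc.prems]]])
      (use Suc low in \<open>auto intro!: Ck_on_mult assms\<close>)
qed

lemma open_spacetime_pos: "open (spacetime_pos :: ((real^'n) \<times> real) set)"
  by (intro open_Times) auto

lemma smooth_on_intros:
  fixes f g :: "(real^'n) \<times> real \<Rightarrow> real"
  shows "smooth_on (\<lambda>z. a) spacetime_pos"
    and "smooth_on f spacetime_pos \<Longrightarrow> smooth_on g spacetime_pos \<Longrightarrow> smooth_on (\<lambda>z. f z + g z) spacetime_pos"
    and "smooth_on f spacetime_pos \<Longrightarrow> smooth_on g spacetime_pos \<Longrightarrow> smooth_on (\<lambda>z. f z * g z) spacetime_pos"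
    and "smooth_on f spacetime_pos \<Longrightarrow> smooth_on (\<lambda>z. exp (f z)) spacetime_pos"
    and "smooth_on (\<lambda>z. snd z) (spacetime_pos :: ((real^'n) \<times> real) set)"
    and "smooth_on (\<lambda>z. fst z $ i) (spacetime_pos :: ((real^'n) \<times> real) set)"
  unfolding smooth_on_def
  by (simp_all add: Ck_on_const Ck_on_add Ck_on_mult Ck_on_exp Ck_on_linear open_spacetime_pos
      bounded_linear_snd bounded_linear_compose[OF bounded_linear_vec_nth bounded_linear_fst])

lemma smooth_on_diff:
  fixes f g :: "(real^'n) \<times> real \<Rightarrow> real"
  assumes "smooth_on f spacetime_pos" "smooth_on g spacetime_pos"
  shows "smooth_on (\<lambda>z. f z - g z) spacetime_pos"
proof -
  have "smooth_on (\<lambda>z. f z + (-1) * g z) spacetime_pos"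
    by (intro smooth_on_intros assms)
  then show ?thesis by simp
qed

section \<open>Envelopes and the curvature operator\<close>

lemma usc_envelope_eq:
  assumes "continuous_on S f" "x \<in> S"
  shows "usc_envelope S f x = ereal (f x)"
proof (rule antisym)
  show "usc_envelope S f x \<le> ereal (f x)"
  proof (rule ereal_le_epsilon2)
    fix e :: real assume "0 < e"
    then obtain r where r: "r > 0" "\<And>y. y \<in> S \<Longrightarrow> dist y x < r \<Longrightarrow> dist (f y) (f x) < e"
      using assms by (metis continuous_on_iff)
    have "usc_envelope S f x \<le> (SUP y\<in>S \<inter> ball x r. ereal (f y))"
      unfolding usc_envelope_def using r(1) by (intro INF_lower) auto
    also have "\<dots> \<le> ereal (f x) + ereal e"
      using r(2) by (intro SUP_least) (fastforce simp: dist_commute dist_real_def)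
    finally show "usc_envelope S f x \<le> ereal (f x) + ereal e" .
  qed
  show "ereal (f x) \<le> usc_envelope S f x"
    unfolding usc_envelope_def using assms by (intro INF_greatest SUP_upper2[of x]) auto
qed

lemma lsc_envelope_eq_minus: "lsc_envelope S f x = - usc_envelope S (\<lambda>y. - f y) x"
  unfolding lsc_envelope_def usc_envelope_def
  by (simp add: uminus_ereal.simps(1)[symmetric] ereal_SUP_uminus_eq ereal_INF_uminus_eq
      del: uminus_ereal.simps)

lemma lsc_envelope_eq:
  assumes "continuous_on S f" "x \<in> S"
  shows "lsc_envelope S f x = ereal (f x)"
  unfolding lsc_envelope_eq_minus
  by (subst usc_envelope_eq) (use assms in \<open>auto intro: continuous_on_minus\<close>)

lemma curvature_op_2:
  fixes q :: "real^2" and Y :: "real^2^2"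
  assumes "q \<noteq> 0"
  shows "curvature_op (q, Y) = (- (q$2)\<^sup>2 * Y$1$1 + q$1 * q$2 * (Y$1$2 + Y$2$1) - (q$1)\<^sup>2 * Y$2$2) / (norm q)\<^sup>2"
proof -
  define N where "N = (norm q)\<^sup>2"
  have n: "N = (q$1)\<^sup>2 + (q$2)\<^sup>2"
    by (simp add: N_def norm_vec_def L2_set_def UNIV_2)
  have "N \<noteq> 0" using assms by (simp add: N_def)
  then have 1: "1 - q$1 * q$1 / N = (q$2)\<^sup>2 / N" "1 - q$2 * q$2 / N = (q$1)\<^sup>2 / N"
    by (auto simp: field_simps n power2_eq_square)
  have "curvature_op (q, Y) = - ((1 - q$1 * q$1 / N) * Y$1$1 - q$1 * q$2 / N * Y$2$1
      - q$2 * q$1 / N * Y$1$2 + (1 - q$2 * q$2 / N) * Y$2$2)"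
    unfolding curvature_op_def N_def
    by (simp add: trace_def matrix_matrix_mult_def outer_def mat_def sum_2 algebra_simps)
  then show ?thesis
    unfolding 1 N_def[symmetric] by (simp add: add_divide_distrib diff_divide_distrib algebra_simps)
qed

text \<open>
  For a function \<open>\<phi> = H(\<rho> - |x - c|\<^sup>2)\<close> the Hessian is \<open>-2h I\<close> plus a multiple of
  \<open>D\<phi> \<otimes> D\<phi>\<close>, where \<open>h = H'\<close>, and the projection in the curvature operator kills the second
  part. The estimate is uniform down to \<open>p = 0\<close>, because for \<open>q \<noteq> 0\<close> the projection of \<open>p\<close>
  orthogonal to \<open>q\<close> has length at most \<open>|p - q|\<close>. Therefore it controls both envelopes at
  the critical point of \<open>\<phi>\<close> too, and the centre of a disc is no exceptional point in what follows.
\<close>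

lemma curvature_op_radial_near:
  fixes p q :: "real^2" and Y :: "real^2^2"
  assumes "q \<noteq> 0"
  shows "\<bar>curvature_op (q, Y) - 2 * h\<bar>
     \<le> 4 * norm (Y - ((-2*h) *\<^sub>R mat 1 + k *\<^sub>R outer p p)) + \<bar>k\<bar> * (norm (p - q))\<^sup>2"
proof -
  define Z where "Z = Y - ((-2*h) *\<^sub>R mat 1 + k *\<^sub>R outer p p)"
  define N where "N = (norm q)\<^sup>2"
  have N: "N = (q$1)\<^sup>2 + (q$2)\<^sup>2"
    by (simp add: N_def norm_vec_def L2_set_def UNIV_2)
  have N0: "N > 0" using assms by (simp add: N_def)
  have Zij: "\<bar>Z$i$j\<bar> \<le> norm Z" for i j
    by (meson Finite_Cartesian_Product.norm_nth_le component_le_norm_cart order_trans)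
  have Y: "Y$1$1 = Z$1$1 - 2*h + k * (p$1)^2" "Y$2$2 = Z$2$2 - 2*h + k * (p$2)^2"
    "Y$1$2 = Z$1$2 + k * p$1 * p$2" "Y$2$1 = Z$2$1 + k * p$1 * p$2"
    by (auto simp: Z_def mat_def outer_def power2_eq_square)
  define A where "A = - (q$2)\<^sup>2 * Z$1$1 + q$1 * q$2 * (Z$1$2 + Z$2$1) - (q$1)\<^sup>2 * Z$2$2"
  define B where "B = (p$1 * q$2 - p$2 * q$1)\<^sup>2"
  have "curvature_op (q, Y) = (2 * h * N + A - k * B) / N"
    unfolding curvature_op_2[OF assms] N_def[symmetric] Y A_def B_def
    by (simp add: N power2_eq_square algebra_simps)
  then have eq: "curvature_op (q, Y) - 2 * h = A / N - k * (B / N)"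
    using N0 by (simp add: field_simps)
  have qq: "\<bar>q$1 * q$2\<bar> \<le> N"
  proof -
    have "2 * \<bar>q$1\<bar> * \<bar>q$2\<bar> \<le> (q$1)\<^sup>2 + (q$2)\<^sup>2" using sum_squares_bound[of "\<bar>q$1\<bar>" "\<bar>q$2\<bar>"] by simp
    moreover have "0 \<le> \<bar>q$1\<bar> * \<bar>q$2\<bar>" by simp
    ultimately show ?thesis unfolding N abs_mult by linarith
  qed
  have "\<bar>A\<bar> \<le> \<bar>(q$2)\<^sup>2 * Z$1$1\<bar> + \<bar>(q$1 * q$2) * (Z$1$2 + Z$2$1)\<bar> + \<bar>(q$1)\<^sup>2 * Z$2$2\<bar>"
    unfolding A_def by linarith
  also have "\<dots> \<le> N * norm Z + N * (2 * norm Z) + N * norm Z"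
  proof -
    have "\<bar>Z$1$2 + Z$2$1\<bar> \<le> 2 * norm Z" using Zij[of 1 2] Zij[of 2 1] by linarith
    then show ?thesis unfolding abs_mult
      using qq Zij N by (intro add_mono mult_mono) (auto simp: abs_mult)
  qed
  finally have A: "\<bar>A / N\<bar> \<le> 4 * norm Z"
    using N0 by (simp add: field_simps)
  have B: "\<bar>B / N\<bar> \<le> (norm (p - q))\<^sup>2"
  proof -
    have "(norm (p - q))\<^sup>2 = (p$1-q$1)\<^sup>2 + (p$2-q$2)\<^sup>2"
      by (simp add: norm_vec_def L2_set_def UNIV_2)
    moreover have "B \<le> ((p$1-q$1)\<^sup>2 + (p$2-q$2)\<^sup>2) * N"
    proof -
      have "((p$1-q$1)\<^sup>2 + (p$2-q$2)\<^sup>2) * N - B = ((p$1-q$1)*q$1 + (p$2-q$2)*q$2)\<^sup>2"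
        unfolding N B_def by (simp add: power2_eq_square algebra_simps)
      then show ?thesis by (metis diff_ge_0_iff_ge zero_le_power2)
    qed
    moreover have "B \<ge> 0" by (simp add: B_def)
    ultimately show ?thesis using N0 by (simp add: field_simps)
  qed
  have "\<bar>curvature_op (q, Y) - 2 * h\<bar> \<le> \<bar>A / N\<bar> + \<bar>k\<bar> * \<bar>B / N\<bar>"
    unfolding eq by (metis abs_mult abs_triangle_ineq4)
  also have "\<dots> \<le> 4 * norm Z + \<bar>k\<bar> * (norm (p - q))\<^sup>2"
    by (intro add_mono A mult_left_mono B) auto
  finally show ?thesis by (simp add: Z_def)
qed

lemma curvature_op_radial_nearby:
  fixes p :: "real^2"
  assumes X: "X = (-2*h) *\<^sub>R mat 1 + k *\<^sub>R outer p p" and "e > 0"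
  obtains d where "d > 0"
    and "\<And>z. z \<in> curvature_op_dom \<inter> ball (p, X) d \<Longrightarrow> \<bar>curvature_op z - 2 * h\<bar> \<le> e"
proof -
  define d where "d = min 1 (e / (4 + \<bar>k\<bar>))"
  have d: "d > 0" "d \<le> 1"
    using \<open>e > 0\<close> by (auto simp: d_def)
  have "d \<le> e / (4 + \<bar>k\<bar>)" by (simp add: d_def)
  then have d3: "(4 + \<bar>k\<bar>) * d \<le> e"
    by (subst (asm) pos_le_divide_eq) (auto simp: mult.commute)
  have "\<bar>curvature_op z - 2 * h\<bar> \<le> e" if z: "z \<in> curvature_op_dom \<inter> ball (p, X) d" for z
  proof -
    obtain q Y where zq: "z = (q, Y)" by force
    have q: "q \<noteq> 0" using z by (auto simp: zq curvature_op_dom_def)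
    have "dist p q < d" "dist X Y < d"
      using z dist_fst_le[of "(p,X)" z] dist_snd_le[of "(p,X)" z] by (auto simp: zq)
    then have 1: "norm (p - q) \<le> d" and 2: "norm (Y - X) \<le> d"
      by (auto simp: dist_norm norm_minus_commute)
    have "(norm (p - q))\<^sup>2 \<le> d"
      using 1 d by (smt (verit) norm_ge_zero power2_eq_square mult_left_le mult_mono)
    then have "4 * norm (Y - X) + \<bar>k\<bar> * (norm (p - q))\<^sup>2 \<le> 4 * d + \<bar>k\<bar> * d"
      using 2 by (intro add_mono mult_left_mono) auto
    then show ?thesis
      using curvature_op_radial_near[OF q, of Y h k p] d3 unfolding zq X by (simp add: algebra_simps)
  qed
  with d(1) show ?thesis using that by blast
qed

lemma curvature_op_upper_radial:
  fixes p :: "real^2"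
  assumes X: "X = (-2*h) *\<^sub>R mat 1 + k *\<^sub>R outer p p"
  shows "curvature_op_upper p X \<le> ereal (2 * h)"
proof (rule ereal_le_epsilon2)
  fix e :: real assume "0 < e"
  obtain d where d: "d > 0"
    and near: "\<And>z. z \<in> curvature_op_dom \<inter> ball (p, X) d \<Longrightarrow> \<bar>curvature_op z - 2 * h\<bar> \<le> e"
    using curvature_op_radial_nearby[OF X \<open>0 < e\<close>] by blast
  have "curvature_op_upper p X \<le> (SUP y\<in>curvature_op_dom \<inter> ball (p, X) d. ereal (curvature_op y))"
    unfolding curvature_op_upper_def usc_envelope_def using d by (intro INF_lower) auto
  also have "\<dots> \<le> ereal (2 * h) + ereal e"
    using near by (intro SUP_least) (fastforce simp: abs_le_iff)
  finally show "curvature_op_upper p X \<le> ereal (2 * h) + ereal e" .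
qed

lemma curvature_op_lower_radial:
  fixes p :: "real^2"
  assumes X: "X = (-2*h) *\<^sub>R mat 1 + k *\<^sub>R outer p p"
  shows "ereal (2 * h) \<le> curvature_op_lower p X"
proof (rule ereal_le_epsilon2)
  fix e :: real assume "0 < e"
  obtain d where d: "d > 0"
    and near: "\<And>z. z \<in> curvature_op_dom \<inter> ball (p, X) d \<Longrightarrow> \<bar>curvature_op z - 2 * h\<bar> \<le> e"
    using curvature_op_radial_nearby[OF X \<open>0 < e\<close>] by blast
  have "ereal (2 * h - e) \<le> (INF y\<in>curvature_op_dom \<inter> ball (p, X) d. ereal (curvature_op y))"
    using near by (intro INF_greatest) (fastforce simp: abs_le_iff)
  also have "\<dots> \<le> curvature_op_lower p X"
    unfolding curvature_op_lower_def lsc_envelope_def using d by (intro SUP_upper) auto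
  finally have "ereal (2 * h - e) + ereal e \<le> curvature_op_lower p X + ereal e"
    by (intro add_mono) auto
  then show "ereal (2 * h) \<le> curvature_op_lower p X + ereal e" by simp
qed

section \<open>Radial test functions\<close>

lemma has_derivative_time:
  assumes "(f has_vector_derivative f') (at t)"
  shows "((\<lambda>z. f (snd z)) has_derivative (\<lambda>v. snd v *\<^sub>R f')) (at (x, t))"
proof -
  have "(snd has_derivative snd) (at (x, t))"
    by (rule bounded_linear_imp_has_derivative[OF bounded_linear_snd])
  from has_derivative_compose[OF this, of f "\<lambda>s. s *\<^sub>R f'"] assms show ?thesis
    by (simp add: has_vector_derivative_def)
qed

lemmas has_derivative_time_real =
  has_derivative_time[OF iffD1[OF has_real_derivative_iff_has_vector_derivative], simplified]

lemma has_derivative_radial_profile: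
  fixes c :: "real \<Rightarrow> real^2"
  assumes \<rho>: "\<And>t. (\<rho> has_real_derivative \<rho>' t) (at t)"
    and c: "\<And>t. (c has_vector_derivative c' t) (at t)"
    and H: "\<And>w. (H has_real_derivative H1 w) (at w)"
  shows "((\<lambda>z. H (\<rho> (snd z) - (norm (fst z - c (snd z)))\<^sup>2)) has_derivative
     (\<lambda>v. H1 (\<rho> t - (norm (x - c t))\<^sup>2) *
        (\<rho>' t * snd v - 2 * ((x - c t) \<bullet> (fst v - snd v *\<^sub>R c' t))))) (at (x, t))"
proof -
  have \<rho>': "((\<lambda>z. \<rho> (snd z)) has_derivative (\<lambda>v. snd v * \<rho>' t)) (at (x, t))"
    by (rule has_derivative_time_real[OF \<rho>])
  have c': "((\<lambda>z. c (snd z)) has_derivative (\<lambda>v. snd v *\<^sub>R c' t)) (at (x, t))"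
    by (rule has_derivative_time[OF c])
  define \<psi> where "\<psi> = (\<lambda>z. \<rho> (snd z) - (fst z - c (snd z)) \<bullet> (fst z - c (snd z)))"
  have \<psi>: "(\<psi> has_derivative (\<lambda>v. \<rho>' t * snd v - 2 * ((x - c t) \<bullet> (fst v - snd v *\<^sub>R c' t)))) (at (x, t))"
    unfolding \<psi>_def
    by (rule has_derivative_eq_rhs, (rule derivative_intros \<rho>' c')+)
      (auto simp: fun_eq_iff inner_commute)
  have "((\<lambda>z. H (\<psi> z)) has_derivative (\<lambda>v. H1 (\<psi> (x,t)) *
        (\<rho>' t * snd v - 2 * ((x - c t) \<bullet> (fst v - snd v *\<^sub>R c' t))))) (at (x, t))"
    using has_derivative_compose[OF \<psi> H[of "\<psi> (x,t)", unfolded has_field_derivative_def]] by simp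
  then show ?thesis unfolding \<psi>_def by (simp add: dot_square_norm)
qed

lemma radial_test_derivatives:
  fixes c :: "real \<Rightarrow> real^2"
  assumes \<rho>: "\<And>t. (\<rho> has_real_derivative \<rho>' t) (at t)"
    and c: "\<And>t. (c has_vector_derivative c' t) (at t)"
    and H: "\<And>w. (H has_real_derivative H1 w) (at w)"
    and H1: "\<And>w. (H1 has_real_derivative H2 w) (at w)"
    and G: "\<And>t. (G has_real_derivative G' t) (at t)"
  defines "\<psi> \<equiv> \<lambda>z. \<rho> (snd z) - (norm (fst z - c (snd z)))\<^sup>2"
  defines "\<phi> \<equiv> \<lambda>z. H (\<psi> z) + G (snd z)"
  shows "time_deriv \<phi> (x, t) = H1 (\<psi> (x, t)) * (\<rho>' t + 2 * ((x - c t) \<bullet> c' t)) + G' t"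
    and "space_grad \<phi> (x, t) = (- 2 * H1 (\<psi> (x, t))) *\<^sub>R (x - c t)"
    and "space_hessian \<phi> (x, t) = (- 2 * H1 (\<psi> (x, t))) *\<^sub>R mat 1
           + (4 * H2 (\<psi> (x, t))) *\<^sub>R outer (x - c t) (x - c t)"
proof -
  have G': "((\<lambda>z. G (snd z)) has_derivative (\<lambda>v. snd v * G' t)) (at (x, t))" for x t
    by (rule has_derivative_time_real[OF G])
  have d: "frechet_derivative \<phi> (at (x, t)) = (\<lambda>v. H1 (\<psi> (x, t)) *
        (\<rho>' t * snd v - 2 * ((x - c t) \<bullet> (fst v - snd v *\<^sub>R c' t))) + snd v * G' t)" for x t
    unfolding \<phi>_def \<psi>_def
    using frechet_derivative_at[OF has_derivative_add[OF has_derivative_radial_profile[OF \<rho> c H, of t x] G'[of t x]]]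
    by simp
  show "time_deriv \<phi> (x, t) = H1 (\<psi> (x, t)) * (\<rho>' t + 2 * ((x - c t) \<bullet> c' t)) + G' t"
    unfolding time_deriv_def d by (simp add: algebra_simps)
  have sp: "space_partial j \<phi> = (\<lambda>z. H1 (\<psi> z) * (- 2 * (fst z - c (snd z)) $ j))" for j
    by (rule ext) (auto simp: space_partial_def d inner_axis split: prod.splits)
  show "space_grad \<phi> (x, t) = (- 2 * H1 (\<psi> (x, t))) *\<^sub>R (x - c t)"
    unfolding space_grad_def sp by (simp add: vec_eq_iff algebra_simps)
  have sp2: "space_partial i (space_partial j \<phi>) (x, t) =
      H1 (\<psi> (x, t)) * (- 2 * (if i = j then 1 else 0))
      + 4 * H2 (\<psi> (x, t)) * (x - c t) $ i * (x - c t) $ j" for i j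
  proof -
    have c': "((\<lambda>z. c (snd z)) has_derivative (\<lambda>v. snd v *\<^sub>R c' t)) (at (x, t))"
      by (rule has_derivative_time[OF c])
    have 1: "((\<lambda>z. H1 (\<psi> z)) has_derivative (\<lambda>v. H2 (\<psi> (x, t)) *
        (\<rho>' t * snd v - 2 * ((x - c t) \<bullet> (fst v - snd v *\<^sub>R c' t))))) (at (x, t))"
      unfolding \<psi>_def using has_derivative_radial_profile[OF \<rho> c H1, of t x] by simp
    have 2: "((\<lambda>z. - 2 * (fst z - c (snd z)) $ j) has_derivative
        (\<lambda>v. - 2 * (fst v - snd v *\<^sub>R c' t) $ j)) (at (x, t))"
      by (rule has_derivative_mult_right bounded_linear.has_derivative[OF bounded_linear_vec_nth]
          has_derivative_diff has_derivative_fst has_derivative_ident c')+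
    show ?thesis
      unfolding space_partial_def[of i] sp
      by (subst frechet_derivative_at[OF has_derivative_mult[OF 1 2], symmetric])
        (simp add: inner_axis, auto simp: axis_def algebra_simps)
  qed
  show "space_hessian \<phi> (x, t) = (- 2 * H1 (\<psi> (x, t))) *\<^sub>R mat 1
           + (4 * H2 (\<psi> (x, t))) *\<^sub>R outer (x - c t) (x - c t)"
    unfolding space_hessian_def sp2 by (simp add: vec_eq_iff mat_def outer_def)
qed

lemma outer_scaleR: "outer (a *\<^sub>R p) (b *\<^sub>R q) = (a * b) *\<^sub>R outer p q"
  by (simp add: outer_def vec_eq_iff)

text \<open>
  The inequality is linear in \<open>h\<close>: divided by \<open>h\<close>, and up to the time profile \<open>G\<close>, it states
  that the disc \<open>|x - c(t)|\<^sup>2 < \<rho>(t)\<close> moves at least as fast as \<open>V = \<nu> - 1 / |x - c|\<close>. Only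
  the first derivative of the profile \<open>H\<close> enters, since the equation is geometric, so \<open>H\<close> may be as
  steep as one likes.
\<close>

lemma supersolution_radial_test:
  fixes c :: "real \<Rightarrow> real^2" and u :: "(real^2) \<times> real \<Rightarrow> real"
  assumes super: "viscosity_supersolution \<nu> \<Psi>m \<Psi>p u0 u" and cont: "continuous_on spacetime u"
    and \<rho>: "\<And>t. (\<rho> has_real_derivative \<rho>' t) (at t)"
    and c: "\<And>t. (c has_vector_derivative c' t) (at t)"
    and H: "\<And>w. (H has_real_derivative H1 w) (at w)"
    and H1: "\<And>w. (H1 has_real_derivative H2 w) (at w)"
    and G: "\<And>t. (G has_real_derivative G' t) (at t)"
    and smooth: "smooth_on (\<lambda>z. H (\<rho> (snd z) - (norm (fst z - c (snd z)))\<^sup>2) + G (snd z)) spacetime_pos"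
    and t: "t > 0" and below: "u (x, t) < \<Psi>p x"
    and min: "\<forall>\<^sub>F z in nhds (x, t).
        u (x, t) - (H (\<rho> t - (norm (x - c t))\<^sup>2) + G t)
        \<le> u z - (H (\<rho> (snd z) - (norm (fst z - c (snd z)))\<^sup>2) + G (snd z))"
    and h: "h = H1 (\<rho> t - (norm (x - c t))\<^sup>2)" "h > 0"
  shows "0 \<le> h * (\<rho>' t + 2 * ((x - c t) \<bullet> c' t) - 2 * \<nu> * norm (x - c t) + 2) + G' t"
proof -
  define \<phi> where "\<phi> = (\<lambda>z. H (\<rho> (snd z) - (norm (fst z - c (snd z)))\<^sup>2) + G (snd z))"
  note der = radial_test_derivatives[OF \<rho> c H H1 G, of x t, folded \<phi>_def, unfolded fst_conv snd_conv, folded h(1)]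
  have env: "lsc_envelope spacetime u (y, s) = ereal (u (y, s))" if "s \<ge> 0" for y s
    by (rule lsc_envelope_eq[OF cont]) (use that in auto)
  have "\<forall>\<^sub>F z in nhds (x, t). z \<in> spacetime_pos"
    using open_spacetime_pos t by (intro eventually_nhds_in_open) auto
  then have ev: "\<forall>\<^sub>F z in nhds (x, t). lsc_envelope spacetime u z - ereal (\<phi> z)
     \<ge> lsc_envelope spacetime u (x, t) - ereal (\<phi> (x, t))"
    using min by eventually_elim (use env t in \<open>auto simp: \<phi>_def\<close>)
  have "ereal (time_deriv \<phi> (x, t) - \<nu> * norm (space_grad \<phi> (x, t)))
          + curvature_op_upper (space_grad \<phi> (x, t)) (space_hessian \<phi> (x, t)) \<ge> 0"
    using super[unfolded viscosity_supersolution_def Let_def, THEN conjunct2, THEN conjunct2, rule_format, of \<phi> t x]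
      smooth t ev env[of t x] below by (auto simp: \<phi>_def)
  moreover have "curvature_op_upper (space_grad \<phi> (x, t)) (space_hessian \<phi> (x, t)) \<le> ereal (2 * h)"
    by (rule curvature_op_upper_radial[where k = "H2 (\<rho> t - (norm (x - c t))\<^sup>2) / h\<^sup>2"])
      (use h(2) in \<open>simp only: der outer_scaleR, simp add: power2_eq_square\<close>)
  ultimately have "0 \<le> ereal (time_deriv \<phi> (x, t) - \<nu> * norm (space_grad \<phi> (x, t))) + ereal (2 * h)"
    by (meson add_left_mono order_trans)
  then have "0 \<le> time_deriv \<phi> (x, t) - \<nu> * norm (space_grad \<phi> (x, t)) + 2 * h"
    by simp
  also have "\<dots> = h * (\<rho>' t + 2 * ((x - c t) \<bullet> c' t) - 2 * \<nu> * norm (x - c t) + 2) + G' t"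
    unfolding der norm_scaleR using h(2) by (simp add: abs_mult algebra_simps)
  finally show ?thesis .
qed

lemma subsolution_radial_test:
  fixes c :: "real \<Rightarrow> real^2" and u :: "(real^2) \<times> real \<Rightarrow> real"
  assumes sub: "viscosity_subsolution \<nu> \<Psi>m \<Psi>p u0 u" and cont: "continuous_on spacetime u"
    and \<rho>: "\<And>t. (\<rho> has_real_derivative \<rho>' t) (at t)"
    and c: "\<And>t. (c has_vector_derivative c' t) (at t)"
    and H: "\<And>w. (H has_real_derivative H1 w) (at w)"
    and H1: "\<And>w. (H1 has_real_derivative H2 w) (at w)"
    and G: "\<And>t. (G has_real_derivative G' t) (at t)"
    and smooth: "smooth_on (\<lambda>z. H (\<rho> (snd z) - (norm (fst z - c (snd z)))\<^sup>2) + G (snd z)) spacetime_pos"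
    and t: "t > 0" and above: "u (x, t) > \<Psi>m x"
    and max: "\<forall>\<^sub>F z in nhds (x, t).
        u z - (H (\<rho> (snd z) - (norm (fst z - c (snd z)))\<^sup>2) + G (snd z))
        \<le> u (x, t) - (H (\<rho> t - (norm (x - c t))\<^sup>2) + G t)"
    and h: "h = H1 (\<rho> t - (norm (x - c t))\<^sup>2)" "h > 0"
  shows "h * (\<rho>' t + 2 * ((x - c t) \<bullet> c' t) - 2 * \<nu> * norm (x - c t) + 2) + G' t \<le> 0"
proof -
  define \<phi> where "\<phi> = (\<lambda>z. H (\<rho> (snd z) - (norm (fst z - c (snd z)))\<^sup>2) + G (snd z))"
  note der = radial_test_derivatives[OF \<rho> c H H1 G, of x t, folded \<phi>_def, unfolded fst_conv snd_conv, folded h(1)]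
  have env: "usc_envelope spacetime u (y, s) = ereal (u (y, s))" if "s \<ge> 0" for y s
    by (rule usc_envelope_eq[OF cont]) (use that in auto)
  have "\<forall>\<^sub>F z in nhds (x, t). z \<in> spacetime_pos"
    using open_spacetime_pos t by (intro eventually_nhds_in_open) auto
  then have ev: "\<forall>\<^sub>F z in nhds (x, t). usc_envelope spacetime u z - ereal (\<phi> z)
     \<le> usc_envelope spacetime u (x, t) - ereal (\<phi> (x, t))"
    using max by eventually_elim (use env t in \<open>auto simp: \<phi>_def\<close>)
  have "ereal (time_deriv \<phi> (x, t) - \<nu> * norm (space_grad \<phi> (x, t)))
          + curvature_op_lower (space_grad \<phi> (x, t)) (space_hessian \<phi> (x, t)) \<le> 0"
    using sub[unfolded viscosity_subsolution_def Let_def, THEN conjunct2, THEN conjunct2, rule_format, of \<phi> t x]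
      smooth t ev env[of t x] above by (auto simp: \<phi>_def)
  moreover have "ereal (2 * h) \<le> curvature_op_lower (space_grad \<phi> (x, t)) (space_hessian \<phi> (x, t))"
    by (rule curvature_op_lower_radial[where k = "H2 (\<rho> t - (norm (x - c t))\<^sup>2) / h\<^sup>2"])
      (use h(2) in \<open>simp only: der outer_scaleR, simp add: power2_eq_square\<close>)
  ultimately have "ereal (time_deriv \<phi> (x, t) - \<nu> * norm (space_grad \<phi> (x, t))) + ereal (2 * h) \<le> 0"
    by (meson add_left_mono order_trans)
  then have "time_deriv \<phi> (x, t) - \<nu> * norm (space_grad \<phi> (x, t)) + 2 * h \<le> 0"
    by simp
  also have "time_deriv \<phi> (x, t) - \<nu> * norm (space_grad \<phi> (x, t)) + 2 * h
      = h * (\<rho>' t + 2 * ((x - c t) \<bullet> c' t) - 2 * \<nu> * norm (x - c t) + 2) + G' t"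
    unfolding der norm_scaleR using h(2) by (simp add: abs_mult algebra_simps)
  finally show ?thesis .
qed

section \<open>Comparison with moving discs\<close>

lemma norm_squared_2: "(norm (v :: real^2))\<^sup>2 = v $ 1 * v $ 1 + v $ 2 * v $ 2"
  by (simp add: norm_vec_def L2_set_def UNIV_2 power2_eq_square)

lemma smooth_moving_disc:
  fixes v0 v1 :: "real^2"
  shows "smooth_on (\<lambda>z. r0 + r1 * exp (- \<kappa> * snd z) + r2 * (exp (- \<kappa> * snd z))\<^sup>2
     - (norm (fst z - (v0 + exp (- \<kappa> * snd z) *\<^sub>R v1)))\<^sup>2) spacetime_pos"
  unfolding norm_squared_2 vector_minus_component vector_add_component vector_scaleR_component
    real_scaleR_def
  unfolding power2_eq_square
  by (intro smooth_on_diff smooth_on_intros)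

text \<open>
  The profile \<open>\<epsilon> exp (b w)\<close> imitates a step: with \<open>b\<close> large it exceeds any given bound for
  \<open>w \<ge> \<delta>\<close>, while for \<open>w \<le> - \<delta>\<close> its slope is so small that the curvature and
  forcing terms there, of size \<open>B\<close>, are dominated by the margin \<open>m\<close>.
\<close>

lemma sharp_exponent:
  fixes \<epsilon> \<delta> m M B :: real
  assumes "\<epsilon> > 0" "\<delta> > 0" "m > 0"
  obtains b where "b > 0" "M < \<epsilon> * exp (b * \<delta>)" "\<epsilon> * b * exp (- (b * \<delta>)) * B < m"
proof -
  define b where "b = \<bar>M\<bar> / (\<epsilon> * \<delta>) + 2 * \<epsilon> * (\<bar>B\<bar> + 1) / (\<delta>\<^sup>2 * m) + 1"
  have b1: "b \<ge> 1" using assms by (simp add: b_def)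
  have "\<bar>M\<bar> / (\<epsilon> * \<delta>) \<le> b" using assms by (simp add: b_def)
  then have "\<bar>M\<bar> \<le> \<epsilon> * (b * \<delta>)" using assms by (simp add: field_simps)
  also have "b * \<delta> < exp (b * \<delta>)"
    using exp_ge_add_one_self[of "b * \<delta>"] by linarith
  then have "\<epsilon> * (b * \<delta>) < \<epsilon> * exp (b * \<delta>)"
    using assms by (intro mult_strict_left_mono) auto
  finally have 1: "M < \<epsilon> * exp (b * \<delta>)" by linarith
  have "2 * \<epsilon> * (\<bar>B\<bar> + 1) / (\<delta>\<^sup>2 * m) \<le> b" using assms by (simp add: b_def)
  then have "2 * \<epsilon> * (\<bar>B\<bar> + 1) \<le> b * \<delta>\<^sup>2 * m"
    using assms by (simp add: field_simps)
  then have "2 * \<epsilon> * (\<bar>B\<bar> + 1) * b \<le> b * \<delta>\<^sup>2 * m * b"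
    using b1 by (intro mult_right_mono) auto
  then have "\<epsilon> * b * (\<bar>B\<bar> + 1) \<le> m * ((b * \<delta>)\<^sup>2 / 2)"
    by (simp add: power2_eq_square algebra_simps)
  also have "(b * \<delta>)\<^sup>2 / 2 < exp (b * \<delta>)"
  proof -
    have "0 \<le> b * \<delta>" using assms b1 by simp
    from exp_lower_Taylor_quadratic[OF this] this show ?thesis by linarith
  qed
  then have "m * ((b * \<delta>)\<^sup>2 / 2) < m * exp (b * \<delta>)"
    using assms by (intro mult_strict_left_mono) auto
  finally have "\<epsilon> * b * (\<bar>B\<bar> + 1) * exp (- (b * \<delta>)) < m"
    by (simp add: exp_minus field_simps)
  moreover have "\<epsilon> * b * exp (- (b * \<delta>)) * B \<le> \<epsilon> * b * (\<bar>B\<bar> + 1) * exp (- (b * \<delta>))"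
    using assms b1 by (simp add: mult.assoc mult_left_mono mult.commute[of B])
  ultimately show ?thesis using that[of b] 1 b1 by linarith
qed

lemma exp_rate:
  fixes \<epsilon> C :: real
  assumes "\<epsilon> > 0"
  obtains L where "L > 0" "C < \<epsilon> * exp L"
proof -
  define L where "L = (\<bar>C\<bar> + 1) / \<epsilon>"
  have "L > 0" "C < \<epsilon> * L" using assms by (simp_all add: L_def add_nonneg_pos)
  moreover have "\<epsilon> * L \<le> \<epsilon> * exp L"
    using assms exp_ge_add_one_self[of L] by (intro mult_left_mono) linarith+
  ultimately show ?thesis using that[of L] by simp
qed

lemma compact_abs_bound:
  fixes f :: "'a::topological_space \<Rightarrow> real"
  assumes "compact Q" "continuous_on Q f"
  obtains M where "\<And>z. z \<in> Q \<Longrightarrow> \<bar>f z\<bar> \<le> M"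
proof -
  have "bounded (f ` Q)"
    using assms by (intro compact_imp_bounded compact_continuous_image)
  then obtain M where "\<forall>y\<in>f ` Q. norm y \<le> M" unfolding bounded_iff ..
  then show ?thesis using that[of M] by simp
qed

lemma abs_inner_bound:
  fixes x y :: "real^2"
  assumes "norm x \<le> a" "norm y \<le> b"
  shows "\<bar>x \<bullet> y\<bar> \<le> a * b"
  using assms by (meson Cauchy_Schwarz_ineq2 mult_mono norm_ge_zero order_trans)

text \<open>
  The centre moves along a segment and the squared radius is a quadratic polynomial, both in the
  parameter \<open>exp (- \<kappa> t)\<close>, which falls from 1 to 0. The schedule is smooth, never stops, and by the
  choice of \<open>\<kappa>\<close> runs as slowly as needed.
\<close>

lemma moving_disc_derivs:
  fixes v0 v1 :: "real^2"
  shows "((\<lambda>t. v0 + exp (- \<kappa> * t) *\<^sub>R v1) has_vector_derivative (- \<kappa> * exp (- \<kappa> * t)) *\<^sub>R v1) (at t)"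
    and "((\<lambda>t. r0 + r1 * exp (- \<kappa> * t) + r2 * (exp (- \<kappa> * t))\<^sup>2) has_real_derivative
       - \<kappa> * exp (- \<kappa> * t) * (r1 + 2 * r2 * exp (- \<kappa> * t))) (at t)"
  by (auto intro!: derivative_eq_intros simp: algebra_simps power2_eq_square)

lemma moving_disc_limit:
  fixes v0 v1 x :: "real^2"
  assumes "\<kappa> > 0"
  shows "((\<lambda>t. r0 + r1 * exp (- \<kappa> * t) + r2 * (exp (- \<kappa> * t))\<^sup>2
     - (norm (x - (v0 + exp (- \<kappa> * t) *\<^sub>R v1)))\<^sup>2) \<longlongrightarrow> r0 - (norm (x - v0))\<^sup>2) at_top"
proof -
  have "((\<lambda>t. exp (- \<kappa> * t)) \<longlongrightarrow> 0) at_top"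
    by (intro filterlim_compose[OF exp_at_bot] filterlim_tendsto_neg_mult_at_bot[OF tendsto_const])
      (use assms in \<open>auto simp: filterlim_ident\<close>)
  then have "((\<lambda>t. r0 + r1 * exp (- \<kappa> * t) + r2 * (exp (- \<kappa> * t))\<^sup>2
     - (norm (x - (v0 + exp (- \<kappa> * t) *\<^sub>R v1)))\<^sup>2)
     \<longlongrightarrow> r0 + r1 * 0 + r2 * 0\<^sup>2 - (norm (x - (v0 + 0 *\<^sub>R v1)))\<^sup>2) at_top"
    by (intro tendsto_intros)
  then show ?thesis by simp
qed

lemma moving_disc_speed:
  fixes v0 v1 x :: "real^2"
  assumes "\<kappa> \<ge> 0" "\<theta> \<in> {0..1}" "norm y \<le> d"
  shows "\<bar>- \<kappa> * \<theta> * (r1 + 2 * r2 * \<theta>) + 2 * (y \<bullet> ((- \<kappa> * \<theta>) *\<^sub>R v1))\<bar>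
    \<le> \<kappa> * (\<bar>r1\<bar> + 2 * \<bar>r2\<bar> + 2 * (d * norm v1))"
proof -
  have 1: "\<bar>r2 * \<theta>\<bar> \<le> \<bar>r2\<bar>" using assms by (auto simp: abs_mult mult_left_le)
  have 2: "\<bar>y \<bullet> v1\<bar> \<le> d * norm v1" using assms by (intro abs_inner_bound) auto
  have "\<bar>r1 + 2 * r2 * \<theta> + 2 * (y \<bullet> v1)\<bar> \<le> \<bar>r1\<bar> + 2 * \<bar>r2\<bar> + 2 * (d * norm v1)"
    using 1 2 by linarith
  moreover have "\<kappa> * \<theta> \<le> \<kappa>" "0 \<le> \<kappa> * \<theta>" using assms by (auto simp: mult_left_le)
  ultimately have "(\<kappa> * \<theta>) * \<bar>r1 + 2 * r2 * \<theta> + 2 * (y \<bullet> v1)\<bar>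
      \<le> \<kappa> * (\<bar>r1\<bar> + 2 * \<bar>r2\<bar> + 2 * (d * norm v1))"
    using assms by (intro mult_mono) auto
  moreover have "- \<kappa> * \<theta> * (r1 + 2 * r2 * \<theta>) + 2 * (y \<bullet> ((- \<kappa> * \<theta>) *\<^sub>R v1))
     = - (\<kappa> * \<theta>) * (r1 + 2 * r2 * \<theta> + 2 * (y \<bullet> v1))"
    by (simp add: algebra_simps)
  ultimately show ?thesis
    by (simp only: abs_mult[of "- (\<kappa> * \<theta>)"] abs_minus_cancel abs_of_nonneg[OF \<open>0 \<le> \<kappa> * \<theta>\<close>])
qed

lemma eventually_nhds_interior_prod:
  assumes "x \<in> interior X" "t0 < t" "t < t1"
  shows "\<forall>\<^sub>F z in nhds (x, t :: real). fst z \<in> X \<and> snd z \<in> {t0..t1}"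
proof -
  have "\<forall>\<^sub>F z in nhds (x, t). z \<in> interior X \<times> {t0<..<t1}"
    using assms by (intro eventually_nhds_in_open open_Times) auto
  then show ?thesis
    by (rule eventually_mono) (use interior_subset[of X] in auto)
qed

text \<open>
  Discs of radius less than \<open>1 / \<nu>\<close> want to shrink, so such a disc, moved slowly enough, is an
  obstacle which a subsolution cannot cross. The subsolution is compared with
  \<open>\<mu> + \<epsilon> exp (b \<psi>) + \<epsilon> exp (L (t - T))\<close>, where \<open>\<psi>\<close> is positive in the disc.
  Inside the disc, away from its boundary, the second term is huge, and this takes care of the initial
  values and of the lower obstacle. Far outside, at distance more than \<open>1 / \<nu>\<close> from the centre, the barrier
  has the wrong sign, but there its slope is negligible against the time derivative of the third term.
  That term is at most \<open>\<epsilon>\<close> up to time \<open>T\<close> and exceeds all values at time \<open>T + 1\<close>,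
  so that a maximum is attained at an interior time.
\<close>

lemma subsolution_vanishes_outside_moving_disc:
  fixes v0 v1 :: "real^2" and u :: "(real^2) \<times> real \<Rightarrow> real"
  assumes sub: "viscosity_subsolution \<nu> \<Psi>m \<Psi>p u0 u" and cont: "continuous_on spacetime u"
    and far: "\<And>T. T > 0 \<Longrightarrow> \<exists>R>0. \<forall>x t. norm x \<ge> R \<and> 0 \<le> t \<and> t \<le> T \<longrightarrow> u (x, t) = a"
    and a: "a < \<mu>" and \<nu>: "\<nu> > 0" and \<delta>: "\<delta> > 0"
    and P: "\<And>\<theta>. \<theta> \<in> {0..1} \<Longrightarrow> r0 + r1 * \<theta> + r2 * \<theta>\<^sup>2 \<le> P" "P < (1 / \<nu>)\<^sup>2"
    and obst: "\<And>x \<theta>. \<Psi>m x > \<mu> \<Longrightarrow> \<theta> \<in> {0..1} \<Longrightarrow>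
        \<delta> \<le> r0 + r1 * \<theta> + r2 * \<theta>\<^sup>2 - (norm (x - (v0 + \<theta> *\<^sub>R v1)))\<^sup>2"
    and init: "\<And>x. u (x, 0) > \<mu> \<Longrightarrow> \<delta> \<le> r0 + r1 + r2 - (norm (x - (v0 + v1)))\<^sup>2"
    and x: "r0 < (norm (x - v0))\<^sup>2"
  shows "\<exists>\<tau>>0. \<forall>t>\<tau>. u (x, t) \<le> \<mu>"
proof -
  \<comment> \<open>\<open>R0\<close> separates the radii of the discs from the critical radius \<open>1 / \<nu>\<close>: up to distance \<open>R0\<close>
    from the centre the barrier is strict, and beyond it \<open>\<psi>\<close> is bounded away from 0\<close>
  define R0 where "R0 = sqrt ((max P 0 + (1 / \<nu>)\<^sup>2) / 2)"
  have R0: "P < R0\<^sup>2" "R0 < 1 / \<nu>" "R0 > 0"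
  proof -
    define i where "i = (1 / \<nu>)\<^sup>2"
    have "i > 0" "P < i" using \<nu> P(2) by (simp_all add: i_def)
    then have "(max P 0 + (1 / \<nu>)\<^sup>2) / 2 < (1 / \<nu>)\<^sup>2" "(max P 0 + (1 / \<nu>)\<^sup>2) / 2 > 0"
      "P < (max P 0 + (1 / \<nu>)\<^sup>2) / 2"
      unfolding i_def[symmetric] by (auto simp: max_def)
    then show "R0 < 1 / \<nu>" "R0 > 0" unfolding R0_def
      using \<nu> by (auto intro!: real_less_lsqrt)
    show "P < R0\<^sup>2" unfolding R0_def
      using \<open>P < (max P 0 + (1 / \<nu>)\<^sup>2) / 2\<close> by (subst real_sqrt_pow2) simp_all
  qed
  define C where "C = \<bar>r1\<bar> + 2 * \<bar>r2\<bar> + 2 * (R0 * norm v1) + 1"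
  have C: "C > 0" using R0 by (simp add: C_def add_nonneg_pos)
  define \<kappa> where "\<kappa> = (1 - \<nu> * R0) / C"
  have \<kappa>: "\<kappa> > 0" "\<kappa> * (\<bar>r1\<bar> + 2 * \<bar>r2\<bar> + 2 * (R0 * norm v1)) < 2 - 2 * \<nu> * R0"
  proof -
    have "\<nu> * R0 < 1" using R0 \<nu> by (simp add: field_simps)
    then show "\<kappa> > 0" using C by (simp add: \<kappa>_def)
    moreover have "\<kappa> * C = 1 - \<nu> * R0" using C by (simp add: \<kappa>_def)
    ultimately show "\<kappa> * (\<bar>r1\<bar> + 2 * \<bar>r2\<bar> + 2 * (R0 * norm v1)) < 2 - 2 * \<nu> * R0"
      using \<open>\<nu> * R0 < 1\<close> unfolding C_def by (simp add: algebra_simps)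
  qed
  define \<theta> where "\<theta> = (\<lambda>t. exp (- \<kappa> * t))"
  have \<theta>: "\<theta> t \<in> {0..1}" if "t \<ge> 0" for t using \<kappa> that by (simp add: \<theta>_def)
  define c where "c = (\<lambda>t. v0 + \<theta> t *\<^sub>R v1)"
  define \<rho> where "\<rho> = (\<lambda>t. r0 + r1 * \<theta> t + r2 * (\<theta> t)\<^sup>2)"
  define \<psi> where "\<psi> = (\<lambda>z. \<rho> (snd z) - (norm (fst z - c (snd z)))\<^sup>2)"
  have cont_\<psi>: "continuous_on S \<psi>" for S
    unfolding \<psi>_def \<rho>_def c_def \<theta>_def by (intro continuous_intros)
  have claim: "u (y, T) \<le> \<mu>" if T: "T > 0" and y: "\<psi> (y, T) \<le> 0" for y T
  proof (rule field_le_epsilon)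
    fix e :: real assume "e > 0"
    define \<epsilon> where "\<epsilon> = e / 2"
    have \<epsilon>: "\<epsilon> > 0" using \<open>e > 0\<close> by (simp add: \<epsilon>_def)
    obtain R where R: "R > 0" "\<And>x t. norm x \<ge> R \<Longrightarrow> 0 \<le> t \<Longrightarrow> t \<le> T + 1 \<Longrightarrow> u (x, t) = a"
      using far[of "T + 1"] T by auto
    define Q where "Q = cball (0 :: real^2) R \<times> {0..T + 1}"
    have Q: "compact Q" "Q \<noteq> {}" "Q \<subseteq> spacetime"
      using R T by (auto simp: Q_def compact_Times)
    have cQ: "continuous_on Q u" using cont Q(3) continuous_on_subset by blast
    obtain M where M: "\<And>z. z \<in> Q \<Longrightarrow> \<bar>u z\<bar> \<le> M"
      using compact_abs_bound[OF Q(1) cQ] by blast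
    obtain L where L: "L > 0" "\<epsilon> * exp L > M - \<mu>" by (rule exp_rate[OF \<epsilon>])
    define m where "m = \<epsilon> * L * exp (- L * T)"
    have m: "m > 0" using \<epsilon> L by (simp add: m_def)
    define d where "d = R + norm v0 + norm v1"
    define B where "B = \<kappa> * (\<bar>r1\<bar> + 2 * \<bar>r2\<bar> + 2 * (d * norm v1)) + 2 * \<nu> * d + 2"
    define \<delta>' where "\<delta>' = min \<delta> (R0\<^sup>2 - P)"
    have \<delta>': "\<delta>' > 0" using \<delta> R0 by (simp add: \<delta>'_def)
    obtain b where b: "b > 0" "M - \<mu> < \<epsilon> * exp (b * \<delta>')" "\<epsilon> * b * exp (- (b * \<delta>')) * B < m"
      using sharp_exponent[OF \<epsilon> \<delta>' m] by blast
    define H where "H = (\<lambda>w. \<epsilon> * exp (b * w))"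
    define G where "G = (\<lambda>t. \<epsilon> * exp (L * (t - T)))"
    define f where "f = (\<lambda>z. u z - (H (\<psi> z) + G (snd z)))"
    have "continuous_on Q f"
      unfolding f_def H_def G_def by (intro continuous_intros cQ cont_\<psi>)
    from continuous_attains_sup[OF Q(1,2) this] obtain z where
      z: "z \<in> Q" and zmax: "\<And>y. y \<in> Q \<Longrightarrow> f y \<le> f z" by blast
    obtain x0 t0 where zx: "z = (x0, t0)" by force
    have t0: "0 \<le> t0" "t0 \<le> T + 1" using z by (auto simp: Q_def zx)
    have big: "M - \<mu> < H w" if "\<delta> \<le> w" for w
    proof -
      have "b * \<delta>' \<le> b * w" using b(1) that by (simp add: \<delta>'_def)
      then have "\<epsilon> * exp (b * \<delta>') \<le> H w" unfolding H_def using \<epsilon> by simp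
      with b(2) show ?thesis by linarith
    qed
    have pos: "H w > 0" "G t > 0" for w t using \<epsilon> by (auto simp: H_def G_def)
    have "f z \<le> \<mu>"
    proof (rule ccontr)
      assume "\<not> f z \<le> \<mu>"
      then have fz: "u (x0, t0) > \<mu> + H (\<psi> (x0, t0)) + G t0" by (simp add: f_def zx)
      then have ul: "u (x0, t0) > \<mu>" using pos(1)[of "\<psi> (x0, t0)"] pos(2)[of t0] by linarith
      have uM: "u (x0, t0) \<le> M" using M[OF z] by (simp add: zx)
      have nd: "\<psi> (x0, t0) < \<delta>"
        using big[of "\<psi> (x0, t0)"] fz uM pos(2)[of t0] by force
      have x0: "norm x0 < R" using R(2)[of x0 t0] t0 ul a by force
      have "t0 \<noteq> 0" using init[of x0] ul nd by (auto simp: \<psi>_def \<rho>_def c_def \<theta>_def)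
      then have t0': "0 < t0" using t0 by simp
      have "t0 \<noteq> T + 1" using fz uM L(2) pos(1)[of "\<psi> (x0, t0)"] by (auto simp: G_def)
      then have t0'': "t0 < T + 1" using t0 by simp
      have "ereal (\<Psi>m x0) \<le> usc_envelope spacetime u (x0, t0)"
        using sub t0' by (simp add: viscosity_subsolution_def Let_def)
      then have "\<Psi>m x0 \<le> u (x0, t0)"
        using usc_envelope_eq[OF cont, of "(x0, t0)"] t0 by simp
      moreover have "\<Psi>m x0 \<le> \<mu>"
        using obst[of x0 "\<theta> t0"] nd \<theta>[OF t0(1)] by (force simp: \<psi>_def \<rho>_def c_def)
      ultimately have above: "u (x0, t0) > \<Psi>m x0" using ul by linarith
      have ev: "\<forall>\<^sub>F y in nhds (x0, t0). f y \<le> f (x0, t0)"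
      proof -
        have "x0 \<in> interior (cball 0 R)" using x0 by simp
        from eventually_nhds_interior_prod[OF this t0' t0''] show ?thesis
          by (rule eventually_mono) (use zmax in \<open>auto simp: zx Q_def\<close>)
      qed
      have sm: "smooth_on (\<lambda>z. H (\<psi> z) + G (snd z)) spacetime_pos"
        unfolding H_def G_def \<psi>_def \<rho>_def c_def \<theta>_def
        by (intro smooth_on_intros smooth_moving_disc smooth_on_diff)
      define h where "h = \<epsilon> * b * exp (b * \<psi> (x0, t0))"
      have h: "h > 0" using \<epsilon> b by (simp add: h_def)
      define br where "br = - \<kappa> * \<theta> t0 * (r1 + 2 * r2 * \<theta> t0) + 2 * ((x0 - c t0) \<bullet> ((- \<kappa> * \<theta> t0) *\<^sub>R v1))
         - 2 * \<nu> * norm (x0 - c t0) + 2"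
      have "h * br + \<epsilon> * L * exp (L * (t0 - T)) \<le> 0"
        unfolding br_def
      proof (rule subsolution_radial_test[OF sub cont, where H = H and G = G and \<rho> = \<rho> and c = c
            and x = x0 and t = t0 and ?H1.0 = "\<lambda>w. \<epsilon> * b * exp (b * w)" and ?H2.0 = "\<lambda>w. \<epsilon> * b * b * exp (b * w)"
            and ?G' = "\<lambda>t. \<epsilon> * L * exp (L * (t - T))" and ?\<rho>' = "\<lambda>t. - \<kappa> * \<theta> t * (r1 + 2 * r2 * \<theta> t)"
            and ?c' = "\<lambda>t. (- \<kappa> * \<theta> t) *\<^sub>R v1"])
        show "(\<rho> has_real_derivative - \<kappa> * \<theta> t * (r1 + 2 * r2 * \<theta> t)) (at t)" for t
          unfolding \<rho>_def \<theta>_def by (rule moving_disc_derivs)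
        show "(c has_vector_derivative (- \<kappa> * \<theta> t) *\<^sub>R v1) (at t)" for t
          unfolding c_def \<theta>_def by (rule moving_disc_derivs)
        show "smooth_on (\<lambda>z. H (\<rho> (snd z) - (norm (fst z - c (snd z)))\<^sup>2) + G (snd z)) spacetime_pos"
          using sm by (simp add: \<psi>_def)
        show "\<forall>\<^sub>F z in nhds (x0, t0). u z - (H (\<rho> (snd z) - (norm (fst z - c (snd z)))\<^sup>2) + G (snd z))
          \<le> u (x0, t0) - (H (\<rho> t0 - (norm (x0 - c t0))\<^sup>2) + G t0)"
          using ev by (simp add: f_def \<psi>_def)
        show "h = \<epsilon> * b * exp (b * (\<rho> t0 - (norm (x0 - c t0))\<^sup>2))" by (simp add: h_def \<psi>_def)
      qed (use t0' above h in \<open>auto simp: H_def G_def intro!: derivative_eq_intros\<close>)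
      moreover have "m \<le> \<epsilon> * L * exp (L * (t0 - T))"
        unfolding m_def using \<epsilon> L t0 by (simp add: algebra_simps)
      moreover have "h * br > - m"
      proof (cases "norm (x0 - c t0) \<le> R0")
        case True
        have "\<bar>- \<kappa> * \<theta> t0 * (r1 + 2 * r2 * \<theta> t0) + 2 * ((x0 - c t0) \<bullet> ((- \<kappa> * \<theta> t0) *\<^sub>R v1))\<bar>
          \<le> \<kappa> * (\<bar>r1\<bar> + 2 * \<bar>r2\<bar> + 2 * (R0 * norm v1))"
          using \<kappa> \<theta>[OF t0(1)] True by (intro moving_disc_speed) auto
        moreover have "2 * \<nu> * norm (x0 - c t0) \<le> 2 * \<nu> * R0" using True \<nu> by simp
        ultimately have "br > 0" using \<kappa>(2) unfolding br_def by linarith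
        then have "h * br > 0" using h by simp
        then show ?thesis using m by linarith
      next
        case False
        have "norm (x0 - c t0) \<le> d"
        proof -
          have "norm (\<theta> t0 *\<^sub>R v1) \<le> norm v1" using \<theta>[OF t0(1)] by (simp add: mult_left_le_one_le)
          then show ?thesis
            using x0 norm_triangle_ineq4[of x0 "c t0"] norm_triangle_ineq[of v0 "\<theta> t0 *\<^sub>R v1"]
            unfolding c_def d_def by linarith
        qed
        then have "\<bar>- \<kappa> * \<theta> t0 * (r1 + 2 * r2 * \<theta> t0) + 2 * ((x0 - c t0) \<bullet> ((- \<kappa> * \<theta> t0) *\<^sub>R v1))\<bar>
          \<le> \<kappa> * (\<bar>r1\<bar> + 2 * \<bar>r2\<bar> + 2 * (d * norm v1))"
          using \<kappa> \<theta>[OF t0(1)] by (intro moving_disc_speed) auto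
        moreover have "2 * \<nu> * norm (x0 - c t0) \<le> 2 * \<nu> * d"
          using \<open>norm (x0 - c t0) \<le> d\<close> \<nu> by simp
        ultimately have br: "- B \<le> br" unfolding br_def B_def by linarith
        have B0: "B \<ge> 0" using \<kappa>(1) \<nu> R by (auto simp: B_def d_def intro!: add_nonneg_nonneg mult_nonneg_nonneg)
        have "R0\<^sup>2 < (norm (x0 - c t0))\<^sup>2" using False R0 by (intro power_strict_mono) auto
        then have "\<psi> (x0, t0) \<le> - \<delta>'"
          using P(1)[OF \<theta>[OF t0(1)]] by (simp add: \<psi>_def \<rho>_def \<delta>'_def)
        then have "b * \<psi> (x0, t0) \<le> - (b * \<delta>')"
          using b(1) mult_left_mono[of "\<psi> (x0, t0)" "- \<delta>'" b] by simp
        then have "h \<le> \<epsilon> * b * exp (- (b * \<delta>'))" unfolding h_def using \<epsilon> b by simp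
        then have "h * B \<le> \<epsilon> * b * exp (- (b * \<delta>')) * B" using B0 by (rule mult_right_mono)
        moreover have "h * (- B) \<le> h * br" using br h by (intro mult_left_mono) auto
        ultimately show ?thesis using b(3) by simp
      qed
      ultimately show False by linarith
    qed
    show "u (y, T) \<le> \<mu> + e"
    proof (cases "norm y \<le> R")
      case True
      then have "f (y, T) \<le> f z" using zmax T by (simp add: Q_def)
      moreover have "H (\<psi> (y, T)) \<le> \<epsilon>" using y \<epsilon> b by (simp add: H_def mult_le_0_iff)
      ultimately show ?thesis using \<open>f z \<le> \<mu>\<close> by (simp add: f_def G_def \<epsilon>_def)
    next
      case False
      then show ?thesis using R(2)[of y T] T a \<open>e > 0\<close> by simp
    qed
  qed
  have "((\<lambda>t. \<psi> (x, t)) \<longlongrightarrow> r0 - (norm (x - v0))\<^sup>2) at_top"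
    unfolding \<psi>_def \<rho>_def c_def \<theta>_def fst_conv snd_conv by (rule moving_disc_limit[OF \<kappa>(1)])
  then have "\<forall>\<^sub>F t in at_top. \<psi> (x, t) < 0"
    by (rule order_tendstoD) (use x in simp)
  then obtain \<tau> where \<tau>: "\<And>t. t \<ge> \<tau> \<Longrightarrow> \<psi> (x, t) < 0"
    by (auto simp: eventually_at_top_linorder)
  show ?thesis
    by (intro exI[of _ "max \<tau> 1"] conjI allI impI claim less_imp_le[OF \<tau>]) auto
qed

text \<open>
  The counterpart from inside: discs of radius \<open>R > 1 / \<nu>\<close> want to grow, and a disc translated
  slowly is a barrier below a supersolution. The comparison takes place in a compact set \<open>X\<close> only,
  whose boundary points either belong to the region where \<open>u \<ge> \<mu>\<close> is known for all times, or
  never meet the disc.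
\<close>

lemma supersolution_fills_moving_disc:
  fixes v0 v1 :: "real^2" and u :: "(real^2) \<times> real \<Rightarrow> real"
  assumes super: "viscosity_supersolution \<nu> \<Psi>m \<Psi>p u0 u" and cont: "continuous_on spacetime u"
    and X: "compact X" and \<nu>: "\<nu> > 0" and \<delta>: "\<delta> > 0" and R: "R > 1 / \<nu>"
    and obst: "\<And>x. x \<in> X \<Longrightarrow> \<mu> \<le> \<Psi>p x"
    and bdry: "\<And>x. x \<in> X \<Longrightarrow> x \<in> interior X \<or> (\<forall>t\<ge>0. \<mu> \<le> u (x, t)) \<or>
        (\<forall>\<theta>\<in>{0..1}. R\<^sup>2 - (norm (x - (v0 + \<theta> *\<^sub>R v1)))\<^sup>2 \<le> - \<delta>)"
    and init: "\<And>x. x \<in> X \<Longrightarrow> R\<^sup>2 - (norm (x - (v0 + v1)))\<^sup>2 \<le> - \<delta>"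
    and x: "x \<in> X" "norm (x - v0) < R"
  shows "\<exists>\<tau>>0. \<forall>t>\<tau>. \<mu> \<le> u (x, t)"
proof -
  define R0 where "R0 = (1 / \<nu> + R) / 2"
  have R0: "1 / \<nu> < R0" "R0 < R" "R0 > 0"
  proof -
    define i where "i = 1 / \<nu>"
    have "i > 0" "i < R" using \<nu> R by (simp_all add: i_def)
    then show "1 / \<nu> < R0" "R0 < R" "R0 > 0" by (auto simp: R0_def i_def[symmetric])
  qed
  define \<kappa> where "\<kappa> = (\<nu> - 1 / R0) / (norm v1 + 1)"
  have \<kappa>: "\<kappa> > 0" "\<kappa> * norm v1 \<le> \<nu> - 1 / R0"
  proof -
    have "1 / R0 < \<nu>" using R0 \<nu> by (simp add: field_simps)
    then show \<kappa>0: "\<kappa> > 0" by (simp add: \<kappa>_def add_nonneg_pos)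
    have "norm v1 + 1 > 0" by (simp add: add_nonneg_pos)
    then have "\<kappa> * (norm v1 + 1) = \<nu> - 1 / R0" by (simp add: \<kappa>_def)
    then show "\<kappa> * norm v1 \<le> \<nu> - 1 / R0" using \<kappa>0 by (simp add: algebra_simps)
  qed
  define \<theta> where "\<theta> = (\<lambda>t. exp (- \<kappa> * t))"
  have \<theta>: "\<theta> t \<in> {0..1}" if "t \<ge> 0" for t using \<kappa> that by (simp add: \<theta>_def)
  define c where "c = (\<lambda>t. v0 + \<theta> t *\<^sub>R v1)"
  define \<rho> where "\<rho> = (\<lambda>t. R\<^sup>2 + 0 * \<theta> t + 0 * (\<theta> t)\<^sup>2)"
  define \<psi> where "\<psi> = (\<lambda>z. \<rho> (snd z) - (norm (fst z - c (snd z)))\<^sup>2)"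
  have cont_\<psi>: "continuous_on S \<psi>" for S
    unfolding \<psi>_def \<rho>_def c_def \<theta>_def by (intro continuous_intros)
  have claim: "\<mu> \<le> u (y, T)" if T: "T > 0" and y: "y \<in> X" "0 \<le> \<psi> (y, T)" for y T
  proof (rule field_le_epsilon)
    fix e :: real assume "e > 0"
    define \<epsilon> where "\<epsilon> = e / 2"
    have \<epsilon>: "\<epsilon> > 0" using \<open>e > 0\<close> by (simp add: \<epsilon>_def)
    define Q where "Q = X \<times> {0..T + 1}"
    have Q: "compact Q" "Q \<noteq> {}" "Q \<subseteq> spacetime"
      using X x T by (auto simp: Q_def compact_Times)
    have cQ: "continuous_on Q u" using cont Q(3) continuous_on_subset by blast
    obtain M where M: "\<And>z. z \<in> Q \<Longrightarrow> \<bar>u z\<bar> \<le> M"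
      using compact_abs_bound[OF Q(1) cQ] by blast
    obtain L where L: "L > 0" "\<epsilon> * exp L > M + \<mu>" by (rule exp_rate[OF \<epsilon>])
    define m where "m = \<epsilon> * L * exp (- L * T)"
    have m: "m > 0" using \<epsilon> L by (simp add: m_def)
    define B where "B = \<kappa> * (2 * (R0 * norm v1)) + 2"
    define \<delta>' where "\<delta>' = min \<delta> (R\<^sup>2 - R0\<^sup>2)"
    have "R0\<^sup>2 < R\<^sup>2" using R0 by (intro power_strict_mono) auto
    then have \<delta>': "\<delta>' > 0" using \<delta> by (simp add: \<delta>'_def)
    obtain b where b: "b > 0" "M + \<mu> < \<epsilon> * exp (b * \<delta>')" "\<epsilon> * b * exp (- (b * \<delta>')) * B < m"
      using sharp_exponent[OF \<epsilon> \<delta>' m] by blast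
    define H where "H = (\<lambda>w. - \<epsilon> * exp (- b * w))"
    define G where "G = (\<lambda>t. - \<epsilon> * exp (L * (t - T)))"
    define f where "f = (\<lambda>z. u z - (H (\<psi> z) + G (snd z)))"
    have "continuous_on Q f"
      unfolding f_def H_def G_def by (intro continuous_intros cQ cont_\<psi>)
    from continuous_attains_inf[OF Q(1,2) this] obtain z where
      z: "z \<in> Q" and zmin: "\<And>y. y \<in> Q \<Longrightarrow> f z \<le> f y" by blast
    obtain x0 t0 where zx: "z = (x0, t0)" by force
    have t0: "0 \<le> t0" "t0 \<le> T + 1" and x0X: "x0 \<in> X" using z by (auto simp: Q_def zx)
    have big: "H w < - M - \<mu>" if "w \<le> - \<delta>" for w
    proof -
      have "w \<le> - \<delta>'" using that by (simp add: \<delta>'_def)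
      then have "b * \<delta>' \<le> - b * w" using b(1) mult_left_mono[of w "- \<delta>'" b] by simp
      then have "\<epsilon> * exp (b * \<delta>') \<le> - H w" unfolding H_def using \<epsilon> by simp
      with b(2) show ?thesis by linarith
    qed
    have neg: "H w < 0" "G t < 0" for w t using \<epsilon> by (auto simp: H_def G_def)
    have "\<mu> \<le> f z"
    proof (rule ccontr)
      assume "\<not> \<mu> \<le> f z"
      then have fz: "u (x0, t0) < \<mu> + H (\<psi> (x0, t0)) + G t0" by (simp add: f_def zx)
      then have ul: "u (x0, t0) < \<mu>" using neg(1)[of "\<psi> (x0, t0)"] neg(2)[of t0] by linarith
      have uM: "- M \<le> u (x0, t0)" using M[OF z] by (simp add: zx)
      have nd: "- \<delta> < \<psi> (x0, t0)"
      proof (rule ccontr)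
        assume "\<not> - \<delta> < \<psi> (x0, t0)"
        then have "H (\<psi> (x0, t0)) < - M - \<mu>" by (intro big) simp
        moreover have "H (\<psi> (x0, t0)) > - M - \<mu>" using fz uM neg(2)[of t0] by linarith
        ultimately show False by linarith
      qed
      have "x0 \<in> interior X"
        using bdry[OF x0X] nd ul t0 \<theta>[OF t0(1)] by (force simp: \<psi>_def \<rho>_def c_def)
      have "t0 \<noteq> 0" using init[OF x0X] nd by (auto simp: \<psi>_def \<rho>_def c_def \<theta>_def)
      then have t0': "0 < t0" using t0 by simp
      have "t0 \<noteq> T + 1"
      proof
        assume "t0 = T + 1"
        then have "G t0 = - \<epsilon> * exp L" by (simp add: G_def)
        then show False using fz uM L(2) neg(1)[of "\<psi> (x0, t0)"] by simp
      qed
      then have t0'': "t0 < T + 1" using t0 by simp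
      have below: "u (x0, t0) < \<Psi>p x0" using obst[OF x0X] ul by linarith
      have ev: "\<forall>\<^sub>F y in nhds (x0, t0). f (x0, t0) \<le> f y"
        using eventually_nhds_interior_prod[OF \<open>x0 \<in> interior X\<close> t0' t0'']
        by (rule eventually_mono) (use zmin in \<open>auto simp: zx Q_def\<close>)
      have sm: "smooth_on (\<lambda>z. H (\<psi> z) + G (snd z)) spacetime_pos"
        unfolding H_def G_def \<psi>_def \<rho>_def c_def \<theta>_def
        by (intro smooth_on_intros smooth_moving_disc smooth_on_diff)
      define h where "h = \<epsilon> * b * exp (- b * \<psi> (x0, t0))"
      have h: "h > 0" using \<epsilon> b by (simp add: h_def)
      define br where "br = - \<kappa> * \<theta> t0 * (0 + 2 * 0 * \<theta> t0) + 2 * ((x0 - c t0) \<bullet> ((- \<kappa> * \<theta> t0) *\<^sub>R v1))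
         - 2 * \<nu> * norm (x0 - c t0) + 2"
      have "0 \<le> h * br + - (\<epsilon> * L * exp (L * (t0 - T)))"
        unfolding br_def
      proof (rule supersolution_radial_test[OF super cont, where H = H and G = G and \<rho> = \<rho> and c = c
            and x = x0 and t = t0 and ?H1.0 = "\<lambda>w. \<epsilon> * b * exp (- b * w)" and ?H2.0 = "\<lambda>w. - \<epsilon> * b * b * exp (- b * w)"
            and ?G' = "\<lambda>t. - (\<epsilon> * L * exp (L * (t - T)))" and ?\<rho>' = "\<lambda>t. - \<kappa> * \<theta> t * (0 + 2 * 0 * \<theta> t)"
            and ?c' = "\<lambda>t. (- \<kappa> * \<theta> t) *\<^sub>R v1"])
        show "(\<rho> has_real_derivative - \<kappa> * \<theta> t * (0 + 2 * 0 * \<theta> t)) (at t)" for t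
          unfolding \<rho>_def \<theta>_def by (rule moving_disc_derivs)
        show "(c has_vector_derivative (- \<kappa> * \<theta> t) *\<^sub>R v1) (at t)" for t
          unfolding c_def \<theta>_def by (rule moving_disc_derivs)
        show "smooth_on (\<lambda>z. H (\<rho> (snd z) - (norm (fst z - c (snd z)))\<^sup>2) + G (snd z)) spacetime_pos"
          using sm by (simp add: \<psi>_def)
        show "\<forall>\<^sub>F z in nhds (x0, t0). u (x0, t0) - (H (\<rho> t0 - (norm (x0 - c t0))\<^sup>2) + G t0)
          \<le> u z - (H (\<rho> (snd z) - (norm (fst z - c (snd z)))\<^sup>2) + G (snd z))"
          using ev by (simp add: f_def \<psi>_def)
        show "h = \<epsilon> * b * exp (- b * (\<rho> t0 - (norm (x0 - c t0))\<^sup>2))" by (simp add: h_def \<psi>_def)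
      qed (use t0' below h in \<open>auto simp: H_def G_def intro!: derivative_eq_intros\<close>)
      moreover have "m \<le> \<epsilon> * L * exp (L * (t0 - T))"
        unfolding m_def using \<epsilon> L t0 by (simp add: algebra_simps)
      moreover have "h * br < m"
      proof (cases "norm (x0 - c t0) < R0")
        case False
        define D where "D = norm (x0 - c t0)"
        have D: "D \<ge> R0" using False by (simp add: D_def)
        have "\<bar>- \<kappa> * \<theta> t0 * (0 + 2 * 0 * \<theta> t0) + 2 * ((x0 - c t0) \<bullet> ((- \<kappa> * \<theta> t0) *\<^sub>R v1))\<bar>
          \<le> \<kappa> * (\<bar>0\<bar> + 2 * \<bar>0\<bar> + 2 * (D * norm v1))"
          using \<kappa> \<theta>[OF t0(1)] by (intro moving_disc_speed) (auto simp: D_def)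
        then have "br \<le> 2 * D * (\<kappa> * norm v1) - 2 * \<nu> * D + 2"
          unfolding br_def D_def[symmetric] by (simp add: algebra_simps)
        also have "\<dots> \<le> 2 * D * (\<nu> - 1 / R0) - 2 * \<nu> * D + 2"
          using \<kappa>(2) D R0 by (intro add_right_mono diff_right_mono mult_left_mono) auto
        also have "\<dots> \<le> 0" using D R0 by (simp add: field_simps)
        finally have "h * br \<le> 0" using h by (simp add: mult_le_0_iff)
        then show ?thesis using m by linarith
      next
        case True
        then have "\<bar>- \<kappa> * \<theta> t0 * (0 + 2 * 0 * \<theta> t0) + 2 * ((x0 - c t0) \<bullet> ((- \<kappa> * \<theta> t0) *\<^sub>R v1))\<bar>
          \<le> \<kappa> * (\<bar>0\<bar> + 2 * \<bar>0\<bar> + 2 * (R0 * norm v1))"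
          using \<kappa> \<theta>[OF t0(1)] by (intro moving_disc_speed) auto
        moreover have "0 \<le> 2 * \<nu> * norm (x0 - c t0)" using \<nu> by simp
        ultimately have br: "br \<le> B" unfolding br_def B_def by simp
        have B0: "B \<ge> 0" using \<kappa>(1) R0 by (auto simp: B_def)
        have "(norm (x0 - c t0))\<^sup>2 \<le> R0\<^sup>2" using True by (intro power_mono) auto
        then have "\<delta>' \<le> \<psi> (x0, t0)"
          by (simp add: \<psi>_def \<rho>_def \<delta>'_def)
        then have "- b * \<psi> (x0, t0) \<le> - (b * \<delta>')"
          using b(1) by simp
        then have "h \<le> \<epsilon> * b * exp (- (b * \<delta>'))" unfolding h_def using \<epsilon> b by simp
        then have "h * B \<le> \<epsilon> * b * exp (- (b * \<delta>')) * B" using B0 by (rule mult_right_mono)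
        moreover have "h * br \<le> h * B" using br h by (intro mult_left_mono) auto
        ultimately show ?thesis using b(3) by simp
      qed
      ultimately show False by linarith
    qed
    have "f z \<le> f (y, T)" using zmin T y by (simp add: Q_def)
    moreover have "- H (\<psi> (y, T)) \<le> \<epsilon>" using y \<epsilon> b by (simp add: H_def mult_le_0_iff)
    ultimately show "\<mu> \<le> u (y, T) + e" using \<open>\<mu> \<le> f z\<close> by (simp add: f_def G_def \<epsilon>_def)
  qed
  have "((\<lambda>t. \<psi> (x, t)) \<longlongrightarrow> R\<^sup>2 - (norm (x - v0))\<^sup>2) at_top"
    unfolding \<psi>_def \<rho>_def c_def \<theta>_def fst_conv snd_conv by (rule moving_disc_limit[OF \<kappa>(1)])
  then have "\<forall>\<^sub>F t in at_top. 0 < \<psi> (x, t)"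
    by (rule order_tendstoD) (use x in \<open>simp add: power_strict_mono\<close>)
  then obtain \<tau> where \<tau>: "\<And>t. t \<ge> \<tau> \<Longrightarrow> 0 < \<psi> (x, t)"
    by (auto simp: eventually_at_top_linorder)
  show ?thesis
    by (intro exI[of _ "max \<tau> 1"] conjI allI impI claim x less_imp_le[OF \<tau>]) auto
qed

section \<open>Curves of bounded curvature\<close>

definition cross2 :: "real^2 \<Rightarrow> real^2 \<Rightarrow> real" where
  "cross2 a b = a $ 1 * b $ 2 - a $ 2 * b $ 1"

lemma inner_2: "(a :: real^2) \<bullet> b = a $ 1 * b $ 1 + a $ 2 * b $ 2"
  by (simp add: inner_vec_def UNIV_2)

lemma cross2_inner_squares:
  "(cross2 a b)\<^sup>2 + (a \<bullet> b)\<^sup>2 = (norm a)\<^sup>2 * (norm b)\<^sup>2"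
  unfolding cross2_def inner_2 norm_squared_2 by (simp add: power2_eq_square algebra_simps)

lemma cross2_normal:
  assumes "norm n = 1" "n \<bullet> v = 0"
  shows "cross2 v w = - cross2 n v * (n \<bullet> w)" and "(cross2 n v)\<^sup>2 = (norm v)\<^sup>2"
proof -
  have n: "n$1 * n$1 + n$2 * n$2 = 1" using norm_squared_2[of n] assms by simp
  have o: "n$1 * v$1 + n$2 * v$2 = 0" using assms by (simp add: inner_2)
  have v1: "v$1 = - cross2 n v * n$2"
  proof -
    have "- cross2 n v * n$2 = v$1 * (n$1*n$1 + n$2*n$2) - n$1 * (n$1 * v$1 + n$2 * v$2)"
      unfolding cross2_def by (simp add: algebra_simps)
    then show ?thesis using n o by simp
  qed
  have v2: "v$2 = cross2 n v * n$1"
  proof -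
    have "cross2 n v * n$1 = v$2 * (n$1*n$1 + n$2*n$2) - n$2 * (n$1 * v$1 + n$2 * v$2)"
      unfolding cross2_def by (simp add: algebra_simps)
    then show ?thesis using n o by simp
  qed
  have "cross2 v w = v$1 * w$2 - v$2 * w$1" by (simp add: cross2_def)
  also have "\<dots> = - cross2 n v * (n$1 * w$1 + n$2 * w$2)"
    by (subst v1, subst v2) (simp add: algebra_simps)
  finally show "cross2 v w = - cross2 n v * (n \<bullet> w)" by (simp add: inner_2)
  show "(cross2 n v)\<^sup>2 = (norm v)\<^sup>2"
    using cross2_inner_squares[of n v] assms by simp
qed

lemma normal_component_le_curvature:
  assumes "norm n = 1" "n \<bullet> v = 0" "v \<noteq> 0" "\<bar>planar_curvature v w\<bar> \<le> \<nu>"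
  shows "\<bar>n \<bullet> w\<bar> \<le> \<nu> * (norm v)\<^sup>2"
proof -
  have nv: "norm v > 0" using assms by simp
  have "\<bar>cross2 n v\<bar> = norm v"
    using cross2_normal(2)[OF assms(1,2)] by (metis abs_norm_cancel power2_eq_iff_nonneg abs_ge_zero power2_abs norm_ge_zero)
  then have "\<bar>cross2 v w\<bar> = norm v * \<bar>n \<bullet> w\<bar>"
    unfolding cross2_normal(1)[OF assms(1,2), of w] by (simp add: abs_mult)
  moreover have "\<bar>cross2 v w\<bar> \<le> \<nu> * norm v ^ 3"
    using assms(4) nv by (simp add: planar_curvature_def cross2_def field_simps)
  ultimately have "norm v * \<bar>n \<bullet> w\<bar> \<le> norm v * (\<nu> * (norm v)\<^sup>2)"
    by (simp add: power2_eq_square power3_eq_cube algebra_simps)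
  then show ?thesis using nv by simp
qed

lemma parallel_distance:
  fixes a b :: "real^2"
  assumes "cross2 a b = 0" "a \<bullet> b \<ge> 0" "norm a \<le> norm b"
  shows "norm (b - a) = norm b - norm a"
proof -
  have "(a \<bullet> b)\<^sup>2 = (norm a * norm b)\<^sup>2"
    using cross2_inner_squares[of a b] assms by (simp add: power_mult_distrib)
  then have "a \<bullet> b = norm a * norm b"
    using assms by simp
  moreover have "(norm (b - a))\<^sup>2 = (norm b)\<^sup>2 - 2 * (a \<bullet> b) + (norm a)\<^sup>2"
    unfolding norm_squared_2 inner_2 by (simp add: algebra_simps)
  ultimately have "(norm (b - a))\<^sup>2 = (norm b - norm a)\<^sup>2"
    by (simp add: power2_diff)
  then show ?thesis using assms by simp
qed

lemma local_min_of_second_derivative: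
  fixes f :: "real \<Rightarrow> real"
  assumes f: "\<And>s. s \<in> {a<..<b} \<Longrightarrow> (f has_real_derivative f' s) (at s)"
    and f': "(f' has_real_derivative D) (at t)" "D > 0" "f' t = 0" and t: "t \<in> {a<..<b}"
  shows "\<exists>e>0. {t - e..t + e} \<subseteq> {a<..<b} \<and> (\<forall>s\<in>{t - e..t + e}. f t \<le> f s)"
proof -
  obtain e1 where e1: "e1 > 0" "\<And>h. 0 < h \<Longrightarrow> h < e1 \<Longrightarrow> f' t < f' (t + h)"
    using DERIV_pos_inc_right[OF f'(1,2)] by blast
  obtain e2 where e2: "e2 > 0" "\<And>h. 0 < h \<Longrightarrow> h < e2 \<Longrightarrow> f' (t - h) < f' t"
    using DERIV_pos_inc_left[OF f'(1,2)] by blast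
  define e where "e = Min {e1, e2, t - a, b - t} / 2"
  have e: "e > 0" "e < e1" "e < e2" "e < t - a" "e < b - t"
    using e1(1) e2(1) t by (auto simp: e_def min_def)
  have sub: "{t - e..t + e} \<subseteq> {a<..<b}" using e by auto
  have "f t \<le> f s" if s: "s \<in> {t - e..t + e}" for s
  proof (cases "t \<le> s")
    case True
    show ?thesis
    proof (rule DERIV_nonneg_imp_nondecreasing[OF True])
      fix x assume x: "t \<le> x" "x \<le> s"
      then have "f' x \<ge> 0" using e1(2)[of "x - t"] e f'(3) s by (cases "x = t") auto
      moreover have "x \<in> {a<..<b}" using x s e by auto
      ultimately show "\<exists>y. (f has_real_derivative y) (at x) \<and> 0 \<le> y"
        using f[of x] by blast
    qed
  next
    case False
    show ?thesis
    proof (rule DERIV_nonpos_imp_nonincreasing[of s t])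
      fix x assume x: "s \<le> x" "x \<le> t"
      then have "f' x \<le> 0" using e2(2)[of "t - x"] e f'(3) s by (cases "x = t") auto
      moreover have "x \<in> {a<..<b}" using x s e by auto
      ultimately show "\<exists>y. (f has_real_derivative y) (at x) \<and> y \<le> 0"
        using f[of x] by blast
    qed (use False in simp)
  qed
  with e(1) sub show ?thesis by blast
qed

text \<open>
  A curve of curvature at most \<open>\<nu>\<close> stays locally outside the tangent disc of radius \<open>\<rho> < 1 / \<nu>\<close>,
  since the squared distance to the centre has a positive second derivative. A point \<open>x\<close> near
  \<open>\<gamma> \<tau> + d n\<close> sees the curve on the segment to the centre, by the intermediate value theorem for the
  cross product, so its distance to the curve is at most its distance to the disc. In this way the
  merely \<open>C\<^sup>2\<close> distance to the curve is bounded by the smooth distance to a circle.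
\<close>

lemma osculating_disc:
  fixes \<gamma> \<gamma>' :: "real \<Rightarrow> real^2"
  assumes \<gamma>: "\<And>s. s \<in> {a<..<b} \<Longrightarrow> (\<gamma> has_vector_derivative \<gamma>' s) (at s)"
    and \<gamma>': "(\<gamma>' has_vector_derivative w) (at \<tau>)" and \<tau>: "\<tau> \<in> {a<..<b}"
    and reg: "\<gamma>' \<tau> \<noteq> 0" and curv: "\<bar>planar_curvature (\<gamma>' \<tau>) w\<bar> \<le> \<nu>"
    and n: "norm n = 1" "n \<bullet> \<gamma>' \<tau> = 0"
    and \<rho>: "\<rho> > 0" "\<rho> * \<nu> < 1" and d: "d > 0"
  defines "ctr \<equiv> \<gamma> \<tau> - \<rho> *\<^sub>R n"
  shows "\<forall>\<^sub>F x in nhds (\<gamma> \<tau> + d *\<^sub>R n). \<exists>s\<in>{a<..<b}. norm (x - \<gamma> s) \<le> norm (x - ctr) - \<rho>"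
proof -
  define f where "f = (\<lambda>s. (\<gamma> s - ctr) \<bullet> (\<gamma> s - ctr))"
  define f' where "f' = (\<lambda>s. 2 * ((\<gamma> s - ctr) \<bullet> \<gamma>' s))"
  have f: "(f has_real_derivative f' s) (at s)" if "s \<in> {a<..<b}" for s
  proof -
    have "(f has_derivative (\<lambda>h. (\<gamma> s - ctr) \<bullet> (h *\<^sub>R \<gamma>' s) + (h *\<^sub>R \<gamma>' s) \<bullet> (\<gamma> s - ctr))) (at s)"
      unfolding f_def using \<gamma>[OF that]
      by (auto simp: has_vector_derivative_def intro!: derivative_eq_intros)
    then show ?thesis
      unfolding has_field_derivative_def f'_def
      by (rule has_derivative_eq_rhs) (auto simp: fun_eq_iff inner_commute)
  qed
  define D where "D = 2 * (\<gamma>' \<tau> \<bullet> \<gamma>' \<tau> + (\<gamma> \<tau> - ctr) \<bullet> w)"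
  have f': "(f' has_real_derivative D) (at \<tau>)"
  proof -
    have "(f' has_derivative (\<lambda>h. 2 * ((\<gamma> \<tau> - ctr) \<bullet> (h *\<^sub>R w) + (h *\<^sub>R \<gamma>' \<tau>) \<bullet> \<gamma>' \<tau>))) (at \<tau>)"
      unfolding f'_def using \<gamma>[OF \<tau>] \<gamma>'
      by (auto simp: has_vector_derivative_def intro!: derivative_eq_intros)
    then show ?thesis
      unfolding has_field_derivative_def D_def
      by (rule has_derivative_eq_rhs) (auto simp: fun_eq_iff algebra_simps)
  qed
  have ctr: "\<gamma> \<tau> - ctr = \<rho> *\<^sub>R n" by (simp add: ctr_def)
  have "D > 0"
  proof -
    have v0: "(norm (\<gamma>' \<tau>))\<^sup>2 > 0" using reg by simp
    have "\<rho> * \<bar>n \<bullet> w\<bar> \<le> \<rho> * (\<nu> * (norm (\<gamma>' \<tau>))\<^sup>2)"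
      using normal_component_le_curvature[OF n reg curv] \<rho> by (intro mult_left_mono) auto
    also have "\<dots> < (norm (\<gamma>' \<tau>))\<^sup>2"
      using mult_strict_right_mono[OF \<rho>(2) v0] by (simp add: algebra_simps)
    finally have "\<rho> * \<bar>n \<bullet> w\<bar> < (norm (\<gamma>' \<tau>))\<^sup>2" .
    moreover have "\<rho> * (- \<bar>n \<bullet> w\<bar>) \<le> \<rho> * (n \<bullet> w)"
      using \<rho> by (intro mult_left_mono) auto
    ultimately have "- (norm (\<gamma>' \<tau>))\<^sup>2 < \<rho> * (n \<bullet> w)" by simp
    then show ?thesis by (simp add: D_def ctr dot_square_norm)
  qed
  have "f' \<tau> = 0" using n by (simp add: f'_def ctr)
  obtain e where e: "e > 0" "{\<tau> - e..\<tau> + e} \<subseteq> {a<..<b}"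
    "\<And>s. s \<in> {\<tau> - e..\<tau> + e} \<Longrightarrow> f \<tau> \<le> f s"
    using local_min_of_second_derivative[OF f f' \<open>D > 0\<close> \<open>f' \<tau> = 0\<close> \<tau>] by auto
  have away: "\<rho> \<le> norm (\<gamma> s - ctr)" if "s \<in> {\<tau> - e..\<tau> + e}" for s
  proof -
    have "\<rho>\<^sup>2 \<le> (norm (\<gamma> s - ctr))\<^sup>2"
      using e(3)[OF that] n(1) by (simp add: f_def ctr dot_square_norm)
    then show ?thesis by (rule power2_le_imp_le) simp
  qed
  define m where "m = min \<rho> d / 2"
  have m: "m > 0" "2 * m \<le> \<rho>" "2 * m \<le> d" using \<rho> d by (auto simp: m_def)
  have "isCont \<gamma> \<tau>" using \<gamma>[OF \<tau>] has_vector_derivative_continuous by blast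
  then obtain e' where e': "e' > 0" "\<And>s. \<bar>s - \<tau>\<bar> < e' \<Longrightarrow> norm (\<gamma> s - \<gamma> \<tau>) < m"
    using m(1) by (auto simp: continuous_at_eps_delta dist_norm)
  define x0 where "x0 = \<gamma> \<tau> + d *\<^sub>R n"
  define q where "q = (\<lambda>x s. cross2 (\<gamma> s - ctr) (x - ctr))"
  have x0: "x0 - ctr = (\<rho> + d) *\<^sub>R n" by (simp add: x0_def ctr_def algebra_simps)
  define K where "K = (\<rho> + d) * cross2 (\<gamma>' \<tau>) n"
  have qd: "(q x0 has_real_derivative K) (at \<tau>)"
  proof -
    have "((\<lambda>s. \<gamma> s $ i) has_real_derivative \<gamma>' \<tau> $ i) (at \<tau>)" for i
      using bounded_linear.has_vector_derivative[OF bounded_linear_vec_nth[of i] \<gamma>[OF \<tau>]]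
      by (simp add: has_real_derivative_iff_has_vector_derivative)
    then show ?thesis
      unfolding q_def x0 K_def cross2_def
      by (auto intro!: derivative_eq_intros simp: algebra_simps)
  qed
  have "K \<noteq> 0"
  proof -
    have "cross2 (\<gamma>' \<tau>) n = - cross2 n (\<gamma>' \<tau>)"
      using cross2_normal(1)[OF n, of n] n by (simp add: dot_square_norm)
    moreover have "(cross2 n (\<gamma>' \<tau>))\<^sup>2 \<noteq> 0" using cross2_normal(2)[OF n] reg by simp
    ultimately show ?thesis using \<rho> d by (simp add: K_def)
  qed
  have q0: "q x0 \<tau> = 0" unfolding q_def x0 ctr by (simp add: cross2_def)
  define e2 where "e2 = min e e' / 2"
  have e2: "e2 > 0" "e2 < e" "e2 < e'" using e e' by (auto simp: e2_def)
  obtain s1 s2 where s: "s1 \<in> {\<tau> - e2..\<tau> + e2}" "s2 \<in> {\<tau> - e2..\<tau> + e2}" "q x0 s1 < 0" "0 < q x0 s2"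
  proof (cases "K > 0")
    case True
    obtain k1 where k1: "k1 > 0" "\<And>h. 0 < h \<Longrightarrow> h < k1 \<Longrightarrow> q x0 \<tau> < q x0 (\<tau> + h)"
      using DERIV_pos_inc_right[OF qd True] by blast
    obtain k2 where k2: "k2 > 0" "\<And>h. 0 < h \<Longrightarrow> h < k2 \<Longrightarrow> q x0 (\<tau> - h) < q x0 \<tau>"
      using DERIV_pos_inc_left[OF qd True] by blast
    define h where "h = Min {k1, k2, e2} / 2"
    have "0 < h" "h < k1" "h < k2" "h < e2" using k1(1) k2(1) e2 by (auto simp: h_def min_def)
    then show ?thesis using that[of "\<tau> - h" "\<tau> + h"] k1(2)[of h] k2(2)[of h] q0 by auto
  next
    case False
    then have "K < 0" using \<open>K \<noteq> 0\<close> by simp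
    obtain k1 where k1: "k1 > 0" "\<And>h. 0 < h \<Longrightarrow> h < k1 \<Longrightarrow> q x0 (\<tau> + h) < q x0 \<tau>"
      using DERIV_neg_dec_right[OF qd \<open>K < 0\<close>] by blast
    obtain k2 where k2: "k2 > 0" "\<And>h. 0 < h \<Longrightarrow> h < k2 \<Longrightarrow> q x0 \<tau> < q x0 (\<tau> - h)"
      using DERIV_neg_dec_left[OF qd \<open>K < 0\<close>] by blast
    define h where "h = Min {k1, k2, e2} / 2"
    have "0 < h" "h < k1" "h < k2" "h < e2" using k1(1) k2(1) e2 by (auto simp: h_def min_def)
    then show ?thesis using that[of "\<tau> + h" "\<tau> - h"] k1(2)[of h] k2(2)[of h] q0 by auto
  qed
  have qx: "((\<lambda>x. q x s') \<longlongrightarrow> q x0 s') (nhds x0)" for s'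
    unfolding q_def cross2_def by (intro tendsto_intros filterlim_ident)
  have near: "\<forall>\<^sub>F x in nhds x0. dist x x0 < m"
    using m(1) by (metis eventually_nhds_metric)
  have "\<forall>\<^sub>F x in nhds x0. q x s1 < 0" "\<forall>\<^sub>F x in nhds x0. 0 < q x s2"
    using order_tendstoD(2)[OF qx s(3)] order_tendstoD(1)[OF qx s(4)] by auto
  then have "\<forall>\<^sub>F x in nhds x0. \<exists>s\<in>{a<..<b}. norm (x - \<gamma> s) \<le> norm (x - ctr) - \<rho>"
    using near
  proof eventually_elim
    case (elim x)
    have iv: "{\<tau> - e2..\<tau> + e2} \<subseteq> {a<..<b}" using e e2 by auto
    have c\<gamma>: "continuous_on {\<tau> - e2..\<tau> + e2} \<gamma>"
      using iv has_vector_derivative_continuous[OF \<gamma>]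
      by (intro continuous_at_imp_continuous_on) blast
    have cont: "continuous_on {\<tau> - e2..\<tau> + e2} (q x)"
      unfolding q_def cross2_def
      by (intro continuous_intros c\<gamma>)
    obtain s where s': "s \<in> {\<tau> - e2..\<tau> + e2}" "q x s = 0"
    proof (cases "s1 \<le> s2")
      case True
      have "continuous_on {s1..s2} (q x)"
        by (rule continuous_on_subset[OF cont]) (use s in auto)
      from IVT'[of "q x" s1 0 s2, OF _ _ True this] elim obtain s where
        "s1 \<le> s" "s \<le> s2" "q x s = 0" by auto
      then show ?thesis using that[of s] s by auto
    next
      case False
      have "continuous_on {s2..s1} (q x)"
        by (rule continuous_on_subset[OF cont]) (use s in auto)
      from IVT2'[of "q x" s1 0 s2, OF _ _ _ this] elim False obtain s where
        "s2 \<le> s" "s \<le> s1" "q x s = 0" by auto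
      then show ?thesis using that[of s] s by auto
    qed
    define A where "A = \<gamma> s - ctr"
    define C where "C = x - ctr"
    have "\<bar>s - \<tau>\<bar> < e'" using s' e2 by auto
    then have A1: "norm (A - \<rho> *\<^sub>R n) < m" using e'(2) by (simp add: A_def ctr_def algebra_simps)
    have C1: "norm (C - (\<rho> + d) *\<^sub>R n) < m"
      using elim x0 by (simp add: C_def dist_norm x0[symmetric])
    have nn: "norm (\<rho> *\<^sub>R n) = \<rho>" "norm ((\<rho> + d) *\<^sub>R n) = \<rho> + d" "norm (d *\<^sub>R n) = d"
      using n \<rho> d by simp_all
    have A2: "norm A < \<rho> + m" "\<rho> - m < norm A"
      using A1 nn norm_triangle_ineq2[of A "\<rho> *\<^sub>R n"] norm_triangle_ineq3[of A "\<rho> *\<^sub>R n"] by linarith+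
    have C2: "\<rho> + d - m < norm C"
      using C1 nn norm_triangle_ineq3[of C "(\<rho> + d) *\<^sub>R n"] by linarith
    have A3: "\<rho> \<le> norm A" unfolding A_def by (rule away) (use s' e2 in auto)
    have par: "cross2 A C = 0" using s' by (simp add: q_def A_def C_def)
    have dir: "A \<bullet> C \<ge> 0"
    proof (rule ccontr)
      assume "\<not> A \<bullet> C \<ge> 0"
      then have "norm (- C - A) = norm (- C) - norm A"
        using par A2 C2 m by (intro parallel_distance) (auto simp: cross2_def)
      then have big: "norm (- C - A) < norm C" unfolding norm_minus_cancel using A3 \<rho>(1) by linarith
      have "norm (C + A) \<ge> norm ((2 * \<rho> + d) *\<^sub>R n) - norm (A - \<rho> *\<^sub>R n) - norm (C - (\<rho> + d) *\<^sub>R n)"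
      proof -
        have "(2 * \<rho> + d) *\<^sub>R n = (C + A) - (A - \<rho> *\<^sub>R n) - (C - (\<rho> + d) *\<^sub>R n)"
          by (simp add: scaleR_left_distrib[symmetric])
        then show ?thesis
          using norm_triangle_ineq4[of "(C + A) - (A - \<rho> *\<^sub>R n)" "C - (\<rho> + d) *\<^sub>R n"]
            norm_triangle_ineq4[of "C + A" "A - \<rho> *\<^sub>R n"] by simp
      qed
      moreover have "norm ((2 * \<rho> + d) *\<^sub>R n) = 2 * \<rho> + d" using n \<rho> d by simp
      moreover have "norm (- C - A) = norm (C + A)"
        by (metis minus_add_distrib uminus_add_conv_diff norm_minus_cancel add.commute)
      moreover have "norm C < \<rho> + d + m"
        using C1 nn norm_triangle_ineq3[of C "(\<rho> + d) *\<^sub>R n"] by linarith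
      ultimately show False
        using big A1 C1 m \<open>norm (- C - A) = norm (- C) - norm A\<close> A3 by simp
    qed
    have "norm (C - A) = norm C - norm A"
      by (rule parallel_distance[OF par dir]) (use A2 C2 m in linarith)
    then have "norm (x - \<gamma> s) \<le> norm (x - ctr) - \<rho>"
      using A3 by (simp add: A_def C_def)
    then show ?case using s' iv by blast
  qed
  then show ?thesis by (simp add: x0_def)
qed

text \<open>
  The squared distance \<open>(r - \<rho>)\<^sup>2\<close> to a circle is touched from above, at \<open>r = r0\<close>, by a quadratic
  polynomial in \<open>r\<^sup>2\<close>. This makes it usable in a test function that is smooth also at the centre
  of the circle.
\<close>

lemma squared_gap_le_quadratic:
  fixes r r0 \<rho> :: real
  assumes "r \<ge> 0" "r0 > 0" "\<rho> \<ge> 0"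
  shows "(r - \<rho>)\<^sup>2 \<le> (r0 - \<rho>)\<^sup>2 + (1 - \<rho> / r0) * (r\<^sup>2 - r0\<^sup>2) + \<rho> / r0 ^ 3 * (r\<^sup>2 - r0\<^sup>2)\<^sup>2"
proof -
  have "(r0 - \<rho>)\<^sup>2 + (1 - \<rho> / r0) * (r\<^sup>2 - r0\<^sup>2) + \<rho> / r0 ^ 3 * (r\<^sup>2 - r0\<^sup>2)\<^sup>2 - (r - \<rho>)\<^sup>2
    = \<rho> * (r - r0)\<^sup>2 * ((r + r0)\<^sup>2 - r0\<^sup>2) / r0 ^ 3"
    using assms(2) by (simp add: field_simps power2_eq_square power3_eq_cube)
  also have "\<dots> \<ge> 0"
    using assms by (intro divide_nonneg_nonneg mult_nonneg_nonneg) auto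
  finally show ?thesis by linarith
qed

lemma smooth_norm_squared:
  fixes c :: "real^2"
  shows "smooth_on (\<lambda>z. (norm (fst z - c))\<^sup>2) spacetime_pos"
  unfolding norm_squared_2 vector_minus_component
  by (intro smooth_on_diff smooth_on_intros)

text \<open>
  The common form of the test functions in the next proof. With \<open>k1 = 1\<close> and \<open>k2 = 0\<close> it is the
  penalty with frozen curve point \<open>c\<close>, otherwise \<open>c\<close> is the centre of a tangent circle.
\<close>

lemma supersolution_static_test:
  fixes u :: "(real^2) \<times> real \<Rightarrow> real" and c :: "real^2"
  assumes super: "viscosity_supersolution \<nu> \<Psi>m \<Psi>p u0 u" and cont: "continuous_on spacetime u"
    and \<epsilon>: "\<epsilon> > 0" and b: "b > 0" and k1: "k1 > 0"
    and t: "t > 0" and below: "u (x, t) < \<Psi>p x"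
    and d: "d = (norm (x - c))\<^sup>2"
    and min: "\<forall>\<^sub>F z in nhds (x, t).
        u (x, t) + \<epsilon> * exp (b * k0) + \<epsilon> * exp (L * (t - T))
        \<le> u z + \<epsilon> * exp (b * (k0 + k1 * ((norm (fst z - c))\<^sup>2 - d) + k2 * ((norm (fst z - c))\<^sup>2 - d)\<^sup>2))
            + \<epsilon> * exp (L * (snd z - T))"
  shows "\<epsilon> * L * exp (L * (t - T)) \<le> \<epsilon> * b * k1 * exp (b * k0) * (2 - 2 * \<nu> * norm (x - c))"
proof -
  define H where "H = (\<lambda>w. - (\<epsilon> * exp (b * (k0 + k1 * (- w - d) + k2 * (- w - d)\<^sup>2))))"
  define H1 where "H1 = (\<lambda>w. \<epsilon> * (b * (k1 + 2 * k2 * (- w - d))) * exp (b * (k0 + k1 * (- w - d) + k2 * (- w - d)\<^sup>2)))"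
  define H2 where "H2 = (\<lambda>w. \<epsilon> * (b * (- 2 * k2)) * exp (b * (k0 + k1 * (- w - d) + k2 * (- w - d)\<^sup>2))
    - \<epsilon> * (b * (k1 + 2 * k2 * (- w - d)))\<^sup>2 * exp (b * (k0 + k1 * (- w - d) + k2 * (- w - d)\<^sup>2)))"
  define G where "G = (\<lambda>t. - (\<epsilon> * exp (L * (t - T))))"
  define h where "h = \<epsilon> * b * k1 * exp (b * k0)"
  have "0 \<le> h * (0 + 2 * ((x - c) \<bullet> 0) - 2 * \<nu> * norm (x - c) + 2) + - (\<epsilon> * L * exp (L * (t - T)))"
  proof (rule supersolution_radial_test[OF super cont, where H = H and G = G and \<rho> = "\<lambda>_. 0" and c = "\<lambda>_. c"
        and x = x and t = t and ?H1.0 = H1 and ?H2.0 = H2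
        and ?G' = "\<lambda>t. - (\<epsilon> * L * exp (L * (t - T)))" and ?\<rho>' = "\<lambda>_. 0" and ?c' = "\<lambda>_. 0"])
    show "(H has_real_derivative H1 w) (at w)" for w
      unfolding H_def H1_def by (auto intro!: derivative_eq_intros simp: algebra_simps)
    show "(H1 has_real_derivative H2 w) (at w)" for w
      unfolding H1_def H2_def
      by (auto intro!: derivative_eq_intros simp: algebra_simps power2_eq_square)
    show "smooth_on (\<lambda>z. H (0 - (norm (fst z - c))\<^sup>2) + G (snd z)) spacetime_pos"
    proof -
      have "smooth_on (\<lambda>z. (-1) * (\<epsilon> * exp (b * (k0 + k1 * ((norm (fst z - c))\<^sup>2 - d)
          + k2 * (((norm (fst z - c))\<^sup>2 - d) * ((norm (fst z - c))\<^sup>2 - d)))))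
          + (-1) * (\<epsilon> * exp (L * (snd z - T)))) spacetime_pos"
        by (intro smooth_on_intros smooth_on_diff smooth_norm_squared)
      then show ?thesis by (simp add: H_def G_def power2_eq_square)
    qed
    show "\<forall>\<^sub>F z in nhds (x, t). u (x, t) - (H (0 - (norm (x - c))\<^sup>2) + G t)
        \<le> u z - (H (0 - (norm (fst z - c))\<^sup>2) + G (snd z))"
      using min by (simp add: H_def G_def d algebra_simps)
    show "h = H1 (0 - (norm (x - c))\<^sup>2)" by (simp add: h_def H1_def d)
    show "h > 0" using \<epsilon> b k1 by (simp add: h_def)
  qed (use t below in \<open>auto simp: G_def intro!: derivative_eq_intros\<close>)
  then show ?thesis by (simp add: h_def algebra_simps)
qed

text \<open>
  The curve parallel to \<open>\<gamma>\<close> at distance \<open>d\<close> has curvature at most \<open>\<nu> / (1 + \<nu> d) < \<nu>\<close>, so a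
  thin tube around \<open>\<gamma>\<close> would like to expand on both sides. To avoid the distance function, which is
  not smooth enough, the point \<open>\<gamma> s\<close> is a variable of the minimisation of
  \<open>u (x, t) + \<epsilon> exp (b (|x - \<gamma> s|\<^sup>2 - \<delta>\<^sup>2)) + \<epsilon> exp (L (t - T))\<close>. If the minimum is
  attained with \<open>|x - \<gamma> s| \<le> \<delta> / 2\<close>, the penalty is flat there and \<open>s\<close> may be frozen. Otherwise
  \<open>x - \<gamma> s\<close> is normal to the curve, and the penalty is bounded by that of the distance to a
  tangent circle, of which the radius is chosen so that the parallel circle through \<open>x\<close> has radius
  larger than \<open>1 / \<nu>\<close>.
\<close>

lemma supersolution_persists_on_curve:
  fixes u :: "(real^2) \<times> real \<Rightarrow> real" and \<gamma> \<gamma>' \<gamma>'' :: "real \<Rightarrow> real^2"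
  assumes super: "viscosity_supersolution \<nu> \<Psi>m \<Psi>p u0 u" and cont: "continuous_on spacetime u"
    and \<nu>: "\<nu> > 0" and \<delta>: "\<delta> > 0"
    and \<gamma>: "\<And>s. s \<in> {0..1} \<Longrightarrow> (\<gamma> has_vector_derivative \<gamma>' s) (at s within {0..1})"
    and \<gamma>': "\<And>s. s \<in> {0..1} \<Longrightarrow> (\<gamma>' has_vector_derivative \<gamma>'' s) (at s within {0..1})"
    and reg: "\<And>s. s \<in> {0..1} \<Longrightarrow> \<gamma>' s \<noteq> 0"
    and curv: "\<And>s. s \<in> {0<..<1} \<Longrightarrow> \<bar>planar_curvature (\<gamma>' s) (\<gamma>'' s)\<bar> \<le> \<nu>"
    and init: "\<And>s x. s \<in> {0..1} \<Longrightarrow> norm (x - \<gamma> s) \<le> 2 * \<delta> \<Longrightarrow> \<mu> \<le> u (x, 0)"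
    and obst: "\<And>s x. s \<in> {0..1} \<Longrightarrow> norm (x - \<gamma> s) \<le> 2 * \<delta> \<Longrightarrow> \<mu> \<le> \<Psi>p x"
    and ends: "\<And>s x t. s \<in> {0, 1} \<Longrightarrow> norm (x - \<gamma> s) \<le> 2 * \<delta> \<Longrightarrow> t \<ge> 0 \<Longrightarrow> \<mu> \<le> u (x, t)"
    and s: "s \<in> {0..1}" and t: "t \<ge> 0"
  shows "\<mu> \<le> u (\<gamma> s, t)"
proof (cases "t = 0")
  case True
  then show ?thesis using init[OF s, of "\<gamma> s"] \<delta> by simp
next
  case False
  define T where "T = t"
  have T: "T > 0" using False t by (simp add: T_def)
  have "\<mu> \<le> u (\<gamma> s, T) + e" if e0: "e > 0" for e
  proof -
    define \<epsilon> where "\<epsilon> = e / 2"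
    have \<epsilon>: "\<epsilon> > 0" using e0 by (simp add: \<epsilon>_def)
    define Q where "Q = {0..1::real} \<times> cball (0 :: real^2) (2 * \<delta>) \<times> {0..T + 1}"
    have Q: "compact Q" "Q \<noteq> {}" using \<delta> T by (auto simp: Q_def compact_Times)
    have cont_\<gamma>: "continuous_on {0..1} \<gamma>"
      using has_vector_derivative_continuous[OF \<gamma>] by (simp add: continuous_on_eq_continuous_within)
    define v where "v = (\<lambda>(s, w, t). u (\<gamma> s + w, t :: real))"
    have cv: "continuous_on Q v"
    proof -
      have "continuous_on Q (\<lambda>p. (\<gamma> (fst p) + fst (snd p), snd (snd p)))"
        by (intro continuous_intros continuous_on_compose2[OF cont_\<gamma>]) (auto simp: Q_def)
      moreover have "(\<lambda>p. (\<gamma> (fst p) + fst (snd p), snd (snd p))) ` Q \<subseteq> spacetime"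
        by (auto simp: Q_def)
      ultimately show ?thesis
        using continuous_on_compose2[OF cont] by (simp add: v_def case_prod_beta)
    qed
    obtain M where M: "\<And>z. z \<in> Q \<Longrightarrow> \<bar>v z\<bar> \<le> M"
      using compact_abs_bound[OF Q(1) cv] by blast
    obtain L where L: "L > 0" "\<epsilon> * exp L > M + \<mu>" by (rule exp_rate[OF \<epsilon>])
    define m where "m = \<epsilon> * L * exp (- L * T)"
    have m: "m > 0" using \<epsilon> L by (simp add: m_def)
    define \<delta>' where "\<delta>' = 3 * \<delta>\<^sup>2 / 4"
    have \<delta>': "\<delta>' > 0" using \<delta> by (simp add: \<delta>'_def)
    obtain b where b: "b > 0" "M + \<mu> < \<epsilon> * exp (b * \<delta>')" "\<epsilon> * b * exp (- (b * \<delta>')) * 2 < m"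
      using sharp_exponent[OF \<epsilon> \<delta>' m] by blast
    define \<Theta> where "\<Theta> = (\<lambda>q. \<epsilon> * exp (b * (q - \<delta>\<^sup>2)))"
    define G where "G = (\<lambda>t. \<epsilon> * exp (L * (t - T)))"
    have pos: "\<Theta> q > 0" "G t > 0" for q t using \<epsilon> by (auto simp: \<Theta>_def G_def)
    have \<Theta>_mono: "\<Theta> q \<le> \<Theta> q' \<longleftrightarrow> q \<le> q'" for q q'
      using \<epsilon> b by (simp add: \<Theta>_def)
    define f where "f = (\<lambda>(s, w, t). v (s, w, t) + \<Theta> ((norm w)\<^sup>2) + G t)"
    have "continuous_on Q f"
      unfolding f_def case_prod_beta \<Theta>_def G_def prod.collapse by (intro continuous_intros cv)
    from continuous_attains_inf[OF Q(1,2) this] obtain z where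
      z: "z \<in> Q" and zmin: "\<And>y. y \<in> Q \<Longrightarrow> f z \<le> f y" by blast
    obtain s0 w0 t0 where zx: "z = (s0, w0, t0)" by (metis prod_cases3)
    define x0 where "x0 = \<gamma> s0 + w0"
    have t0: "0 \<le> t0" "t0 \<le> T + 1" and s0: "s0 \<in> {0..1}" and w0: "norm w0 \<le> 2 * \<delta>"
      using z by (auto simp: Q_def zx)
    have fmin: "f z \<le> u (x, t) + \<Theta> ((norm (x - \<gamma> s))\<^sup>2) + G t"
      if "s \<in> {0..1}" "norm (x - \<gamma> s) \<le> 2 * \<delta>" "t \<in> {0..T + 1}" for s x t
      using zmin[of "(s, x - \<gamma> s, t)"] that by (simp add: Q_def f_def v_def)
    have "\<mu> \<le> f z"
    proof (rule ccontr)
      assume neg: "\<not> \<mu> \<le> f z"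
      have fz: "f z = u (x0, t0) + \<Theta> ((norm w0)\<^sup>2) + G t0" by (simp add: f_def v_def zx x0_def)
      have ul: "u (x0, t0) < \<mu>" using neg fz pos(1)[of "(norm w0)\<^sup>2"] pos(2)[of t0] by linarith
      have uM: "- M \<le> u (x0, t0)" using M[OF z] by (simp add: zx v_def x0_def)
      have xw: "norm (x0 - \<gamma> s0) = norm w0" by (simp add: x0_def)
      have "t0 \<noteq> 0" using init[OF s0, of x0] w0 ul xw by auto
      then have t0': "0 < t0" using t0 by simp
      have "t0 \<noteq> T + 1" using fz neg uM L(2) pos(1)[of "(norm w0)\<^sup>2"] by (auto simp: G_def)
      then have t0'': "t0 < T + 1" using t0 by simp
      have w0': "norm w0 < 2 * \<delta>"
      proof (rule ccontr)
        assume "\<not> norm w0 < 2 * \<delta>"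
        then have "norm w0 = 2 * \<delta>" using w0 by simp
        then have "\<delta>' \<le> (norm w0)\<^sup>2 - \<delta>\<^sup>2" by (simp add: \<delta>'_def power2_eq_square)
        then have "\<epsilon> * exp (b * \<delta>') \<le> \<Theta> ((norm w0)\<^sup>2)"
          using \<epsilon> b(1) by (simp add: \<Theta>_def)
        then show False using fz neg uM b(2) pos(2)[of t0] by linarith
      qed
      have s0': "s0 \<in> {0<..<1}"
        using ends[of s0 x0 t0] w0 ul xw t0 s0 by (cases "s0 = 0 \<or> s0 = 1") auto
      have below: "u (x0, t0) < \<Psi>p x0" using obst[OF s0, of x0] w0 ul xw by simp
      have mG: "m \<le> \<epsilon> * L * exp (L * (t0 - T))"
        unfolding m_def using \<epsilon> L t0 by (simp add: algebra_simps)
      have evt: "\<forall>\<^sub>F z in nhds (x0, t0). snd z \<in> {0..T + 1}"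
        using eventually_nhds_interior_prod[of x0 UNIV 0 t0 "T + 1"] t0' t0'' by simp
      show False
      proof (cases "norm w0 \<le> \<delta> / 2")
        case True
        have "\<forall>\<^sub>F z in nhds (x0, t0). norm (fst z - \<gamma> s0) < 2 * \<delta>"
        proof (rule order_tendstoD(2))
          show "((\<lambda>z. norm (fst z - \<gamma> s0)) \<longlongrightarrow> norm (fst (x0, t0) - \<gamma> s0)) (nhds (x0, t0))"
            by (intro tendsto_intros filterlim_ident)
        qed (use w0' xw in simp)
        with evt have "\<forall>\<^sub>F y in nhds (x0, t0).
            f z \<le> u y + \<Theta> ((norm (fst y - \<gamma> s0))\<^sup>2) + G (snd y)"
          by eventually_elim (use fmin[OF s0] in force)
        then have "\<epsilon> * L * exp (L * (t0 - T)) \<le> \<epsilon> * b * 1 * exp (b * ((norm w0)\<^sup>2 - \<delta>\<^sup>2))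
            * (2 - 2 * \<nu> * norm (x0 - \<gamma> s0))"
          by (intro supersolution_static_test[OF super cont \<epsilon> b(1) _ t0' below refl, where ?k2.0 = 0])
            (auto simp: fz \<Theta>_def G_def xw algebra_simps)
        also have "\<dots> \<le> \<epsilon> * b * 1 * exp (b * ((norm w0)\<^sup>2 - \<delta>\<^sup>2)) * 2"
          using \<epsilon> b(1) \<nu> by (intro mult_left_mono) auto
        also have "\<dots> \<le> \<epsilon> * b * exp (- (b * \<delta>')) * 2"
        proof -
          have "(norm w0)\<^sup>2 \<le> (\<delta> / 2)\<^sup>2" using True by (intro power_mono) auto
          then have "(norm w0)\<^sup>2 - \<delta>\<^sup>2 \<le> - \<delta>'" by (simp add: \<delta>'_def power_divide)
          then have "b * ((norm w0)\<^sup>2 - \<delta>\<^sup>2) \<le> b * (- \<delta>')" using b(1) by (intro mult_left_mono) auto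
          then show ?thesis using \<epsilon> b(1) by simp
        qed
        finally show False using b(3) mG by linarith
      next
        case False
        define d where "d = norm w0"
        define n where "n = (1 / d) *\<^sub>R w0"
        have d: "d > \<delta> / 2" "d > 0" "d < 2 * \<delta>" using False \<delta> w0' by (auto simp: d_def)
        have n: "norm n = 1" "w0 = d *\<^sub>R n" using d by (auto simp: n_def d_def)
        have at: "(\<gamma> has_vector_derivative \<gamma>' s) (at s)" "(\<gamma>' has_vector_derivative \<gamma>'' s) (at s)"
          if "s \<in> {0<..<1}" for s
          using \<gamma>[of s] \<gamma>'[of s] that by (auto simp: at_within_Icc_at)
        have "isCont \<gamma> s0" using at(1)[OF s0'] has_vector_derivative_continuous by blast
        have orth: "n \<bullet> \<gamma>' s0 = 0"
        proof -
          define g where "g = (\<lambda>s. (x0 - \<gamma> s) \<bullet> (x0 - \<gamma> s))"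
          have "(g has_derivative (\<lambda>h. (x0 - \<gamma> s0) \<bullet> (- (h *\<^sub>R \<gamma>' s0)) + (- (h *\<^sub>R \<gamma>' s0)) \<bullet> (x0 - \<gamma> s0))) (at s0)"
            unfolding g_def using at(1)[OF s0']
            by (auto simp: has_vector_derivative_def intro!: derivative_eq_intros)
          then have gd: "(g has_real_derivative - 2 * (w0 \<bullet> \<gamma>' s0)) (at s0)"
            unfolding has_field_derivative_def
            by (rule has_derivative_eq_rhs) (auto simp: fun_eq_iff inner_commute x0_def)
          have "\<forall>\<^sub>F s in nhds s0. norm (x0 - \<gamma> s) < 2 * \<delta>"
          proof (rule order_tendstoD(2))
            have "(\<gamma> \<longlongrightarrow> \<gamma> s0) (nhds s0)" using \<open>isCont \<gamma> s0\<close> by (simp add: tendsto_at_iff_tendsto_nhds isCont_def)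
            then show "((\<lambda>s. norm (x0 - \<gamma> s)) \<longlongrightarrow> norm (x0 - \<gamma> s0)) (nhds s0)"
              by (intro tendsto_intros)
          qed (use w0' xw in simp)
          moreover have "\<forall>\<^sub>F s in nhds s0. s \<in> {0<..<1}" using s0' by (intro eventually_nhds_in_open) auto
          ultimately have "\<forall>\<^sub>F s in nhds s0. g s0 \<le> g s"
          proof eventually_elim
            case (elim s)
            then have "f z \<le> u (x0, t0) + \<Theta> ((norm (x0 - \<gamma> s))\<^sup>2) + G t0"
              using fmin[of s x0 t0] t0 by auto
            then have "(norm (x0 - \<gamma> s0))\<^sup>2 \<le> (norm (x0 - \<gamma> s))\<^sup>2"
              by (simp add: fz \<Theta>_mono xw)
            then show ?case by (simp add: g_def dot_square_norm)
          qed
          then obtain k where "k > 0" "\<And>s. \<bar>s0 - s\<bar> < k \<Longrightarrow> g s0 \<le> g s"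
            unfolding eventually_nhds_metric by (auto simp: dist_real_def abs_minus_commute)
          then have "- 2 * (w0 \<bullet> \<gamma>' s0) = 0" using DERIV_local_min[OF gd] by blast
          then show ?thesis by (simp add: n_def)
        qed
        define \<rho> where "\<rho> = 1 / \<nu> - min (1 / (2 * \<nu>)) (\<delta> / 4)"
        have \<rho>: "\<rho> > 0" "\<rho> * \<nu> < 1" "\<rho> + d > 1 / \<nu>"
        proof -
          have "min (1 / (2 * \<nu>)) (\<delta> / 4) < 1 / \<nu>" using \<nu> by (simp add: min_less_iff_disj field_simps)
          then show "\<rho> > 0" by (simp add: \<rho>_def)
          have "min (1 / (2 * \<nu>)) (\<delta> / 4) > 0" using \<nu> \<delta> by simp
          then have "\<rho> < 1 / \<nu>" by (simp add: \<rho>_def)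
          then show "\<rho> * \<nu> < 1" using \<nu> by (simp add: field_simps)
          have "min (1 / (2 * \<nu>)) (\<delta> / 4) < d" using d \<delta> by (simp add: min_less_iff_disj)
          then show "\<rho> + d > 1 / \<nu>" by (simp add: \<rho>_def)
        qed
        define c where "c = \<gamma> s0 - \<rho> *\<^sub>R n"
        have xc: "x0 - c = (\<rho> + d) *\<^sub>R n" by (simp add: x0_def c_def n(2) algebra_simps)
        then have nxc: "norm (x0 - c) = \<rho> + d" using n \<rho> d by simp
        have osc: "\<forall>\<^sub>F x in nhds x0. \<exists>s\<in>{0<..<1}. norm (x - \<gamma> s) \<le> norm (x - c) - \<rho>"
          using osculating_disc[OF at(1) at(2)[OF s0'] s0' reg[OF s0] curv[OF s0'] n(1) orth \<rho>(1,2) d(2)]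
          by (simp add: x0_def n(2) c_def)
        have "((\<lambda>z. fst z) \<longlongrightarrow> fst (x0, t0)) (nhds (x0, t0))"
          by (intro tendsto_intros filterlim_ident)
        then have fst: "filterlim fst (nhds x0) (nhds (x0, t0))" by simp
        have "\<forall>\<^sub>F y in nhds (x0, t0). norm (fst y - c) - \<rho> < 2 * \<delta>"
        proof (rule order_tendstoD(2))
          show "((\<lambda>y. norm (fst y - c) - \<rho>) \<longlongrightarrow> norm (x0 - c) - \<rho>) (nhds (x0, t0))"
            by (intro tendsto_intros fst)
        qed (use d nxc in simp)
        with evt eventually_compose_filterlim[OF osc fst]
        have ev: "\<forall>\<^sub>F y in nhds (x0, t0). f z \<le> u y
            + \<epsilon> * exp (b * ((d\<^sup>2 - \<delta>\<^sup>2) + (1 - \<rho> / (\<rho> + d)) * ((norm (fst y - c))\<^sup>2 - (norm (x0 - c))\<^sup>2)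
                + \<rho> / (\<rho> + d) ^ 3 * ((norm (fst y - c))\<^sup>2 - (norm (x0 - c))\<^sup>2)\<^sup>2))
            + \<epsilon> * exp (L * (snd y - T))"
        proof eventually_elim
          case (elim y)
          then obtain s where s: "s \<in> {0<..<1}" "norm (fst y - \<gamma> s) \<le> norm (fst y - c) - \<rho>" by blast
          have "f z \<le> u y + \<Theta> ((norm (fst y - \<gamma> s))\<^sup>2) + G (snd y)"
            using fmin[of s "fst y" "snd y"] s elim by simp
          moreover have "(norm (fst y - \<gamma> s))\<^sup>2 \<le> (norm (fst y - c) - \<rho>)\<^sup>2"
            using s(2) by (intro power_mono) auto
          moreover have "(norm (fst y - c) - \<rho>)\<^sup>2 \<le> d\<^sup>2 + (1 - \<rho> / (\<rho> + d)) * ((norm (fst y - c))\<^sup>2 - (norm (x0 - c))\<^sup>2)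
                + \<rho> / (\<rho> + d) ^ 3 * ((norm (fst y - c))\<^sup>2 - (norm (x0 - c))\<^sup>2)\<^sup>2" (is "_ \<le> ?q")
            using squared_gap_le_quadratic[of "norm (fst y - c)" "\<rho> + d" \<rho>] \<rho> d unfolding nxc by simp
          ultimately have "f z \<le> u y + \<Theta> ?q + G (snd y)" using \<Theta>_mono by (smt (verit))
          then show ?case by (simp add: \<Theta>_def G_def algebra_simps)
        qed
        have k1: "1 - \<rho> / (\<rho> + d) > 0" using \<rho> d by (simp add: field_simps)
        have "\<epsilon> * L * exp (L * (t0 - T)) \<le> \<epsilon> * b * (1 - \<rho> / (\<rho> + d)) * exp (b * (d\<^sup>2 - \<delta>\<^sup>2))
            * (2 - 2 * \<nu> * norm (x0 - c))"
          by (rule supersolution_static_test[OF super cont \<epsilon> b(1) k1 t0' below refl, where ?k2.0 = "\<rho> / (\<rho> + d) ^ 3"])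
            (use ev in \<open>simp add: fz \<Theta>_def G_def d_def\<close>)
        also have "\<dots> \<le> 0"
        proof -
          have "1 < \<nu> * (\<rho> + d)" using \<rho>(3) \<nu> by (simp add: field_simps)
          then show ?thesis using \<epsilon> b(1) k1 by (intro mult_nonneg_nonpos) (auto simp: nxc)
        qed
        finally show False using mG m by linarith
      qed
    qed
    moreover have "f z \<le> u (\<gamma> s, T) + \<Theta> 0 + G T"
      using fmin[OF s, of "\<gamma> s" T] \<delta> T by simp
    moreover have "\<Theta> 0 \<le> \<epsilon>" using \<epsilon> b by (simp add: \<Theta>_def)
    ultimately show "\<mu> \<le> u (\<gamma> s, T) + e" by (simp add: G_def \<epsilon>_def)
  qed
  then have "\<mu> \<le> u (\<gamma> s, T)" by (rule field_le_epsilon)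
  then show ?thesis by (simp add: T_def)
qed

lemma norm_le_2_iff: "0 \<le> r \<Longrightarrow> norm (v :: real^2) \<le> r \<longleftrightarrow> (v$1)\<^sup>2 + (v$2)\<^sup>2 \<le> r\<^sup>2"
  using power_mono_iff[of "norm v" r 2] norm_squared_2[of v] by (simp add: power2_eq_square)

lemma norm_less_2_iff: "0 \<le> r \<Longrightarrow> norm (v :: real^2) < r \<longleftrightarrow> (v$1)\<^sup>2 + (v$2)\<^sup>2 < r\<^sup>2"
  using norm_le_2_iff[of r v] power_mono_iff[of r "norm v" 2] norm_squared_2[of v]
  by (simp add: power2_eq_square not_le[symmetric])

lemma eventually_less_of_tendsto:
  fixes f g :: "'a \<Rightarrow> real"
  assumes "(f \<longlongrightarrow> a) F" "(g \<longlongrightarrow> b) F" "a < b"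
  shows "\<forall>\<^sub>F x in F. f x < g x"
  using order_tendstoD(1)[OF tendsto_diff[OF assms(2,1)], of 0] assms(3) by simp

lemma eventually_conj_decided:
  assumes "(\<forall>\<^sub>F x in F. A x) \<or> (\<forall>\<^sub>F x in F. \<not> A x)"
    and "(\<forall>\<^sub>F x in F. B x) \<or> (\<forall>\<^sub>F x in F. \<not> B x)"
  shows "(\<forall>\<^sub>F x in F. A x \<and> B x) \<or> (\<forall>\<^sub>F x in F. \<not> (A x \<and> B x))"
proof -
  have "\<forall>\<^sub>F x in F. \<not> (A x \<and> B x)" if "\<forall>\<^sub>F x in F. \<not> A x"
    using that by eventually_elim simp
  moreover have "\<forall>\<^sub>F x in F. \<not> (A x \<and> B x)" if "\<forall>\<^sub>F x in F. \<not> B x"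
    using that by eventually_elim simp
  ultimately show ?thesis using assms eventually_conj[of A F B] by blast
qed

section \<open>Parametrised graphs\<close>

text \<open>
  A regular parametrisation of a graph cannot turn back: where the abscissa \<open>p\<close> has an extremum, the
  velocity is vertical, so \<open>q\<close> is strictly monotone, although just before and just after the extremum
  the same abscissae occur.
\<close>

lemma no_turning_point:
  fixes p q :: "real \<Rightarrow> real"
  assumes p: "continuous_on {a..b} p" and \<tau>: "\<tau> \<in> {a<..<b}"
    and q: "(q has_real_derivative D) (at \<tau>)" "D \<noteq> 0"
    and max: "\<And>s. s \<in> {a..b} \<Longrightarrow> p s \<le> p \<tau>"
    and fib: "\<And>s s'. s \<in> {a..b} \<Longrightarrow> s' \<in> {a..b} \<Longrightarrow> p s = p s' \<Longrightarrow> q s = q s'"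
  shows False
proof -
  have main: False if q: "(q has_real_derivative D) (at \<tau>)" "D > 0"
    and fib: "\<And>s s'. s \<in> {a..b} \<Longrightarrow> s' \<in> {a..b} \<Longrightarrow> p s = p s' \<Longrightarrow> q s = q s'" for q D
  proof -
    obtain k1 where k1: "k1 > 0" "\<And>h. 0 < h \<Longrightarrow> h < k1 \<Longrightarrow> q \<tau> < q (\<tau> + h)"
      using DERIV_pos_inc_right[OF q] by blast
    obtain k2 where k2: "k2 > 0" "\<And>h. 0 < h \<Longrightarrow> h < k2 \<Longrightarrow> q (\<tau> - h) < q \<tau>"
      using DERIV_pos_inc_left[OF q] by blast
    define h where "h = Min {k1, k2, \<tau> - a, b - \<tau>} / 2"
    have h: "0 < h" "h < k1" "h < k2" "h < \<tau> - a" "h < b - \<tau>"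
      using k1(1) k2(1) \<tau> by (auto simp: h_def min_def)
    show False
    proof (cases "p (\<tau> + h) \<le> p (\<tau> - h)")
      case True
      have "continuous_on {\<tau>..\<tau> + h} p" by (rule continuous_on_subset[OF p]) (use h \<tau> in auto)
      from IVT2'[of p "\<tau> + h" "p (\<tau> - h)" \<tau>, OF True _ _ this] max[of "\<tau> - h"] h \<tau>
      obtain s where s: "\<tau> \<le> s" "s \<le> \<tau> + h" "p s = p (\<tau> - h)" by auto
      then have "q s = q (\<tau> - h)" using h \<tau> by (intro fib) auto
      also have "\<dots> < q \<tau>" using k2(2)[of h] h by simp
      finally show False using k1(2)[of "s - \<tau>"] s h by (cases "s = \<tau>") auto
    next
      case False
      have "continuous_on {\<tau> - h..\<tau>} p" by (rule continuous_on_subset[OF p]) (use h \<tau> in auto)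
      from IVT'[of p "\<tau> - h" "p (\<tau> + h)" \<tau>, OF _ _ _ this] False max[of "\<tau> + h"] h \<tau>
      obtain s where s: "\<tau> - h \<le> s" "s \<le> \<tau>" "p s = p (\<tau> + h)" by auto
      then have "q s = q (\<tau> + h)" using h \<tau> by (intro fib) auto
      moreover have "\<dots> > q \<tau>" using k1(2)[of h] h by simp
      ultimately show False using k2(2)[of "\<tau> - s"] s h by (cases "s = \<tau>") auto
    qed
  qed
  show False
  proof (cases "D > 0")
    case True
    show False by (rule main[OF q(1) True fib])
  next
    case False
    then have D: "- D > 0" using q(2) by simp
    have "((\<lambda>s. - q s) has_real_derivative - D) (at \<tau>)"
      using q(1) by (auto intro: derivative_eq_intros)
    then show False
    proof (rule main[OF _ D])
      fix s s' assume "s \<in> {a..b}" "s' \<in> {a..b}" "p s = p s'"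
      then have "q s = q s'" by (rule fib)
      then show "- q s = - q s'" by simp
    qed
  qed
qed

text \<open>
  By the absence of turning points the parametrisation is injective, so it maps end points to end
  points. The continuity of \<open>g\<close> comes from the compactness of its graph.
\<close>

lemma graph_parametrisation:
  fixes \<gamma> \<gamma>' :: "real \<Rightarrow> real^2" and g :: "real \<Rightarrow> real"
  assumes \<gamma>: "\<And>s. s \<in> {0..1} \<Longrightarrow> (\<gamma> has_vector_derivative \<gamma>' s) (at s within {0..1})"
    and reg: "\<And>s. s \<in> {0..1} \<Longrightarrow> \<gamma>' s \<noteq> 0"
    and graph: "\<gamma> ` {0..1} = {vector [p, q] | p q. q = g p \<and> \<alpha> \<le> p \<and> p \<le> \<beta>}"
  shows "\<alpha> < \<beta>" and "continuous_on {\<alpha>..\<beta>} g"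
    and "{\<gamma> 0, \<gamma> 1} = {vector [\<alpha>, g \<alpha>], vector [\<beta>, g \<beta>]}"
proof -
  define p where "p = (\<lambda>s. \<gamma> s $ 1)"
  define q where "q = (\<lambda>s. \<gamma> s $ 2)"
  have on: "\<gamma> s = vector [p s, g (p s)] \<and> \<alpha> \<le> p s \<and> p s \<le> \<beta>" if "s \<in> {0..1}" for s
  proof -
    have "\<gamma> s \<in> \<gamma> ` {0..1}" using that by blast
    then show ?thesis unfolding graph p_def by auto
  qed
  have qp: "q s = g (p s)" if "s \<in> {0..1}" for s using on[OF that] by (metis q_def vector_2(2))
  have c\<gamma>: "continuous_on {0..1} \<gamma>"
    using has_vector_derivative_continuous[OF \<gamma>] by (simp add: continuous_on_eq_continuous_within)
  then have cp: "continuous_on {0..1} p" unfolding p_def by (intro continuous_intros)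
  have hit: "\<exists>s\<in>{0..1}. p s = y" if "\<alpha> \<le> y" "y \<le> \<beta>" for y
  proof -
    have "vector [y, g y] \<in> \<gamma> ` {0..1}" unfolding graph using that by blast
    then show ?thesis unfolding p_def by (metis imageE vector_2(1))
  qed
  have d: "(p has_real_derivative \<gamma>' s $ 1) (at s)" "(q has_real_derivative \<gamma>' s $ 2) (at s)"
    if "s \<in> {0<..<1}" for s
  proof -
    have "(\<gamma> has_vector_derivative \<gamma>' s) (at s)" using \<gamma>[of s] that by (auto simp: at_within_Icc_at)
    then show "(p has_real_derivative \<gamma>' s $ 1) (at s)" "(q has_real_derivative \<gamma>' s $ 2) (at s)"
      unfolding p_def q_def has_real_derivative_iff_has_vector_derivative
      by (auto intro: bounded_linear.has_vector_derivative[OF bounded_linear_vec_nth])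
  qed
  have noext: False
    if "0 \<le> a" "b \<le> 1" "\<tau> \<in> {a<..<b}" "\<sigma> \<in> {1, -1::real}" "\<And>s. s \<in> {a..b} \<Longrightarrow> \<sigma> * p s \<le> \<sigma> * p \<tau>" for a b \<tau> \<sigma>
  proof (rule no_turning_point[of a b "\<lambda>s. \<sigma> * p s" \<tau> q "\<gamma>' \<tau> $ 2"])
    have \<tau>: "\<tau> \<in> {0<..<1}" using that by auto
    show "continuous_on {a..b} (\<lambda>s. \<sigma> * p s)"
      by (intro continuous_intros continuous_on_subset[OF cp]) (use that in auto)
    show "(q has_real_derivative \<gamma>' \<tau> $ 2) (at \<tau>)" by (rule d[OF \<tau>])
    have "((\<lambda>s. \<sigma> * p s) has_real_derivative \<sigma> * \<gamma>' \<tau> $ 1) (at \<tau>)"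
      by (intro DERIV_cmult d[OF \<tau>])
    moreover have "\<forall>y. \<bar>\<tau> - y\<bar> < min (\<tau> - a) (b - \<tau>) \<longrightarrow> \<sigma> * p y \<le> \<sigma> * p \<tau>"
      by (intro allI impI that(5)) (auto simp: abs_diff_less_iff)
    ultimately have "\<sigma> * \<gamma>' \<tau> $ 1 = 0"
      using DERIV_local_max[of "\<lambda>s. \<sigma> * p s" "\<sigma> * \<gamma>' \<tau> $ 1" \<tau> "min (\<tau> - a) (b - \<tau>)"] that(3) by auto
    then have "\<gamma>' \<tau> $ 1 = 0" using that(4) by auto
    then show "\<gamma>' \<tau> $ 2 \<noteq> 0" using reg[of \<tau>] \<tau> by (auto simp: vec_eq_iff forall_2)
    show "q s = q s'" if "s \<in> {a..b}" "s' \<in> {a..b}" "\<sigma> * p s = \<sigma> * p s'" for s s'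
      using that \<open>\<sigma> \<in> {1, -1}\<close> \<open>0 \<le> a\<close> \<open>b \<le> 1\<close> qp[of s] qp[of s'] by auto
  qed (use that in auto)
  have inj: "p s1 \<noteq> p s2" if s: "0 \<le> s1" "s1 < s2" "s2 \<le> 1" for s1 s2
  proof
    assume eq: "p s1 = p s2"
    have c: "continuous_on {s1..s2} p" by (rule continuous_on_subset[OF cp]) (use s in auto)
    obtain M where M: "M \<in> {s1..s2}" "\<And>y. y \<in> {s1..s2} \<Longrightarrow> p y \<le> p M"
      using continuous_attains_sup[OF compact_Icc _ c] s by force
    obtain m where m: "m \<in> {s1..s2}" "\<And>y. y \<in> {s1..s2} \<Longrightarrow> p m \<le> p y"
      using continuous_attains_inf[OF compact_Icc _ c] s by force
    show False
    proof (cases "M \<in> {s1<..<s2}")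
      case True
      then show False using noext[of s1 s2 M 1] M s by auto
    next
      case nM: False
      show False
      proof (cases "m \<in> {s1<..<s2}")
        case True
        then show False using noext[of s1 s2 m "-1"] m s by auto
      next
        case False
        then have "p m = p s1" "p M = p s1" using nM m(1) M(1) eq by (auto simp: not_less)
        then have const: "p y = p s1" if "y \<in> {s1..s2}" for y using m(2) M(2) that by (metis antisym)
        show False
        proof (rule noext[of s1 s2 "(s1 + s2) / 2" 1])
          fix y assume "y \<in> {s1..s2}"
          moreover have "(s1 + s2) / 2 \<in> {s1..s2}" using s by simp
          ultimately show "1 * p y \<le> 1 * p ((s1 + s2) / 2)" using const by (metis order_refl)
        qed (use s in auto)
      qed
    qed
  qed
  have end_: "p e \<in> {\<alpha>, \<beta>}" if e: "e \<in> {0, 1}" for e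
  proof (rule ccontr)
    assume n: "p e \<notin> {\<alpha>, \<beta>}"
    have "\<alpha> \<le> p e" "p e \<le> \<beta>" using on[of e] e by auto
    then have pe: "\<alpha> < p e" "p e < \<beta>" using n by auto
    then obtain sa sb where sa: "sa \<in> {0..1}" "p sa = \<alpha>" and sb: "sb \<in> {0..1}" "p sb = \<beta>"
      using hit[of \<alpha>] hit[of \<beta>] by auto
    obtain s where s: "min sa sb \<le> s" "s \<le> max sa sb" "p s = p e"
    proof (cases "sa \<le> sb")
      case True
      have "continuous_on {sa..sb} p" by (rule continuous_on_subset[OF cp]) (use sa sb in auto)
      from IVT'[of p sa "p e" sb, OF _ _ True this] pe sa sb that[of] show ?thesis by force
    next
      case False
      have "continuous_on {sb..sa} p" by (rule continuous_on_subset[OF cp]) (use sa sb in auto)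
      from IVT2'[of p sa "p e" sb, OF _ _ _ this] pe sa sb False that[of] show ?thesis by force
    qed
    have "s \<noteq> sa" "s \<noteq> sb" using s(3) sa(2) sb(2) pe by auto
    then have "s \<noteq> e" "s \<in> {0..1}" using s sa(1) sb(1) e by (auto simp: min_def max_def split: if_splits)
    then show False using inj[of s e] inj[of e s] s(3) e by force
  qed
  have ne: "p 0 \<noteq> p 1" using inj[of 0 1] by simp
  have "\<alpha> \<noteq> \<beta>" using ne end_[of 0] end_[of 1] by auto
  moreover have "\<alpha> \<le> \<beta>" using on[of 0] by auto
  ultimately show "\<alpha> < \<beta>" by simp
  have "p 0 = \<alpha> \<and> p 1 = \<beta> \<or> p 0 = \<beta> \<and> p 1 = \<alpha>" using ne end_[of 0] end_[of 1] by auto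
  then show "{\<gamma> 0, \<gamma> 1} = {vector [\<alpha>, g \<alpha>], vector [\<beta>, g \<beta>]}"
    using on[of 0] on[of 1] by auto
  have i1: "compact (\<gamma> ` {0..1})" by (intro compact_continuous_image c\<gamma> compact_Icc)
  have i2: "continuous_on (\<gamma> ` {0..1}) (\<lambda>v. v $ 1)" by (intro continuous_intros)
  have i3: "\<forall>v\<in>\<gamma> ` {0..1}. vector [v $ 1, g (v $ 1)] = v" unfolding graph by auto
  have "continuous_on ((\<lambda>v. v $ 1) ` (\<gamma> ` {0..1})) (\<lambda>y. vector [y, g y] :: real^2)"
    by (rule continuous_on_inv[OF i2 i1 i3])
  moreover have "(\<lambda>v. v $ 1) ` (\<gamma> ` {0..1}) = {\<alpha>..\<beta>}"
    unfolding graph by (auto simp: image_iff intro!: exI)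
  ultimately have "continuous_on {\<alpha>..\<beta>} (\<lambda>y. (vector [y, g y] :: real^2) $ 2)"
    by (intro continuous_on_component) simp
  then show "continuous_on {\<alpha>..\<beta>} g" by simp
qed

section \<open>The region above a graph\<close>

text \<open>
  The part of the plane above the graph of \<open>g\<close> over \<open>[\<alpha>, \<beta>]\<close>, bounded on the left and on the
  right by two rays that leave the points \<open>(-l, 0)\<close> and \<open>(l, 0)\<close> upwards and away from
  \<open>(0, -k)\<close>. The alternatives with \<open>q \<le> 0\<close> admit the pocket between a disc and a graph that
  leaves this disc outwards and then turns back below it.
\<close>

definition above_graph :: "real \<Rightarrow> real \<Rightarrow> real \<Rightarrow> real \<Rightarrow> (real \<Rightarrow> real) \<Rightarrow> real \<Rightarrow> real \<Rightarrow> bool" where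
  "above_graph l k \<alpha> \<beta> g p q \<longleftrightarrow>
     (\<alpha> \<le> p \<and> p \<le> \<beta> \<longrightarrow> g p \<le> q) \<and>
     (p \<le> - l \<longrightarrow> k / l * (- p - l) \<le> q \<or> q \<le> 0 \<and> \<alpha> \<le> p) \<and>
     (l \<le> p \<longrightarrow> k / l * (p - l) \<le> q \<or> q \<le> 0 \<and> p \<le> \<beta>)"

text \<open>
  The region can be entered or left only through its boundary, which consists of the graph, of
  pieces inside the disc of radius \<open>r\<close>, and of the ray. The part of the ray outside this disc lies
  outside the circle about \<open>(0, -k)\<close> with radius
  \<open>r + sqrt (l\<^sup>2 + k\<^sup>2)\<close>, which encloses the disc and touches it on the ray. This is why the ray
  points away from \<open>(0, -k)\<close>.
\<close>

lemma above_graph_locally_constant_left: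
  fixes p q :: "'a \<Rightarrow> real" and g :: "real \<Rightarrow> real"
  assumes lk: "l > 0" "k > 0" and ab: "\<alpha> < - l" "l < \<beta>" and r: "r > 0"
    and g: "continuous_on UNIV g" and end_: "(\<alpha> + l)\<^sup>2 + (g \<alpha>)\<^sup>2 \<le> r\<^sup>2"
    and p: "(p \<longlongrightarrow> p0) F" and q: "(q \<longlongrightarrow> q0) F"
    and off: "\<not> (\<alpha> \<le> p0 \<and> p0 \<le> \<beta> \<and> q0 = g p0)" and ball: "r\<^sup>2 < (p0 + l)\<^sup>2 + q0\<^sup>2"
    and far: "\<not> (0 \<le> q0 \<and> (r + sqrt (l\<^sup>2 + k\<^sup>2))\<^sup>2 \<le> p0\<^sup>2 + (q0 + k)\<^sup>2)"
    and p0: "p0 < l"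
  defines "C1 \<equiv> \<lambda>x. \<alpha> \<le> p x \<and> p x \<le> \<beta> \<longrightarrow> g (p x) \<le> q x"
  defines "C2 \<equiv> \<lambda>x. p x \<le> - l \<longrightarrow> k / l * (- p x - l) \<le> q x \<or> q x \<le> 0 \<and> \<alpha> \<le> p x"
  shows "(\<forall>\<^sub>F x in F. C1 x \<and> C2 x) \<or> (\<forall>\<^sub>F x in F. \<not> (C1 x \<and> C2 x))"
proof -
  have "isCont g p0" using g by (simp add: continuous_on_eq_continuous_at)
  then have gp: "((\<lambda>x. g (p x)) \<longlongrightarrow> g p0) F" using p by (rule isCont_tendsto_compose)
  define ray where "ray = (\<lambda>p. k / l * (- p - l))"
  have rp: "((\<lambda>x. ray (p x)) \<longlongrightarrow> ray p0) F" unfolding ray_def by (intro tendsto_intros p)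
  have ray0: "p0 \<le> - l \<Longrightarrow> 0 \<le> ray p0" using lk by (simp add: ray_def)
  have ray_pos: "p0 < - l \<Longrightarrow> 0 < ray p0" using lk by (simp add: ray_def)
  note lt = order_tendstoD(2)[OF p] order_tendstoD(1)[OF p] order_tendstoD(2)[OF q] order_tendstoD(1)[OF q]
  have qr: "q0 \<noteq> ray p0" if "p0 < - l"
  proof
    assume eq: "q0 = ray p0"
    define t where "t = - p0 - l"
    define N where "N = sqrt (l\<^sup>2 + k\<^sup>2)"
    have t: "t > 0" "p0 = - l - t" using that by (auto simp: t_def)
    have N: "N > 0" "N\<^sup>2 = l\<^sup>2 + k\<^sup>2" using lk by (auto simp: N_def add_pos_pos)
    have q0: "q0 = k * t / l" using eq by (simp add: ray_def t)
    have "(p0 + l)\<^sup>2 + q0\<^sup>2 = (l\<^sup>2 + k\<^sup>2) * (t / l)\<^sup>2"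
      using lk by (simp add: t(2) q0 field_simps power2_eq_square)
    also have "\<dots> = (N * (t / l))\<^sup>2" by (simp only: power_mult_distrib N(2))
    finally have "(p0 + l)\<^sup>2 + q0\<^sup>2 = (N * (t / l))\<^sup>2" .
    then have "r < N * (t / l)"
      using ball lk t N by (intro power_less_imp_less_base[of r 2]) auto
    then have "r + N \<le> N * (1 + t / l)" by (simp add: algebra_simps)
    then have "(r + N)\<^sup>2 \<le> (N * (1 + t / l))\<^sup>2" using r N by (intro power_mono) auto
    also have "\<dots> = (l\<^sup>2 + k\<^sup>2) * (1 + t / l)\<^sup>2" by (simp only: power_mult_distrib N(2))
    also have "\<dots> = p0\<^sup>2 + (q0 + k)\<^sup>2"
      using lk by (simp add: t(2) q0 field_simps power2_eq_square)
    finally show False using far q0 lk t by (simp add: N_def)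
  qed
  have le_r: "\<bar>q0\<bar> > \<bar>y\<bar>" if "(p0 + l)\<^sup>2 + y\<^sup>2 \<le> r\<^sup>2" for y
  proof -
    have "y\<^sup>2 < q0\<^sup>2" using that ball by linarith
    then show ?thesis by (intro power2_less_imp_less[of "\<bar>y\<bar>"]) auto
  qed
  have eC2: "(\<forall>\<^sub>F x in F. C2 x) \<or> (\<forall>\<^sub>F x in F. \<not> C2 x)" if ne: "p0 \<noteq> \<alpha> \<or> 0 < q0"
  proof -
    consider "- l < p0" | "p0 = - l" "q0 > 0" | "p0 = - l" "q0 < 0" | "p0 < - l" "ray p0 < q0"
      | "p0 < - l" "q0 < ray p0" "q0 > 0" | "p0 < - l" "q0 < ray p0" "p0 < \<alpha>"
      | "p0 < - l" "q0 < 0" "\<alpha> < p0" | "p0 < - l" "q0 = 0" "\<alpha> < p0"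
    proof -
      have "q0 \<noteq> 0" if "p0 = - l" using le_r[of 0] that r by auto
      moreover have "q0 \<noteq> ray p0" if "p0 < - l" using that by (rule qr)
      ultimately have "- l < p0 \<or> p0 = - l \<and> q0 > 0 \<or> p0 = - l \<and> q0 < 0 \<or> p0 < - l \<and> ray p0 < q0
        \<or> p0 < - l \<and> q0 < ray p0 \<and> q0 > 0 \<or> p0 < - l \<and> q0 < ray p0 \<and> p0 < \<alpha>
        \<or> p0 < - l \<and> q0 < 0 \<and> \<alpha> < p0 \<or> p0 < - l \<and> q0 = 0 \<and> \<alpha> < p0"
        using ne by (cases "p0 < - l"; cases "q0 < ray p0"; cases "q0 = 0"; cases "q0 < 0"; cases "p0 = - l"; auto)
      then show ?thesis using that by (elim disjE) auto
    qed
    then show ?thesis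
    proof cases
      case 1
      then have "\<forall>\<^sub>F x in F. - l < p x" by (rule lt)
      then have "\<forall>\<^sub>F x in F. C2 x" by eventually_elim (auto simp: C2_def)
      then show ?thesis ..
    next
      case 2
      then have "ray p0 < q0" by (simp add: ray_def)
      then have "\<forall>\<^sub>F x in F. ray (p x) < q x" by (rule eventually_less_of_tendsto[OF rp q])
      then have "\<forall>\<^sub>F x in F. C2 x" by (rule eventually_mono) (auto simp: C2_def ray_def)
      then show ?thesis ..
    next
      case 3
      then have "\<forall>\<^sub>F x in F. q x < 0" "\<forall>\<^sub>F x in F. \<alpha> < p x" using lt ab by auto
      then have "\<forall>\<^sub>F x in F. C2 x" by eventually_elim (auto simp: C2_def)
      then show ?thesis ..
    next
      case 4
      then have "\<forall>\<^sub>F x in F. ray (p x) < q x" by (intro eventually_less_of_tendsto[OF rp q])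
      then have "\<forall>\<^sub>F x in F. C2 x" by (rule eventually_mono) (auto simp: C2_def ray_def)
      then show ?thesis ..
    next
      case 5
      then have "\<forall>\<^sub>F x in F. q x < ray (p x)" "\<forall>\<^sub>F x in F. 0 < q x" "\<forall>\<^sub>F x in F. p x < - l"
        using lt by (auto intro: eventually_less_of_tendsto[OF q rp])
      then have "\<forall>\<^sub>F x in F. \<not> C2 x" by eventually_elim (auto simp: C2_def ray_def)
      then show ?thesis ..
    next
      case 6
      then have "\<forall>\<^sub>F x in F. q x < ray (p x)" "\<forall>\<^sub>F x in F. p x < \<alpha>" "\<forall>\<^sub>F x in F. p x < - l"
        using lt by (auto intro: eventually_less_of_tendsto[OF q rp])
      then have "\<forall>\<^sub>F x in F. \<not> C2 x" by eventually_elim (auto simp: C2_def ray_def)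
      then show ?thesis ..
    next
      case 7
      then have "\<forall>\<^sub>F x in F. q x < 0" "\<forall>\<^sub>F x in F. \<alpha> < p x" using lt by auto
      then have "\<forall>\<^sub>F x in F. C2 x" by eventually_elim (auto simp: C2_def)
      then show ?thesis ..
    next
      case 8
      have "(p0 + l)\<^sup>2 \<le> (\<alpha> + l)\<^sup>2" using 8 by (intro abs_le_square_iff[THEN iffD1]) auto
      then have "(p0 + l)\<^sup>2 + 0\<^sup>2 \<le> r\<^sup>2" using end_ by (smt (verit) zero_le_power2 zero_power2)
      then show ?thesis using le_r[of 0] 8 by simp
    qed
  qed
  show ?thesis
  proof (cases "p0 = \<alpha>")
    case False
    have "(\<forall>\<^sub>F x in F. C1 x) \<or> (\<forall>\<^sub>F x in F. \<not> C1 x)"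
    proof (cases "p0 < \<alpha>")
      case True
      then have "\<forall>\<^sub>F x in F. p x < \<alpha>" by (rule lt)
      then have "\<forall>\<^sub>F x in F. C1 x" by eventually_elim (auto simp: C1_def)
      then show ?thesis ..
    next
      case nless: False
      then have "\<alpha> < p0" using False by simp
      moreover have "p0 < \<beta>" using p0 ab by simp
      ultimately have "q0 \<noteq> g p0" using off by auto
      then consider "g p0 < q0" | "q0 < g p0" by linarith
      then show ?thesis
      proof cases
        case 1
        then have "\<forall>\<^sub>F x in F. g (p x) < q x" by (rule eventually_less_of_tendsto[OF gp q])
        then have "\<forall>\<^sub>F x in F. C1 x" by eventually_elim (auto simp: C1_def)
        then show ?thesis ..
      next
        case 2
        then have "\<forall>\<^sub>F x in F. q x < g (p x)" "\<forall>\<^sub>F x in F. \<alpha> < p x" "\<forall>\<^sub>F x in F. p x < \<beta>"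
          using lt \<open>\<alpha> < p0\<close> \<open>p0 < \<beta>\<close> by (auto intro: eventually_less_of_tendsto[OF q gp])
        then have "\<forall>\<^sub>F x in F. \<not> C1 x" by eventually_elim (auto simp: C1_def)
        then show ?thesis ..
      qed
    qed
    then show ?thesis using eC2 False by (intro eventually_conj_decided) simp_all
  next
    case True
    then have qg: "\<bar>q0\<bar> > \<bar>g p0\<bar>" using le_r[of "g p0"] end_ by simp
    show ?thesis
    proof (cases "q0 > 0")
      case q0: True
      then have "g p0 < q0" using qg by linarith
      then have "\<forall>\<^sub>F x in F. g (p x) < q x" by (rule eventually_less_of_tendsto[OF gp q])
      then have "\<forall>\<^sub>F x in F. C1 x" by (rule eventually_mono) (auto simp: C1_def)
      then show ?thesis using eC2 q0 by (intro eventually_conj_decided) simp_all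
    next
      case q0: False
      then have "q0 < g p0" "q0 < ray p0" using qg True ab ray_pos by auto
      then have "\<forall>\<^sub>F x in F. q x < g (p x)" "\<forall>\<^sub>F x in F. q x < ray (p x)"
        "\<forall>\<^sub>F x in F. p x < - l" "\<forall>\<^sub>F x in F. p x < \<beta>"
        using lt True ab lk by (auto intro: eventually_less_of_tendsto[OF q gp] eventually_less_of_tendsto[OF q rp])
      then have "\<forall>\<^sub>F x in F. \<not> (C1 x \<and> C2 x)"
        by eventually_elim (auto simp: C1_def C2_def ray_def)
      then show ?thesis ..
    qed
  qed
qed

text \<open>
  The right half follows from the left half by reflection.
\<close>

lemma above_graph_locally_constant:
  fixes p q :: "'a \<Rightarrow> real" and g :: "real \<Rightarrow> real"
  assumes lk: "l > 0" "k > 0" and ab: "\<alpha> < - l" "l < \<beta>" and r: "r > 0"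
    and g: "continuous_on UNIV g"
    and end1: "(\<alpha> + l)\<^sup>2 + (g \<alpha>)\<^sup>2 \<le> r\<^sup>2" and end2: "(\<beta> - l)\<^sup>2 + (g \<beta>)\<^sup>2 \<le> r\<^sup>2"
    and p: "(p \<longlongrightarrow> p0) F" and q: "(q \<longlongrightarrow> q0) F"
    and off: "\<not> (\<alpha> \<le> p0 \<and> p0 \<le> \<beta> \<and> q0 = g p0)"
    and ball1: "r\<^sup>2 < (p0 + l)\<^sup>2 + q0\<^sup>2" and ball2: "r\<^sup>2 < (p0 - l)\<^sup>2 + q0\<^sup>2"
    and far: "\<not> (0 \<le> q0 \<and> (r + sqrt (l\<^sup>2 + k\<^sup>2))\<^sup>2 \<le> p0\<^sup>2 + (q0 + k)\<^sup>2)"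
  shows "(\<forall>\<^sub>F x in F. above_graph l k \<alpha> \<beta> g (p x) (q x)) \<or>
         (\<forall>\<^sub>F x in F. \<not> above_graph l k \<alpha> \<beta> g (p x) (q x))"
proof (cases "p0 < l")
  case True
  have "\<forall>\<^sub>F x in F. p x < l" using order_tendstoD(2)[OF p True] .
  from above_graph_locally_constant_left[OF lk ab r g end1 p q off ball1 far True]
  show ?thesis
  proof (elim disjE, goal_cases)
    case 1
    with \<open>\<forall>\<^sub>F x in F. p x < l\<close> have "\<forall>\<^sub>F x in F. above_graph l k \<alpha> \<beta> g (p x) (q x)"
      by eventually_elim (auto simp: above_graph_def)
    then show ?case ..
  next
    case 2
    with \<open>\<forall>\<^sub>F x in F. p x < l\<close> have "\<forall>\<^sub>F x in F. \<not> above_graph l k \<alpha> \<beta> g (p x) (q x)"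
      by eventually_elim (auto simp: above_graph_def)
    then show ?case ..
  qed
next
  case False
  have p': "((\<lambda>x. - p x) \<longlongrightarrow> - p0) F" by (intro tendsto_intros p)
  have g': "continuous_on UNIV (\<lambda>x. g (- x))"
    by (rule continuous_on_compose2[OF g]) (auto intro: continuous_intros)
  have ev: "\<forall>\<^sub>F x in F. - l < p x" using order_tendstoD(1)[OF p, of "- l"] False lk by simp
  have hyps: "- \<beta> < - l" "l < - \<alpha>" "(- \<beta> + l)\<^sup>2 + (g (- (- \<beta>)))\<^sup>2 \<le> r\<^sup>2" "r\<^sup>2 < (- p0 + l)\<^sup>2 + q0\<^sup>2"
    "\<not> (- \<beta> \<le> - p0 \<and> - p0 \<le> - \<alpha> \<and> q0 = g (- (- p0)))"
    "\<not> (0 \<le> q0 \<and> (r + sqrt (l\<^sup>2 + k\<^sup>2))\<^sup>2 \<le> (- p0)\<^sup>2 + (q0 + k)\<^sup>2)" "- p0 < l"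
    using end2 ball2 ab off far False lk by (auto simp: power2_commute[of l])
  from above_graph_locally_constant_left[OF lk hyps(1,2) r g' hyps(3) p' q hyps(5,4,6,7)]
  show ?thesis
  proof (elim disjE, goal_cases)
    case 1
    with ev have "\<forall>\<^sub>F x in F. above_graph l k \<alpha> \<beta> g (p x) (q x)"
      by eventually_elim (auto simp: above_graph_def)
    then show ?case ..
  next
    case 2
    with ev have "\<forall>\<^sub>F x in F. \<not> above_graph l k \<alpha> \<beta> g (p x) (q x)"
      by eventually_elim (auto simp: above_graph_def)
    then show ?case ..
  qed
qed

lemma above_graph_lower_bound:
  assumes "above_graph l k \<alpha> \<beta> g p q" "l > 0" "k > 0" "\<alpha> < - l" "l < \<beta>"
    and "\<And>p. p \<in> {\<alpha>..\<beta>} \<Longrightarrow> - G \<le> g p" "G \<ge> 0"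
  shows "- G \<le> q"
proof -
  consider "p \<in> {\<alpha>..\<beta>}" | "p < \<alpha>" | "\<beta> < p" by force
  then show ?thesis
  proof cases
    case 1
    then show ?thesis using assms(1) assms(6)[OF 1] by (auto simp: above_graph_def)
  next
    case 2
    then have "k / l * (- p - l) \<le> q" using assms by (auto simp: above_graph_def)
    moreover have "0 \<le> k / l * (- p - l)" using 2 assms by simp
    ultimately show ?thesis using assms(7) by linarith
  next
    case 3
    then have "k / l * (p - l) \<le> q" using assms by (auto simp: above_graph_def)
    moreover have "0 \<le> k / l * (p - l)" using 3 assms by simp
    ultimately show ?thesis using assms(7) by linarith
  qed
qed

text \<open>
  A disc of radius \<open>R > 1 / \<nu>\<close> is pushed upwards, from far below up to a final position slightly
  below the circle about \<open>(0, -k)\<close> that encloses both discs and touches them. On the boundary of the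
  region above the graph either \<open>u \<ge> \<mu>\<close> is known, or the moving disc does not get there. The sign
  \<open>\<sigma>\<close> treats the regions above and below the graph at the same time.
\<close>

lemma supersolution_fills_above_graph:
  fixes u :: "(real^2) \<times> real \<Rightarrow> real" and g :: "real \<Rightarrow> real"
  assumes super: "viscosity_supersolution \<nu> \<Psi>m \<Psi>p u0 u" and cont: "continuous_on spacetime u"
    and \<nu>: "\<nu> > 0" and lk: "l > 0" "k > 0" and ab: "\<alpha> < - l" "l < \<beta>" and r: "r > 0"
    and \<sigma>: "\<sigma> \<in> {1, -1}"
    and R: "R = r + sqrt (l\<^sup>2 + k\<^sup>2)" "R > 1 / \<nu>"
    and g: "continuous_on UNIV g" and G: "\<And>p. p \<in> {\<alpha>..\<beta>} \<Longrightarrow> \<bar>g p\<bar> \<le> G"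
    and end1: "(\<alpha> + l)\<^sup>2 + (g \<alpha>)\<^sup>2 \<le> r\<^sup>2" and end2: "(\<beta> - l)\<^sup>2 + (g \<beta>)\<^sup>2 \<le> r\<^sup>2"
    and K1: "\<And>p t. p \<in> {\<alpha>..\<beta>} \<Longrightarrow> t \<ge> 0 \<Longrightarrow> \<mu> \<le> u (vector [p, \<sigma> * g p], t)"
    and K2: "\<And>x t. norm (x - vector [- l, 0]) \<le> r \<or> norm (x - vector [l, 0]) \<le> r \<Longrightarrow> t \<ge> 0 \<Longrightarrow> \<mu> \<le> u (x, t)"
    and obst: "\<And>x. norm x \<le> 3 * R + G + 4 \<Longrightarrow> \<mu> \<le> \<Psi>p x"
    and x: "above_graph l k \<alpha> \<beta> g (x $ 1) (\<sigma> * x $ 2)" "norm (x - vector [0, - \<sigma> * k]) < R"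
  shows "\<exists>\<tau>>0. \<forall>t>\<tau>. \<mu> \<le> u (x, t)"
proof -
  have G0: "G \<ge> 0" using G[of 0] ab lk by force
  have kR: "k < R" "R > 0"
  proof -
    have "k < sqrt (l\<^sup>2 + k\<^sup>2)" using lk by (intro real_less_rsqrt) simp
    then show "k < R" using r by (simp add: R(1))
    then show "R > 0" using lk by simp
  qed
  define c where "c = (vector [0, - \<sigma> * k] :: real^2)"
  \<comment> \<open>for \<open>\<sigma> = 1\<close> the centre of the disc stops at distance \<open>s\<close> below \<open>(0, -k)\<close>, which keeps the disc
    away from the rays outside the fixed discs; \<open>S\<close> is so large that it starts below the region\<close>
  define s where "s = min 1 ((R - norm (x - c)) / 2)"
  have s: "0 < s" "s \<le> 1" "norm (x - c) + s < R" using x(2) by (auto simp: s_def c_def min_def field_simps)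
  define S where "S = R + G + 2"
  define v0 where "v0 = (vector [0, - \<sigma> * (k + s)] :: real^2)"
  define v1 where "v1 = (vector [0, - \<sigma> * S] :: real^2)"
  define M where "M = 3 * R + G + 4"
  define X where "X = closure {y :: real^2. above_graph l k \<alpha> \<beta> g (y $ 1) (\<sigma> * y $ 2)} \<inter> cball 0 M"
  have sq: "(norm (y - (v0 + \<theta> *\<^sub>R v1)))\<^sup>2 = (y $ 1)\<^sup>2 + (\<sigma> * y $ 2 + k + s + \<theta> * S)\<^sup>2" for y \<theta>
  proof -
    have "y $ 2 + \<sigma> * (k + s + \<theta> * S) = \<sigma> * (\<sigma> * y $ 2 + k + s + \<theta> * S)"
      using \<sigma> by (auto simp: algebra_simps)
    then have "(y $ 2 + \<sigma> * (k + s + \<theta> * S))\<^sup>2 = (\<sigma> * y $ 2 + k + s + \<theta> * S)\<^sup>2"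
      using \<sigma> by (auto simp: power_mult_distrib)
    moreover have "(norm (y - (v0 + \<theta> *\<^sub>R v1)))\<^sup>2 = (y $ 1)\<^sup>2 + (y $ 2 + \<sigma> * (k + s + \<theta> * S))\<^sup>2"
      unfolding norm_squared_2 by (simp add: v0_def v1_def power2_eq_square algebra_simps)
    ultimately show ?thesis by simp
  qed
  have nv: "norm v0 = k + s" "norm v1 = S"
  proof -
    have "(norm v0)\<^sup>2 = (k + s)\<^sup>2" "(norm v1)\<^sup>2 = S\<^sup>2"
      unfolding norm_squared_2 using \<sigma> by (auto simp: v0_def v1_def power2_eq_square algebra_simps)
    then show "norm v0 = k + s" "norm v1 = S" using lk s kR G0 by (simp_all add: S_def)
  qed
  have X: "compact X" unfolding X_def by (intro closed_Int_compact) auto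
  have low: "- G \<le> \<sigma> * y $ 2" if "y \<in> X" for y
  proof -
    have "closure {y :: real^2. above_graph l k \<alpha> \<beta> g (y $ 1) (\<sigma> * y $ 2)} \<subseteq> {y. - G \<le> \<sigma> * y $ 2}"
    proof (rule closure_minimal)
      show "closed {y :: real^2. - G \<le> \<sigma> * y $ 2}"
        by (intro closed_Collect_le continuous_intros)
      have "- G \<le> g p" if "p \<in> {\<alpha>..\<beta>}" for p using G[OF that] by linarith
      then show "{y :: real^2. above_graph l k \<alpha> \<beta> g (y $ 1) (\<sigma> * y $ 2)} \<subseteq> {y. - G \<le> \<sigma> * y $ 2}"
        using above_graph_lower_bound[OF _ lk ab _ G0] by blast
    qed
    then show ?thesis using that by (auto simp: X_def)
  qed
  have far_s: "R\<^sup>2 - (norm (y - (v0 + \<theta> *\<^sub>R v1)))\<^sup>2 \<le> - s\<^sup>2"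
    if y: "R\<^sup>2 \<le> (y $ 1)\<^sup>2 + (\<sigma> * y $ 2 + k)\<^sup>2" "0 \<le> \<sigma> * y $ 2" and \<theta>: "\<theta> \<in> {0..1}" for y \<theta>
  proof -
    have "0 \<le> \<theta> * S" using \<theta> kR G0 by (simp add: S_def)
    then have "(\<sigma> * y $ 2 + k + s)\<^sup>2 \<le> (\<sigma> * y $ 2 + k + s + \<theta> * S)\<^sup>2"
      using y(2) lk s by (intro power_mono) auto
    moreover have "(\<sigma> * y $ 2 + k)\<^sup>2 + s\<^sup>2 \<le> (\<sigma> * y $ 2 + k + s)\<^sup>2"
      using y(2) lk s by (simp add: power2_sum[of "\<sigma> * y $ 2 + k" s])
    ultimately show ?thesis unfolding sq using y(1) by linarith
  qed
  have large: "R\<^sup>2 - d\<^sup>2 \<le> - s\<^sup>2" if "R + 1 \<le> d" for d :: real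
  proof -
    have "(R + 1)\<^sup>2 \<le> d\<^sup>2" using that kR by (intro power_mono) auto
    moreover have "(R + 1)\<^sup>2 = R\<^sup>2 + 2 * R + 1" by (simp add: power2_eq_square algebra_simps)
    moreover have "s\<^sup>2 \<le> 1" using s by (simp add: power_le_one)
    ultimately show ?thesis using kR by linarith
  qed
  have bdry: "y \<in> interior X \<or> (\<forall>t\<ge>0. \<mu> \<le> u (y, t)) \<or>
        (\<forall>\<theta>\<in>{0..1}. R\<^sup>2 - (norm (y - (v0 + \<theta> *\<^sub>R v1)))\<^sup>2 \<le> - s\<^sup>2)" if y: "y \<in> X" for y
  proof (rule disjCI, rule ccontr)
    assume n: "\<not> ((\<forall>t\<ge>0. \<mu> \<le> u (y, t)) \<or>
        (\<forall>\<theta>\<in>{0..1}. R\<^sup>2 - (norm (y - (v0 + \<theta> *\<^sub>R v1)))\<^sup>2 \<le> - s\<^sup>2))" and ni: "y \<notin> interior X"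
    have yM: "norm y < M"
    proof (rule ccontr)
      assume "\<not> norm y < M"
      have "R + 1 \<le> norm (y - (v0 + \<theta> *\<^sub>R v1))" if "\<theta> \<in> {0..1}" for \<theta>
      proof -
        have "norm (\<theta> *\<^sub>R v1) \<le> S" using that nv kR G0 by (simp add: mult_left_le_one_le S_def)
        then show ?thesis
          using \<open>\<not> norm y < M\<close> norm_triangle_ineq2[of y "v0 + \<theta> *\<^sub>R v1"] norm_triangle_ineq[of v0 "\<theta> *\<^sub>R v1"]
            nv kR s by (simp add: M_def S_def)
      qed
      then show False using n large by blast
    qed
    have nK1: "\<not> (\<alpha> \<le> y $ 1 \<and> y $ 1 \<le> \<beta> \<and> \<sigma> * y $ 2 = g (y $ 1))"
    proof
      assume a: "\<alpha> \<le> y $ 1 \<and> y $ 1 \<le> \<beta> \<and> \<sigma> * y $ 2 = g (y $ 1)"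
      then have "vector [y $ 1, \<sigma> * g (y $ 1)] = y"
        using \<sigma> by (auto simp: vec_eq_iff forall_2)
      then show False using n K1[of "y $ 1"] a by auto
    qed
    have b1: "r\<^sup>2 < (y $ 1 + l)\<^sup>2 + (\<sigma> * y $ 2)\<^sup>2" and b2: "r\<^sup>2 < (y $ 1 - l)\<^sup>2 + (\<sigma> * y $ 2)\<^sup>2"
      using n K2[of y] r \<sigma> norm_le_2_iff[of r "y - vector [- l, 0]"] norm_le_2_iff[of r "y - vector [l, 0]"]
      by (auto simp: power_mult_distrib)
    have nf: "\<not> (0 \<le> \<sigma> * y $ 2 \<and> (r + sqrt (l\<^sup>2 + k\<^sup>2))\<^sup>2 \<le> (y $ 1)\<^sup>2 + (\<sigma> * y $ 2 + k)\<^sup>2)"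
      using n far_s[of y] unfolding R(1)[symmetric] by blast
    have t1: "((\<lambda>z. z $ 1) \<longlongrightarrow> y $ 1) (nhds y)" and t2: "((\<lambda>z. \<sigma> * z $ 2) \<longlongrightarrow> \<sigma> * y $ 2) (nhds y)"
      by (intro tendsto_intros filterlim_ident)+
    from above_graph_locally_constant[OF lk ab r g end1 end2 t1 t2 nK1 b1 b2 nf]
    show False
    proof
      assume "\<forall>\<^sub>F z in nhds y. above_graph l k \<alpha> \<beta> g (z $ 1) (\<sigma> * z $ 2)"
      moreover have "\<forall>\<^sub>F z in nhds y. z \<in> ball 0 M" using yM by (intro eventually_nhds_in_open) auto
      ultimately have "\<forall>\<^sub>F z in nhds y. z \<in> X"
        by eventually_elim (auto simp: X_def intro: closure_subset[THEN subsetD])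
      then show False using ni by (auto simp: eventually_nhds interior_def)
    next
      assume "\<forall>\<^sub>F z in nhds y. \<not> above_graph l k \<alpha> \<beta> g (z $ 1) (\<sigma> * z $ 2)"
      then obtain W where "open W" "y \<in> W" "W \<inter> {z. above_graph l k \<alpha> \<beta> g (z $ 1) (\<sigma> * z $ 2)} = {}"
        by (auto simp: eventually_nhds)
      then show False using y open_Int_closure_eq_empty[of W] by (auto simp: X_def)
    qed
  qed
  have init: "R\<^sup>2 - (norm (y - (v0 + v1)))\<^sup>2 \<le> - s\<^sup>2" if "y \<in> X" for y
  proof -
    have "R + 1 \<le> \<sigma> * y $ 2 + k + s + 1 * S" using low[OF that] lk s by (simp add: S_def)
    then have "R\<^sup>2 - (\<sigma> * y $ 2 + k + s + 1 * S)\<^sup>2 \<le> - s\<^sup>2" by (rule large)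
    then show ?thesis using sq[of y 1, unfolded scaleR_one] zero_le_power2[of "y $ 1"] by linarith
  qed
  have xv: "norm (x - v0) < R"
  proof -
    have "(norm (v0 - c))\<^sup>2 = s\<^sup>2"
      unfolding norm_squared_2 using \<sigma> by (auto simp: v0_def c_def power2_eq_square algebra_simps)
    then have "norm (v0 - c) = s" using s by simp
    then show ?thesis using s(3) norm_triangle_ineq4[of "x - c" "v0 - c"] by simp
  qed
  have "x \<in> X"
  proof -
    have "norm c = k"
    proof -
      have "(norm c)\<^sup>2 = k\<^sup>2" unfolding norm_squared_2 using \<sigma> by (auto simp: c_def power2_eq_square)
      then show ?thesis using lk by simp
    qed
    then have "norm x \<le> M"
      unfolding M_def using x(2)[folded c_def] kR G0 norm_triangle_ineq[of "x - c" c, simplified] by linarith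
    then show ?thesis using x(1) by (auto simp: X_def intro!: closure_subset[THEN subsetD])
  qed
  have ob: "\<mu> \<le> \<Psi>p y" if "y \<in> X" for y using obst[of y] that by (simp add: X_def M_def)
  show ?thesis
    by (rule supersolution_fills_moving_disc[OF super cont X \<nu> _ R(2) ob bdry init \<open>x \<in> X\<close> xv])
      (use s in simp)
qed

section \<open>The hull of two discs\<close>

text \<open>
  The two circles of radius \<open>1 / \<nu>\<close> that touch both discs, with centres \<open>(0, h)\<close> and \<open>(0, -h)\<close>,
  give the first two bounds. In the sectors beyond the points of contact the hull is no larger
  than the discs: a point \<open>x\<close> of a sector outside the disc about \<open>a\<close> is cut off by the circle that
  rolls along this disc, with its centre on the line from \<open>x\<close> through \<open>a\<close>.
\<close>

lemma hull_of_two_discs: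
  fixes x :: "real^2" and l r \<nu> :: real
  defines "Om \<equiv> ball (vector [l, 0]) r \<union> ball (vector [- l, 0]) r"
    and "N \<equiv> 1 / \<nu> - r"
  assumes l: "l > 0" and r: "r > 0" and N: "l < N"
    and x: "\<And>y. Om \<subseteq> cball y (1 / \<nu>) \<Longrightarrow> norm (x - y) < 1 / \<nu>" and out: "x \<notin> Om"
  shows "norm (x - vector [0, sqrt (N\<^sup>2 - l\<^sup>2)]) < 1 / \<nu>"
    and "norm (x - vector [0, - sqrt (N\<^sup>2 - l\<^sup>2)]) < 1 / \<nu>"
    and "x $ 1 \<le> - l \<Longrightarrow> sqrt (N\<^sup>2 - l\<^sup>2) / l * (- x $ 1 - l) < \<bar>x $ 2\<bar>"
    and "l \<le> x $ 1 \<Longrightarrow> sqrt (N\<^sup>2 - l\<^sup>2) / l * (x $ 1 - l) < \<bar>x $ 2\<bar>"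
proof -
  define h where "h = sqrt (N\<^sup>2 - l\<^sup>2)"
  have h: "h\<^sup>2 = N\<^sup>2 - l\<^sup>2" "h \<ge> 0"
  proof -
    have "l\<^sup>2 \<le> N\<^sup>2" using l N by (intro power_mono) auto
    then show "h\<^sup>2 = N\<^sup>2 - l\<^sup>2" "h \<ge> 0" by (auto simp: h_def)
  qed
  have sub: "Om \<subseteq> cball y (1 / \<nu>)" if "norm (vector [l, 0] - y) \<le> N" "norm (vector [- l, 0] - y) \<le> N" for y
  proof -
    have "ball z r \<subseteq> cball y (1 / \<nu>)" if "norm (z - y) \<le> N" for z :: "real^2"
    proof
      fix w assume "w \<in> ball z r"
      then have "dist y w < norm (z - y) + r"
        using dist_triangle[of y w z] by (simp add: dist_norm norm_minus_commute)
      then show "w \<in> cball y (1 / \<nu>)" using that by (simp add: N_def)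
    qed
    then show ?thesis using that unfolding Om_def by blast
  qed
  have Nc: "norm (v :: real^2) \<le> N \<longleftrightarrow> (v $ 1)\<^sup>2 + (v $ 2)\<^sup>2 \<le> N\<^sup>2" for v
    by (rule norm_le_2_iff) (use l N in linarith)
  show "norm (x - vector [0, sqrt (N\<^sup>2 - l\<^sup>2)]) < 1 / \<nu>" "norm (x - vector [0, - sqrt (N\<^sup>2 - l\<^sup>2)]) < 1 / \<nu>"
    unfolding h_def[symmetric] by (rule x, rule sub; simp add: Nc h)+
  have sector: "h / l * (\<sigma> * x $ 1 - l) < \<bar>x $ 2\<bar>" if \<sigma>: "\<sigma> \<in> {1, -1}" and s: "l \<le> \<sigma> * x $ 1" for \<sigma>
  proof (rule ccontr)
    assume neg: "\<not> h / l * (\<sigma> * x $ 1 - l) < \<bar>x $ 2\<bar>"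
    define a where "a = (vector [\<sigma> * l, 0] :: real^2)"
    define d where "d = norm (x - a)"
    have "a = vector [l, 0] \<or> a = vector [- l, 0]" using \<sigma> by (auto simp: a_def)
    then have "d \<ge> r" using out by (auto simp: Om_def d_def dist_norm norm_minus_commute)
    then have d0: "d > 0" using r by simp
    define e where "e = (1 / d) *\<^sub>R (a - x)"
    define y where "y = a + N *\<^sub>R e"
    have ne: "norm e = 1" using d0 by (simp add: e_def d_def norm_minus_commute)
    have "a - x = d *\<^sub>R e" using d0 by (simp add: e_def)
    moreover have "x - y = - (a - x) - N *\<^sub>R e" by (simp add: y_def)
    ultimately have "x - y = - ((d + N) *\<^sub>R e)" by (simp add: scaleR_left_distrib)
    then have "norm (x - y) = d + N" using ne d0 l N by simp
    then have far: "1 / \<nu> \<le> norm (x - y)" using \<open>d \<ge> r\<close> by (simp add: N_def)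
    have "norm (a - y) \<le> N" using ne l N by (simp add: y_def)
    moreover have "norm (- a - y) \<le> N"
    proof -
      define m where "m = \<sigma> * x $ 1 - l"
      have m0: "m \<ge> 0" using s by (simp add: m_def)
      have "d\<^sup>2 = m\<^sup>2 + (x $ 2)\<^sup>2"
        unfolding d_def norm_squared_2 a_def m_def using \<sigma> by (auto simp: power2_eq_square algebra_simps)
      also have "(x $ 2)\<^sup>2 \<le> (h / l * m)\<^sup>2"
        using neg m0 h l by (simp add: m_def[symmetric] abs_le_square_iff[symmetric])
      also have "m\<^sup>2 + (h / l * m)\<^sup>2 = (N / l * m)\<^sup>2"
      proof -
        have "N\<^sup>2 = h\<^sup>2 + l\<^sup>2" using h(1) by simp
        then have "(N / l * m)\<^sup>2 = (h\<^sup>2 + l\<^sup>2) / l\<^sup>2 * m\<^sup>2" by (simp only: power_mult_distrib power_divide)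
        then show ?thesis using l by (simp add: power_mult_distrib power_divide field_simps)
      qed
      finally have "d\<^sup>2 \<le> (N / l * m)\<^sup>2" by simp
      moreover have "0 \<le> N / l * m" using l N m0 by simp
      ultimately have "d \<le> N / l * m" by (rule power2_le_imp_le)
      then have "l * d \<le> N * m" using l by (simp add: field_simps)
      then have ld: "l \<le> N * m / d" using d0 by (simp add: field_simps)
      have e1: "\<sigma> * e $ 1 = - m / d" using \<sigma> by (auto simp: e_def a_def m_def add_divide_distrib diff_divide_distrib)
      have "- a - y = - (2 *\<^sub>R a + N *\<^sub>R e)" by (simp add: y_def scaleR_2)
      then have "(norm (- a - y))\<^sup>2 = (norm (2 *\<^sub>R a + N *\<^sub>R e))\<^sup>2" by (simp only: norm_minus_cancel)
      also have "\<dots> = 4 * l\<^sup>2 + 4 * l * N * (\<sigma> * e $ 1) + N\<^sup>2 * (norm e)\<^sup>2"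
        unfolding norm_squared_2 a_def using \<sigma> by (auto simp: power2_eq_square algebra_simps)
      also have "\<dots> = 4 * l * (l - N * m / d) + N\<^sup>2"
        by (simp add: e1 ne algebra_simps power2_eq_square)
      also have "\<dots> \<le> N\<^sup>2" using ld l by (simp add: mult_nonneg_nonpos)
      finally show ?thesis by (rule power2_le_imp_le) (use l N in simp)
    qed
    moreover have "a = vector [l, 0] \<and> - a = vector [- l, 0] \<or> a = vector [- l, 0] \<and> - a = vector [l, 0]"
      using \<sigma> by (auto simp: a_def vec_eq_iff forall_2)
    ultimately have "Om \<subseteq> cball y (1 / \<nu>)" by (intro sub) auto
    from x[OF this] far show False by simp
  qed
  show "x $ 1 \<le> - l \<Longrightarrow> sqrt (N\<^sup>2 - l\<^sup>2) / l * (- x $ 1 - l) < \<bar>x $ 2\<bar>"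
    using sector[of "-1"] by (simp add: h_def)
  show "l \<le> x $ 1 \<Longrightarrow> sqrt (N\<^sup>2 - l\<^sup>2) / l * (x $ 1 - l) < \<bar>x $ 2\<bar>"
    using sector[of 1] by (simp add: h_def)
qed

section \<open>Long-time behaviour of the obstacle problem\<close>

lemma compact_positive_lower_bound:
  fixes f :: "'a::topological_space \<Rightarrow> real"
  assumes "compact K" "continuous_on K f" "\<And>x. x \<in> K \<Longrightarrow> 0 < f x"
  obtains m where "m > 0" "\<And>x. x \<in> K \<Longrightarrow> m \<le> f x"
proof (cases "K = {}")
  case True
  then show ?thesis using that[of 1] by simp
next
  case False
  then show ?thesis using continuous_attains_inf[OF assms(1) False assms(2)] assms(3) that by blast
qed

lemma compact_upper_bound_negative:
  fixes f :: "'a::heine_borel \<Rightarrow> real"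
  assumes "closed B" "continuous_on UNIV f" "\<And>x. x \<in> B \<Longrightarrow> f x < 0"
    and "\<And>x. dist x z \<ge> R \<Longrightarrow> f x \<le> a" "a < 0"
  obtains m where "m < 0" "\<And>x. x \<in> B \<Longrightarrow> f x \<le> m"
proof -
  have K: "compact (B \<inter> cball z R)" using assms(1) by (intro closed_Int_compact) auto
  have "continuous_on (B \<inter> cball z R) (\<lambda>x. - f x)"
    by (intro continuous_intros continuous_on_subset[OF assms(2)]) auto
  from compact_positive_lower_bound[OF K this] assms(3) obtain m where
    m: "m > 0" "\<And>x. x \<in> B \<inter> cball z R \<Longrightarrow> m \<le> - f x" by auto
  show ?thesis
  proof (rule that[of "max (- m) a"])
    fix x assume x: "x \<in> B"
    show "f x \<le> max (- m) a"
      using m(2)[of x] assms(4)[of x] x by (cases "dist x z \<ge> R") (auto simp: dist_commute max_def)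
  qed (use m assms(5) in simp)
qed

text \<open>
  In the application the discs \<open>B(z, R)\<close> and \<open>B(y, 1 / \<nu>)\<close> both contain the lower obstacle. Convex combinations of the
  functions \<open>R'\<^sup>2 - |w - z|\<^sup>2\<close> and \<open>1 / \<nu>\<^sup>2 - |w - y|\<^sup>2\<close> describe discs of radius less than
  \<open>1 / \<nu>\<close> as long as the second weight is less than 1, and these contain the obstacle as well. The
  final weight \<open>s\<close> is taken so near to 1 that \<open>x\<close>, which lies outside the second disc, is excluded. The level
  \<open>\<mu>\<close> may be chosen after \<open>f0\<close> and \<open>f1\<close>, because for closed evolutions it has to be negative
  and depends on them.
\<close>

lemma subsolution_eventually_outside_hull:
  fixes x y z :: "real^2" and u :: "(real^2) \<times> real \<Rightarrow> real"
  assumes sub: "viscosity_subsolution \<nu> \<Psi>m \<Psi>p u0 u" and cont: "continuous_on spacetime u"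
    and far: "\<And>T. T > 0 \<Longrightarrow> \<exists>R>0. \<forall>x t. norm x \<ge> R \<and> 0 \<le> t \<and> t \<le> T \<longrightarrow> u (x, t) = a"
    and \<nu>: "\<nu> > 0" and R: "0 \<le> R" "R < 1 / \<nu>" and x: "1 / \<nu> < norm (x - y)"
    and level: "\<And>\<delta> f0 f1. 0 < \<delta> \<Longrightarrow> continuous_on UNIV f0 \<Longrightarrow> continuous_on UNIV f1 \<Longrightarrow>
      (\<And>w. norm (w - z) \<le> R \<Longrightarrow> \<delta> < f0 w) \<Longrightarrow>
      (\<And>w. norm (w - z) \<le> R \<Longrightarrow> norm (w - y) \<le> 1 / \<nu> \<Longrightarrow> \<delta> < f1 w) \<Longrightarrow>
      \<exists>\<mu>\<in>J. a < \<mu> \<and> (\<forall>w. \<mu> < \<Psi>m w \<longrightarrow> \<delta> \<le> f0 w \<and> \<delta> \<le> f1 w) \<and> (\<forall>w. \<mu> < u (w, 0) \<longrightarrow> (\<delta> :: real) \<le> f0 w)"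
  shows "\<exists>\<mu>\<in>J. \<exists>\<tau>>0. \<forall>t>\<tau>. u (x, t) \<le> \<mu>"
proof -
  define I where "I = (1 / \<nu>)\<^sup>2"
  define R' where "R' = (R + 1 / \<nu>) / 2"
  have R': "R < R'" "R' < 1 / \<nu>"
  proof -
    define i where "i = 1 / \<nu>"
    show "R < R'" "R' < 1 / \<nu>" using R(2) by (auto simp: R'_def i_def[symmetric])
  qed
  have RR: "R\<^sup>2 < R'\<^sup>2" "R'\<^sup>2 < I" unfolding I_def using R R' by (auto intro!: power_strict_mono)
  define f0 where "f0 = (\<lambda>w. R'\<^sup>2 - (norm (w - z))\<^sup>2)"
  define fy where "fy = (\<lambda>w. I - (norm (w - y))\<^sup>2)"
  define A where "A = \<bar>f0 x\<bar> + 1"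
  define B where "B = - fy x"
  have B: "B > 0"
  proof -
    have "(1 / \<nu>)\<^sup>2 < (norm (x - y))\<^sup>2" using x \<nu> by (intro power_strict_mono) auto
    then show ?thesis by (simp add: B_def fy_def I_def)
  qed
  have A: "A > 0" "f0 x < A" by (auto simp: A_def)
  \<comment> \<open>with this weight the value at \<open>x\<close> is a positive multiple of \<open>f0 x - A\<close>\<close>
  define s where "s = A / (A + B)"
  have s: "0 < s" "s < 1" using A B by (auto simp: s_def)
  define f1 where "f1 = (\<lambda>w. (1 - s) * f0 w + s * fy w)"
  have f1x: "f1 x < 0"
  proof -
    have "1 - s = B / (A + B)" using A B by (simp add: s_def field_simps)
    then have "f1 x = (B * f0 x - A * B) / (A + B)"
      by (simp add: f1_def s_def B_def diff_divide_distrib)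
    also have "\<dots> < 0" using A B by (intro divide_neg_pos) (auto simp: algebra_simps)
    finally show ?thesis .
  qed
  define \<delta> where "\<delta> = (1 - s) * (R'\<^sup>2 - R\<^sup>2) / 2"
  have \<delta>: "\<delta> > 0" "2 * \<delta> = (1 - s) * (R'\<^sup>2 - R\<^sup>2)" using s RR by (auto simp: \<delta>_def)
  have \<delta>2: "2 * \<delta> \<le> R'\<^sup>2 - R\<^sup>2" unfolding \<delta>(2) using s RR by (intro mult_left_le_one_le) auto
  define v0 where "v0 = z + s *\<^sub>R (y - z)"
  define v1 where "v1 = - s *\<^sub>R (y - z)"
  define D where "D = (norm (y - z))\<^sup>2"
  define E where "E = I - R'\<^sup>2 - D"
  define r0 where "r0 = R'\<^sup>2 + s * E + s\<^sup>2 * D"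
  define r1 where "r1 = - s * E - 2 * s\<^sup>2 * D"
  define r2 where "r2 = s\<^sup>2 * D"
  have rad: "r0 + r1 * \<theta> + r2 * \<theta>\<^sup>2 = (1 - s * (1 - \<theta>)) * R'\<^sup>2 + s * (1 - \<theta>) * I - s * (1 - \<theta>) * (1 - s * (1 - \<theta>)) * D" for \<theta>
    unfolding r0_def r1_def r2_def E_def by (simp add: power2_eq_square algebra_simps)
  have comb: "r0 + r1 * \<theta> + r2 * \<theta>\<^sup>2 - (norm (w - (v0 + \<theta> *\<^sub>R v1)))\<^sup>2 = \<theta> * f0 w + (1 - \<theta>) * f1 w" for w \<theta>
  proof -
    define q where "q = s * (1 - \<theta>)"
    have ctr: "v0 + \<theta> *\<^sub>R v1 = z + q *\<^sub>R (y - z)"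
      by (simp add: v0_def v1_def q_def algebra_simps)
    have gap: "(norm (w - (z + q *\<^sub>R (y - z))))\<^sup>2
        = (1 - q) * (norm (w - z))\<^sup>2 + q * (norm (w - y))\<^sup>2 - q * (1 - q) * D"
      unfolding D_def norm_squared_2 by (simp add: algebra_simps)
    have "r0 + r1 * \<theta> + r2 * \<theta>\<^sup>2 - (norm (w - (v0 + \<theta> *\<^sub>R v1)))\<^sup>2 = (1 - q) * f0 w + q * fy w"
      unfolding rad ctr gap q_def[symmetric] by (simp add: f0_def fy_def algebra_simps)
    also have "\<dots> = \<theta> * f0 w + (1 - \<theta>) * f1 w"
      by (simp add: f1_def q_def algebra_simps)
    finally show ?thesis .
  qed
  define P where "P = (1 - s) * R'\<^sup>2 + s * I"
  have P: "r0 + r1 * \<theta> + r2 * \<theta>\<^sup>2 \<le> P" if "\<theta> \<in> {0..1}" for \<theta>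
  proof -
    define q where "q = s * (1 - \<theta>)"
    have q: "0 \<le> q" "q \<le> s" using that s by (auto simp: q_def mult_left_le)
    have "0 \<le> q * (1 - q) * D" using q s by (simp add: D_def)
    moreover have "q * (I - R'\<^sup>2) \<le> s * (I - R'\<^sup>2)" using q RR by (intro mult_right_mono) auto
    ultimately show ?thesis unfolding rad q_def[symmetric] P_def by (simp add: algebra_simps)
  qed
  have PI: "P < I"
  proof -
    have "(1 - s) * R'\<^sup>2 < (1 - s) * I" using s RR by (intro mult_strict_left_mono) auto
    then show ?thesis by (simp add: P_def algebra_simps)
  qed
  have "r0 < (norm (x - v0))\<^sup>2" using comb[of 0 x] f1x by simp
  have in0: "2 * \<delta> \<le> f0 w" if "norm (w - z) \<le> R" for w
  proof -
    have "(norm (w - z))\<^sup>2 \<le> R\<^sup>2" using that by (intro power_mono) auto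
    then show ?thesis using \<delta>2 by (simp add: f0_def)
  qed
  have in1: "2 * \<delta> \<le> f1 w" if "norm (w - z) \<le> R" "norm (w - y) \<le> 1 / \<nu>" for w
  proof -
    have "(norm (w - z))\<^sup>2 \<le> R\<^sup>2" using that by (intro power_mono) auto
    then have "(1 - s) * (R'\<^sup>2 - R\<^sup>2) \<le> (1 - s) * f0 w"
      using s by (intro mult_left_mono) (auto simp: f0_def)
    moreover have "(norm (w - y))\<^sup>2 \<le> I" unfolding I_def using that by (intro power_mono) auto
    then have "0 \<le> s * fy w" using s by (simp add: fy_def)
    ultimately show ?thesis unfolding \<delta>(2) by (simp add: f1_def)
  qed
  have cont_f: "continuous_on UNIV f0" "continuous_on UNIV f1"
    unfolding f1_def f0_def fy_def by (intro continuous_intros)+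
  have in0': "\<delta> < f0 w" if "norm (w - z) \<le> R" for w using in0[OF that] \<delta>(1) by linarith
  have in1': "\<delta> < f1 w" if "norm (w - z) \<le> R" "norm (w - y) \<le> 1 / \<nu>" for w
    using in1[OF that] \<delta>(1) by linarith
  have "\<exists>\<mu>\<in>J. a < \<mu> \<and> (\<forall>w. \<mu> < \<Psi>m w \<longrightarrow> \<delta> \<le> f0 w \<and> \<delta> \<le> f1 w) \<and> (\<forall>w. \<mu> < u (w, 0) \<longrightarrow> \<delta> \<le> f0 w)"
    by (rule level[OF \<delta>(1) cont_f in0' in1'])
  then obtain \<mu> where "\<mu> \<in> J" and \<mu>: "a < \<mu>"
    and o: "\<forall>w. \<mu> < \<Psi>m w \<longrightarrow> \<delta> \<le> f0 w \<and> \<delta> \<le> f1 w" and i: "\<forall>w. \<mu> < u (w, 0) \<longrightarrow> \<delta> \<le> f0 w"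
    by (elim bexE conjE) (rule that)
  have "\<exists>\<tau>>0. \<forall>t>\<tau>. u (x, t) \<le> \<mu>"
  proof (rule subsolution_vanishes_outside_moving_disc[OF sub cont far \<mu> \<nu> \<delta>(1) P PI[unfolded I_def] _ _ \<open>r0 < (norm (x - v0))\<^sup>2\<close>])
    fix w \<theta> assume w: "\<mu> < \<Psi>m w" and \<theta>: "\<theta> \<in> {0..1::real}"
    have "\<theta> * \<delta> + (1 - \<theta>) * \<delta> \<le> \<theta> * f0 w + (1 - \<theta>) * f1 w"
      using o[rule_format, OF w] \<theta> by (intro add_mono mult_left_mono) auto
    then show "\<delta> \<le> r0 + r1 * \<theta> + r2 * \<theta>\<^sup>2 - (norm (w - (v0 + \<theta> *\<^sub>R v1)))\<^sup>2"
      unfolding comb by (simp add: algebra_simps)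
  next
    fix w assume "\<mu> < u (w, 0)"
    from i[rule_format, OF this] show "\<delta> \<le> r0 + r1 + r2 - (norm (w - (v0 + v1)))\<^sup>2" using comb[of 1 w] by simp
  qed
  with \<open>\<mu> \<in> J\<close> show ?thesis by blast
qed

text \<open>
  All constructions are made with discs of a smaller radius \<open>r'\<close> and a circle of radius
  slightly larger than \<open>1 / \<nu>\<close> touching them, which is possible since the bounds for \<open>x\<close> are
  strict. The graph is continued by horizontal pieces inside the discs, so that it reaches beyond their
  centres. The level \<open>\<mu>\<close> may be chosen after the radii: for open evolutions it is positive
  and depends on them.
\<close>

lemma supersolution_eventually_inside_hull:
  fixes x :: "real^2" and u :: "(real^2) \<times> real \<Rightarrow> real" and \<gamma> \<gamma>' \<gamma>'' :: "real \<Rightarrow> real^2" and l r \<nu> :: real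
  defines "Om \<equiv> ball (vector [l, 0]) r \<union> ball (vector [- l, 0]) r"
  assumes super: "viscosity_supersolution \<nu> \<Psi>m \<Psi>p u0 u" and cont: "continuous_on spacetime u"
    and lower: "\<And>y t. t \<ge> 0 \<Longrightarrow> \<Psi>m y \<le> u (y, t)"
    and \<nu>: "\<nu> > 0" and l: "l > 0" and r: "r > 0" and lr: "l < 1 / \<nu> - r"
    and \<gamma>: "\<And>s. s \<in> {0..1} \<Longrightarrow> (\<gamma> has_vector_derivative \<gamma>' s) (at s within {0..1})"
    and \<gamma>': "\<And>s. s \<in> {0..1} \<Longrightarrow> (\<gamma>' has_vector_derivative \<gamma>'' s) (at s within {0..1})"
    and reg: "\<And>s. s \<in> {0..1} \<Longrightarrow> \<gamma>' s \<noteq> 0"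
    and curv: "\<And>s. s \<in> {0<..<1} \<Longrightarrow> \<bar>planar_curvature (\<gamma>' s) (\<gamma>'' s)\<bar> \<le> \<nu>"
    and graph: "\<gamma> ` {0..1} = {vector [p, q] | p q. q = g p \<and> \<alpha> \<le> p \<and> p \<le> \<beta>}"
    and end1: "vector [\<alpha>, g \<alpha>] \<in> ball (vector [- l, 0] :: real^2) r"
    and end2: "vector [\<beta>, g \<beta>] \<in> ball (vector [l, 0] :: real^2) r"
    and D0: "open D0" "\<gamma> ` {0..1} \<subseteq> D0"
    and x: "\<And>y. Om \<subseteq> cball y (1 / \<nu>) \<Longrightarrow> norm (x - y) < 1 / \<nu>" and out: "x \<notin> Om"
    and level: "\<And>r' \<delta> M. 0 < r' \<Longrightarrow> r' < r \<Longrightarrow> 0 < \<delta> \<Longrightarrow>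
      (\<And>s y. s \<in> {0..1} \<Longrightarrow> norm (y - \<gamma> s) \<le> 2 * \<delta> \<Longrightarrow> y \<in> D0) \<Longrightarrow>
      \<exists>\<mu>\<in>I. (\<forall>y. norm (y - vector [- l, 0]) \<le> r' \<or> norm (y - vector [l, 0]) \<le> r' \<longrightarrow> \<mu> \<le> \<Psi>m y) \<and>
        (\<forall>s\<in>{0..1}. \<forall>y. norm (y - \<gamma> s) \<le> 2 * \<delta> \<longrightarrow> \<mu> \<le> u (y, 0)) \<and>
        (\<forall>y. norm y \<le> M \<longrightarrow> \<mu> \<le> \<Psi>p y)"
  shows "\<exists>\<mu>\<in>I. \<exists>\<tau>>0. \<forall>t>\<tau>. \<mu> \<le> u (x, t)"
proof -
  note gp = graph_parametrisation[OF \<gamma> reg graph]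
  define gc where "gc = (\<lambda>p. g (max \<alpha> (min \<beta> p)))"
  have gc: "continuous_on UNIV gc"
    unfolding gc_def
    by (rule continuous_on_compose2[OF gp(2)]) (use gp(1) in \<open>auto intro!: continuous_intros\<close>)
  have gc_eq: "gc p = g p" if "p \<in> {\<alpha>..\<beta>}" for p using that by (simp add: gc_def)
  have e1: "(\<alpha> + l)\<^sup>2 + (g \<alpha>)\<^sup>2 < r\<^sup>2" and e2: "(\<beta> - l)\<^sup>2 + (g \<beta>)\<^sup>2 < r\<^sup>2"
    using end1 end2 r norm_less_2_iff[of r "vector [- l, 0] - vector [\<alpha>, g \<alpha>]"]
      norm_less_2_iff[of r "vector [l, 0] - vector [\<beta>, g \<beta>]"]
    by (simp_all add: dist_norm power2_commute[of "- l"] power2_commute[of l])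
  define N where "N = 1 / \<nu> - r"
  have N: "l < N" "N > 0" using lr l by (auto simp: N_def)
  note hull = hull_of_two_discs[OF l r lr x[unfolded Om_def] out[unfolded Om_def], folded N_def]
  \<comment> \<open>discs of radius \<open>r - \<epsilon>\<close> are touched by the circle of radius \<open>1 / \<nu> + \<epsilon>\<close> about
    \<open>(0, - K \<epsilon>)\<close>\<close>
  define K where "K = (\<lambda>\<epsilon>. sqrt ((N + 2 * \<epsilon>)\<^sup>2 - l\<^sup>2))"
  have K: "(K \<longlongrightarrow> K 0) (at_right 0)" "((\<lambda>\<epsilon>. r - \<epsilon>) \<longlongrightarrow> r - 0) (at_right 0)"
    unfolding K_def by (intro tendsto_intros)+
  have K0: "K 0 = sqrt (N\<^sup>2 - l\<^sup>2)" by (simp add: K_def)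
  have ev1: "\<forall>\<^sub>F \<epsilon> in at_right 0. 0 < r - \<epsilon>"
    using order_tendstoD(1)[OF K(2), of 0] r by simp
  have ev2: "\<forall>\<^sub>F \<epsilon> in at_right 0. (\<alpha> + l)\<^sup>2 + (g \<alpha>)\<^sup>2 < (r - \<epsilon>)\<^sup>2"
    "\<forall>\<^sub>F \<epsilon> in at_right 0. (\<beta> - l)\<^sup>2 + (g \<beta>)\<^sup>2 < (r - \<epsilon>)\<^sup>2"
    using order_tendstoD(1)[OF tendsto_power[OF K(2)]] e1 e2 by auto
  have ev3: "\<forall>\<^sub>F \<epsilon> in at_right 0. norm (x - vector [0, - \<sigma> * K \<epsilon>]) < 1 / \<nu>" if \<sigma>: "\<sigma> \<in> {1, -1}" for \<sigma>
  proof -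
    have eq: "norm (x - vector [0, b]) < 1 / \<nu> \<longleftrightarrow> (x $ 1)\<^sup>2 + (x $ 2 - b)\<^sup>2 < (1 / \<nu>)\<^sup>2" for b
      using \<nu> by (subst norm_less_2_iff) auto
    have "((\<lambda>\<epsilon>. (x $ 1)\<^sup>2 + (x $ 2 - (- \<sigma> * K \<epsilon>))\<^sup>2) \<longlongrightarrow> (x $ 1)\<^sup>2 + (x $ 2 - (- \<sigma> * K 0))\<^sup>2) (at_right 0)"
      by (intro tendsto_intros K)
    moreover have "norm (x - vector [0, - \<sigma> * K 0]) < 1 / \<nu>"
      using hull(1,2) \<sigma> by (auto simp: K0)
    then have "(x $ 1)\<^sup>2 + (x $ 2 - (- \<sigma> * K 0))\<^sup>2 < (1 / \<nu>)\<^sup>2" by (simp only: eq)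
    ultimately show ?thesis unfolding eq by (rule order_tendstoD(2))
  qed
  have ev4: "\<forall>\<^sub>F \<epsilon> in at_right 0. K \<epsilon> / l * a < \<bar>x $ 2\<bar>" if "K 0 / l * a < \<bar>x $ 2\<bar>" for a
  proof (rule order_tendstoD(2)[OF _ that])
    show "((\<lambda>\<epsilon>. K \<epsilon> / l * a) \<longlongrightarrow> K 0 / l * a) (at_right 0)" using l by (intro tendsto_intros K) auto
  qed
  have ev5: "\<forall>\<^sub>F \<epsilon> in at_right 0. x $ 1 \<le> - l \<longrightarrow> K \<epsilon> / l * (- x $ 1 - l) < \<bar>x $ 2\<bar>"
    using ev4[of "- x $ 1 - l"] hull(3) by (cases "x $ 1 \<le> - l") (auto simp: K0)
  have ev6: "\<forall>\<^sub>F \<epsilon> in at_right 0. l \<le> x $ 1 \<longrightarrow> K \<epsilon> / l * (x $ 1 - l) < \<bar>x $ 2\<bar>"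
    using ev4[of "x $ 1 - l"] hull(4) by (cases "l \<le> x $ 1") (auto simp: K0)
  have "\<forall>\<^sub>F \<epsilon> in at_right 0. (0 :: real) < \<epsilon> \<and> 0 < r - \<epsilon> \<and> (\<alpha> + l)\<^sup>2 + (g \<alpha>)\<^sup>2 < (r - \<epsilon>)\<^sup>2 \<and>
      (\<beta> - l)\<^sup>2 + (g \<beta>)\<^sup>2 < (r - \<epsilon>)\<^sup>2 \<and> norm (x - vector [0, - 1 * K \<epsilon>]) < 1 / \<nu> \<and>
      norm (x - vector [0, - (-1) * K \<epsilon>]) < 1 / \<nu> \<and> (x $ 1 \<le> - l \<longrightarrow> K \<epsilon> / l * (- x $ 1 - l) < \<bar>x $ 2\<bar>) \<and>
      (l \<le> x $ 1 \<longrightarrow> K \<epsilon> / l * (x $ 1 - l) < \<bar>x $ 2\<bar>)"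
    by (intro eventually_conj eventually_at_right_less ev1 ev2 ev3 ev5 ev6) auto
  then obtain \<epsilon> where \<epsilon>: "0 < \<epsilon>" "0 < r - \<epsilon>"
    and r1: "(\<alpha> + l)\<^sup>2 + (g \<alpha>)\<^sup>2 < (r - \<epsilon>)\<^sup>2" and r2: "(\<beta> - l)\<^sup>2 + (g \<beta>)\<^sup>2 < (r - \<epsilon>)\<^sup>2"
    and c1: "norm (x - vector [0, - 1 * K \<epsilon>]) < 1 / \<nu>" and c2: "norm (x - vector [0, - (-1) * K \<epsilon>]) < 1 / \<nu>"
    and s1: "x $ 1 \<le> - l \<longrightarrow> K \<epsilon> / l * (- x $ 1 - l) < \<bar>x $ 2\<bar>"
    and s2: "l \<le> x $ 1 \<longrightarrow> K \<epsilon> / l * (x $ 1 - l) < \<bar>x $ 2\<bar>"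
    using eventually_happens'[OF trivial_limit_at_right_real] by blast
  define r' where "r' = r - \<epsilon>"
  define k where "k = K \<epsilon>"
  define R where "R = r' + sqrt (l\<^sup>2 + k\<^sup>2)"
  have r': "0 < r'" "r' < r" using \<epsilon> by (auto simp: r'_def)
  have NN: "l\<^sup>2 < (N + 2 * \<epsilon>)\<^sup>2" using l N \<epsilon> by (intro power_strict_mono) auto
  then have k: "k > 0" "l\<^sup>2 + k\<^sup>2 = (N + 2 * \<epsilon>)\<^sup>2" by (auto simp: k_def K_def)
  have "sqrt (l\<^sup>2 + k\<^sup>2) = N + 2 * \<epsilon>" unfolding k(2) using N \<epsilon> by (intro real_sqrt_abs[THEN trans]) auto
  then have R: "R = 1 / \<nu> + \<epsilon>" by (simp add: R_def r'_def N_def)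
  then have R1: "R > 1 / \<nu>" using \<epsilon> by simp
  \<comment> \<open>the horizontal continuations end on the circles of radius \<open>r'\<close>\<close>
  define a where "a = sqrt (r'\<^sup>2 - (g \<alpha>)\<^sup>2)"
  define b where "b = sqrt (r'\<^sup>2 - (g \<beta>)\<^sup>2)"
  have ga: "(g \<alpha>)\<^sup>2 < r'\<^sup>2" and gb: "(g \<beta>)\<^sup>2 < r'\<^sup>2"
    using r1 r2 zero_le_power2[of "\<alpha> + l"] zero_le_power2[of "\<beta> - l"] unfolding r'_def by linarith+
  have a: "a > 0" "a\<^sup>2 + (g \<alpha>)\<^sup>2 = r'\<^sup>2" and b: "b > 0" "b\<^sup>2 + (g \<beta>)\<^sup>2 = r'\<^sup>2"
    using ga gb by (auto simp: a_def b_def)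
  define \<alpha>' where "\<alpha>' = min \<alpha> (- l - a)"
  define \<beta>' where "\<beta>' = max \<beta> (l + b)"
  have ab: "\<alpha>' < - l" "l < \<beta>'" "\<alpha>' \<le> \<alpha>" "\<beta> \<le> \<beta>'" using a b by (auto simp: \<alpha>'_def \<beta>'_def)
  have near1: "gc p = g \<alpha> \<and> (p + l)\<^sup>2 + (g \<alpha>)\<^sup>2 \<le> r'\<^sup>2" if "\<alpha>' \<le> p" "p \<le> \<alpha>" for p
  proof
    show "gc p = g \<alpha>" using that gp(1) by (simp add: gc_def min_def)
    have "(p + l)\<^sup>2 \<le> max (a\<^sup>2) ((\<alpha> + l)\<^sup>2)"
    proof (cases "p \<le> - l \<and> - l - a \<le> p")
      case True
      then have "(p + l)\<^sup>2 \<le> a\<^sup>2" by (intro abs_le_square_iff[THEN iffD1]) auto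
      then show ?thesis by simp
    next
      case False
      then have "(p + l)\<^sup>2 \<le> (\<alpha> + l)\<^sup>2"
        using that by (intro abs_le_square_iff[THEN iffD1]) (auto simp: \<alpha>'_def min_def split: if_splits)
      then show ?thesis by simp
    qed
    then show "(p + l)\<^sup>2 + (g \<alpha>)\<^sup>2 \<le> r'\<^sup>2" using a(2) r1 unfolding r'_def by linarith
  qed
  have near2: "gc p = g \<beta> \<and> (p - l)\<^sup>2 + (g \<beta>)\<^sup>2 \<le> r'\<^sup>2" if "\<beta> \<le> p" "p \<le> \<beta>'" for p
  proof
    show "gc p = g \<beta>" using that gp(1) by (simp add: gc_def)
    have "(p - l)\<^sup>2 \<le> max (b\<^sup>2) ((\<beta> - l)\<^sup>2)"
    proof (cases "l \<le> p \<and> p \<le> l + b")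
      case True
      then have "(p - l)\<^sup>2 \<le> b\<^sup>2" by (intro abs_le_square_iff[THEN iffD1]) auto
      then show ?thesis by simp
    next
      case False
      then have "(p - l)\<^sup>2 \<le> (\<beta> - l)\<^sup>2"
        using that by (intro abs_le_square_iff[THEN iffD1]) (auto simp: \<beta>'_def max_def split: if_splits)
      then show ?thesis by simp
    qed
    then show "(p - l)\<^sup>2 + (g \<beta>)\<^sup>2 \<le> r'\<^sup>2" using b(2) r2 unfolding r'_def by linarith
  qed
  have c\<gamma>: "continuous_on {0..1} \<gamma>"
    using has_vector_derivative_continuous[OF \<gamma>] by (simp add: continuous_on_eq_continuous_within)
  then have comp: "compact (\<gamma> ` {0..1})" by (intro compact_continuous_image compact_Icc)
  obtain e where e: "e > 0" "(\<Union>y\<in>\<gamma> ` {0..1}. ball y e) \<subseteq> D0"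
    using compact_subset_open_imp_ball_epsilon_subset[OF comp D0] by blast
  define P where "P = (vector [\<alpha>, g \<alpha>] :: real^2)"
  define Q where "Q = (vector [\<beta>, g \<beta>] :: real^2)"
  have PQ: "norm (P - vector [- l, 0]) < r'" "norm (Q - vector [l, 0]) < r'"
    using r1 r2 r' by (subst norm_less_2_iff; simp add: P_def Q_def r'_def)+
  define \<delta> where "\<delta> = Min {e, r' - norm (P - vector [- l, 0]), r' - norm (Q - vector [l, 0])} / 3"
  have \<delta>: "\<delta> > 0" "2 * \<delta> < e" "2 * \<delta> \<le> r' - norm (P - vector [- l, 0])" "2 * \<delta> \<le> r' - norm (Q - vector [l, 0])"
    using e(1) PQ by (auto simp: \<delta>_def min_def)
  have tube: "y \<in> D0" if "s \<in> {0..1}" "norm (y - \<gamma> s) \<le> 2 * \<delta>" for s y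
  proof -
    have "y \<in> ball (\<gamma> s) e" using that \<delta> by (simp add: dist_norm norm_minus_commute)
    then show ?thesis using e(2) that by blast
  qed
  have "compact (gc ` {\<alpha>'..\<beta>'})"
    by (intro compact_continuous_image continuous_on_subset[OF gc]) auto
  then have "bounded (gc ` {\<alpha>'..\<beta>'})" by (rule compact_imp_bounded)
  then obtain G where "\<forall>y\<in>gc ` {\<alpha>'..\<beta>'}. norm y \<le> G"
    unfolding bounded_iff ..
  then have G: "\<bar>gc p\<bar> \<le> G" if "p \<in> {\<alpha>'..\<beta>'}" for p using that by auto
  obtain B where "\<forall>y\<in>\<gamma> ` {0..1}. norm y \<le> B"
    using compact_imp_bounded[OF comp] unfolding bounded_iff ..
  then have B: "norm (\<gamma> s) \<le> B" if "s \<in> {0..1}" for s using that by auto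
  define M where "M = max (3 * R + G + 4) (B + 2 * \<delta>)"
  \<comment> \<open>\<open>x\<close> lies above the graph for \<open>\<sigma> = 1\<close> and below it for \<open>\<sigma> = -1\<close>; beside the graph the sign
    is that of the half-plane, where the sector bound applies\<close>
  define \<sigma> :: real where "\<sigma> = (if x $ 1 \<in> {\<alpha>'..\<beta>'} then (if gc (x $ 1) \<le> x $ 2 then 1 else -1)
      else (if 0 \<le> x $ 2 then 1 else -1))"
  have \<sigma>: "\<sigma> \<in> {1, -1}" by (simp add: \<sigma>_def)
  have above: "above_graph l k \<alpha>' \<beta>' (\<lambda>p. \<sigma> * gc p) (x $ 1) (\<sigma> * x $ 2)"
  proof -
    have abs: "\<bar>x $ 2\<bar> = \<sigma> * x $ 2 \<or> \<sigma> * x $ 2 \<le> 0" using \<sigma> by auto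
    have left: "k / l * (- x $ 1 - l) \<le> \<sigma> * x $ 2 \<or> \<sigma> * x $ 2 \<le> 0 \<and> \<alpha>' \<le> x $ 1" if "x $ 1 \<le> - l"
    proof (cases "\<alpha>' \<le> x $ 1")
      case True
      then show ?thesis using abs s1 that by (auto simp: k_def)
    next
      case False
      then have "\<sigma> * x $ 2 = \<bar>x $ 2\<bar>" by (auto simp: \<sigma>_def)
      then show ?thesis using s1 that by (simp add: k_def)
    qed
    have right: "k / l * (x $ 1 - l) \<le> \<sigma> * x $ 2 \<or> \<sigma> * x $ 2 \<le> 0 \<and> x $ 1 \<le> \<beta>'" if "l \<le> x $ 1"
    proof (cases "x $ 1 \<le> \<beta>'")
      case True
      then show ?thesis using abs s2 that by (auto simp: k_def)
    next
      case False
      then have "\<sigma> * x $ 2 = \<bar>x $ 2\<bar>" by (auto simp: \<sigma>_def)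
      then show ?thesis using s2 that by (simp add: k_def)
    qed
    have mid: "\<sigma> * gc (x $ 1) \<le> \<sigma> * x $ 2" if "\<alpha>' \<le> x $ 1" "x $ 1 \<le> \<beta>'"
      using that by (auto simp: \<sigma>_def)
    show ?thesis unfolding above_graph_def using left right mid by blast
  qed
  have inside: "norm (x - vector [0, - \<sigma> * k]) < R"
    using \<sigma> c1 c2 R1 by (auto simp: k_def)
  have "\<exists>\<mu>\<in>I. (\<forall>y. norm (y - vector [- l, 0]) \<le> r' \<or> norm (y - vector [l, 0]) \<le> r' \<longrightarrow> \<mu> \<le> \<Psi>m y) \<and>
        (\<forall>s\<in>{0..1}. \<forall>y. norm (y - \<gamma> s) \<le> 2 * \<delta> \<longrightarrow> \<mu> \<le> u (y, 0)) \<and>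
        (\<forall>y. norm y \<le> M \<longrightarrow> \<mu> \<le> \<Psi>p y)"
    by (rule level[OF r' \<delta>(1)]) (rule tube)
  then obtain \<mu> where "\<mu> \<in> I"
    and m1': "\<forall>y. norm (y - vector [- l, 0]) \<le> r' \<or> norm (y - vector [l, 0]) \<le> r' \<longrightarrow> \<mu> \<le> \<Psi>m y"
    and m2': "\<forall>s\<in>{0..1}. \<forall>y. norm (y - \<gamma> s) \<le> 2 * \<delta> \<longrightarrow> \<mu> \<le> u (y, 0)"
    and m3': "\<forall>y. norm y \<le> M \<longrightarrow> \<mu> \<le> \<Psi>p y"
    by (elim bexE conjE) (rule that)
  note m1 = m1'[rule_format] and m2 = m2'[rule_format] and m3 = m3'[rule_format]
  have "\<exists>\<tau>>0. \<forall>t>\<tau>. \<mu> \<le> u (x, t)"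
  proof -
    have disc: "\<mu> \<le> u (y, t)" if "norm (y - vector [- l, 0]) \<le> r' \<or> norm (y - vector [l, 0]) \<le> r'" "t \<ge> 0" for y t
      using m1[OF that(1)] lower[OF that(2), of y] by linarith
    have curve: "\<mu> \<le> u (\<gamma> s, t)" if st: "s \<in> {0..1}" "t \<ge> 0" for s t
    proof (rule supersolution_persists_on_curve[OF super cont \<nu> \<delta>(1) \<gamma> \<gamma>' reg curv m2 _ _ st])
      fix s y assume s: "s \<in> {0..1::real}" "norm (y - \<gamma> s) \<le> 2 * \<delta>"
      have "norm y \<le> M"
        using B[OF s(1)] s(2) norm_triangle_ineq[of "y - \<gamma> s" "\<gamma> s"] by (simp add: M_def)
      then show "\<mu> \<le> \<Psi>p y" by (rule m3)
    next
      fix s y t assume s: "s \<in> {0, 1::real}" "norm (y - \<gamma> s) \<le> 2 * \<delta>" and t: "0 \<le> (t::real)"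
      have "\<gamma> s \<in> {P, Q}" using gp(3) s(1) unfolding P_def Q_def by auto
      then have "norm (y - vector [- l, 0]) \<le> r' \<or> norm (y - vector [l, 0]) \<le> r'"
        using s(2) \<delta>(3,4) norm_triangle_ineq[of "y - \<gamma> s" "\<gamma> s - vector [- l, 0]"]
          norm_triangle_ineq[of "y - \<gamma> s" "\<gamma> s - vector [l, 0]"] by auto
      then show "\<mu> \<le> u (y, t)" using t by (rule disc)
    qed
    show ?thesis
    proof (rule supersolution_fills_above_graph[OF super cont \<nu> l k(1) ab(1,2) r'(1) \<sigma> R_def R1 _ _ _ _ _ disc _ above inside])
      show "continuous_on UNIV (\<lambda>p. \<sigma> * gc p)" by (intro continuous_intros gc)
      show "\<bar>\<sigma> * gc p\<bar> \<le> G" if "p \<in> {\<alpha>'..\<beta>'}" for p using G[OF that] \<sigma> by (auto simp: abs_mult)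
      show "(\<alpha>' + l)\<^sup>2 + (\<sigma> * gc \<alpha>')\<^sup>2 \<le> r'\<^sup>2" using near1[of \<alpha>'] ab \<sigma> by (auto simp: power_mult_distrib)
      show "(\<beta>' - l)\<^sup>2 + (\<sigma> * gc \<beta>')\<^sup>2 \<le> r'\<^sup>2" using near2[of \<beta>'] ab \<sigma> by (auto simp: power_mult_distrib)
      show "\<mu> \<le> u (vector [p, \<sigma> * (\<sigma> * gc p)], t)" if p: "p \<in> {\<alpha>'..\<beta>'}" and t: "t \<ge> 0" for p t
      proof -
        have \<sigma>\<sigma>: "\<sigma> * (\<sigma> * gc p) = gc p" using \<sigma> by auto
        consider "p \<in> {\<alpha>..\<beta>}" | "\<alpha>' \<le> p" "p \<le> \<alpha>" | "\<beta> \<le> p" "p \<le> \<beta>'" using p by force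
        then show ?thesis
        proof cases
          case 1
          then have "vector [p, gc p] \<in> \<gamma> ` {0..1}" unfolding graph using gc_eq[OF 1] by auto
          then show ?thesis unfolding \<sigma>\<sigma> using curve t by auto
        next
          case 2
          have "norm (vector [p, gc p] - vector [- l, 0] :: real^2) \<le> r'"
            using near1[OF 2] r' by (subst norm_le_2_iff) auto
          then show ?thesis unfolding \<sigma>\<sigma> using disc t by blast
        next
          case 3
          have "norm (vector [p, gc p] - vector [l, 0] :: real^2) \<le> r'"
            using near2[OF 3] r' by (subst norm_le_2_iff) auto
          then show ?thesis unfolding \<sigma>\<sigma> using disc t by blast
        qed
      qed
      show "\<mu> \<le> \<Psi>p y" if "norm y \<le> 3 * R + G + 4" for y using m3[of y] that by (simp add: M_def)
    qed
  qed
  with \<open>\<mu> \<in> I\<close> show ?thesis by blast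
qed

lemma level_set_data_unfold:
  fixes u :: "(real^'n) \<times> real \<Rightarrow> real"
  assumes "level_set_data \<nu> \<Psi>m \<Psi>p u"
  obtains u0 a where "viscosity_subsolution \<nu> \<Psi>m \<Psi>p u0 u" "viscosity_supersolution \<nu> \<Psi>m \<Psi>p u0 u"
    "continuous_on spacetime u" "a < 0"
    "\<And>T. T > 0 \<Longrightarrow> \<exists>R>0. \<forall>x t. norm x \<ge> R \<and> 0 \<le> t \<and> t \<le> T \<longrightarrow> u (x, t) = a"
    "continuous_on UNIV \<Psi>m" "continuous_on UNIV \<Psi>p"
    "\<And>x t. t \<ge> 0 \<Longrightarrow> \<Psi>m x \<le> u (x, t)"
proof -
  obtain u0 a where s: "viscosity_subsolution \<nu> \<Psi>m \<Psi>p u0 u" "viscosity_supersolution \<nu> \<Psi>m \<Psi>p u0 u"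
    and a: "a < 0" "u \<in> K_class a"
    and lip: "\<exists>L. L-lipschitz_on UNIV \<Psi>m" "\<exists>L. L-lipschitz_on UNIV \<Psi>p"
    using assms by (auto simp: level_set_data_def viscosity_solution_def)
  have cont: "continuous_on spacetime u"
    and far: "\<And>T. T > 0 \<Longrightarrow> \<exists>R>0. \<forall>x t. norm x \<ge> R \<and> 0 \<le> t \<and> t \<le> T \<longrightarrow> u (x, t) = a"
    using a(2) by (auto simp: K_class_def)
  have pos: "\<Psi>m x \<le> u (x, t)" if "t > 0" for x t
  proof -
    have "ereal (\<Psi>m x) \<le> lsc_envelope spacetime u (x, t)"
      using s(2) that by (simp add: viscosity_supersolution_def Let_def)
    then show ?thesis using lsc_envelope_eq[OF cont, of "(x, t)"] that by simp
  qed
  have "\<Psi>m x \<le> u (x, t)" if "t \<ge> 0" for x t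
  proof (cases "t = 0")
    case True
    have "continuous_on {0..} (\<lambda>t. u (x, t))"
      by (rule continuous_on_compose2[OF cont]) (auto intro!: continuous_intros)
    then have "((\<lambda>t. u (x, t)) \<longlongrightarrow> u (x, 0)) (at 0 within {0..})"
      by (simp add: continuous_on)
    then have "((\<lambda>t. u (x, t)) \<longlongrightarrow> u (x, 0)) (at_right 0)"
      by (rule tendsto_within_subset) auto
    moreover have "\<forall>\<^sub>F t in at_right 0. \<Psi>m x \<le> u (x, t)"
      using eventually_at_right_less[of 0] by eventually_elim (rule pos)
    ultimately show ?thesis unfolding True by (rule tendsto_lowerbound) simp
  qed (use pos that in simp)
  with s a cont far lip show ?thesis using that lipschitz_on_continuous_on by metis
qed

lemma set_liminf_subset_set_limsup: "set_liminf D \<subseteq> set_limsup D"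
proof
  fix x assume "x \<in> set_liminf D"
  then obtain \<tau> where "\<And>t. t > \<tau> \<Longrightarrow> x \<in> D t" by (auto simp: set_liminf_def)
  then have "\<exists>t>\<tau>'. x \<in> D t" for \<tau>' by (intro exI[of _ "max \<tau> \<tau>' + 1"]) auto
  then show "x \<in> set_limsup D" by (auto simp: set_limsup_def)
qed

lemma in_set_liminfI: "\<exists>\<tau>>0. \<forall>t>\<tau>. x \<in> D t \<Longrightarrow> x \<in> set_liminf D"
  by (auto simp: set_liminf_def)

lemma notin_set_limsupI: "\<exists>\<tau>>0. \<forall>t>\<tau>. x \<notin> D t \<Longrightarrow> x \<notin> set_limsup D"
  by (auto simp: set_limsup_def)

text \<open>
  In both halves the levels differ between the two evolutions. The open evolution is the set
  \<open>u > 0\<close>: it is bounded from below by a level \<open>\<mu> > 0\<close>, which exists by compactness, and from above by the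
  level 0. The closed evolution is the set \<open>w \<ge> 0\<close>, where \<open>w\<close> and the lower obstacle may vanish
  identically on the given sets: it is bounded from below by the level 0 and from above by a level \<open>\<mu> < 0\<close>.
\<close>

theorem proposition4p14:
  fixes \<nu> r l :: real
    and Om D0 A :: "(real^2) set"
    and D E :: "real \<Rightarrow> (real^2) set"
  defines "Om \<equiv> ball (vector [l, 0]) r \<union> ball (vector [- l, 0]) r"
    and "A \<equiv> \<Inter> {cball y (1 / \<nu>) | y. Om \<subseteq> cball y (1 / \<nu>)}"
  assumes "\<nu> > 0" and "r > 0" and "l > 0"
    and "open D0" and "Om \<subseteq> D0"
    and "\<exists>z R. R < 1 / \<nu> \<and> D0 \<subseteq> ball z R"
    and "\<exists>(g :: real \<Rightarrow> real) \<alpha> \<beta> \<Gamma>. \<Gamma> = {vector [p, q] | p q. q = g p \<and> \<alpha> \<le> p \<and> p \<le> \<beta>} \<and>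
           \<Gamma> \<in> curves_curvature_le \<nu> \<and>
           vector [\<alpha>, g \<alpha>] \<in> ball (vector [- l, 0] :: real^2) r \<and>
           vector [\<beta>, g \<beta>] \<in> ball (vector [l, 0] :: real^2) r \<and>
           \<Gamma> \<subseteq> D0"
    and "open_evolution \<nu> D0 Om UNIV D"
    and "closed_evolution \<nu> (closure D0) (closure Om) UNIV E"
  shows "interior A \<subseteq> set_liminf D \<and> set_liminf D \<subseteq> set_limsup D \<and> set_limsup D \<subseteq> A \<and>
         interior A \<subseteq> set_liminf E \<and> set_liminf E \<subseteq> set_limsup E \<and> set_limsup E \<subseteq> A"
proof -
  note \<nu> = \<open>\<nu> > 0\<close> and r = \<open>r > 0\<close> and l = \<open>l > 0\<close>
  obtain z R where R: "R < 1 / \<nu>" "D0 \<subseteq> ball z R" using assms(8) by blast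
  obtain g \<alpha> \<beta> \<gamma> \<gamma>' \<gamma>'' where
    graph: "\<gamma> ` {0..1} = {vector [p, q] | p q. q = g p \<and> \<alpha> \<le> p \<and> p \<le> \<beta>}"
    and \<gamma>: "\<And>s. s \<in> {0..1} \<Longrightarrow> (\<gamma> has_vector_derivative \<gamma>' s) (at s within {0..1})"
    and \<gamma>': "\<And>s. s \<in> {0..1} \<Longrightarrow> (\<gamma>' has_vector_derivative \<gamma>'' s) (at s within {0..1})"
    and reg: "\<And>s. s \<in> {0..1} \<Longrightarrow> \<gamma>' s \<noteq> 0"
    and curv: "\<And>s. s \<in> {0<..<1} \<Longrightarrow> \<bar>planar_curvature (\<gamma>' s) (\<gamma>'' s)\<bar> \<le> \<nu>"
    and end1: "vector [\<alpha>, g \<alpha>] \<in> ball (vector [- l, 0] :: real^2) r"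
    and end2: "vector [\<beta>, g \<beta>] \<in> ball (vector [l, 0] :: real^2) r"
    and \<Gamma>D0: "\<gamma> ` {0..1} \<subseteq> D0"
  proof -
    obtain g \<alpha> \<beta> \<Gamma> where \<Gamma>: "\<Gamma> = {vector [p, q] | p q. q = g p \<and> \<alpha> \<le> p \<and> p \<le> \<beta>}"
      "\<Gamma> \<in> curves_curvature_le \<nu>" "vector [\<alpha>, g \<alpha>] \<in> ball (vector [- l, 0] :: real^2) r"
      "vector [\<beta>, g \<beta>] \<in> ball (vector [l, 0] :: real^2) r" "\<Gamma> \<subseteq> D0" using assms(9) by blast
    from \<Gamma>(2) obtain \<gamma> \<gamma>' \<gamma>'' where "\<Gamma> = \<gamma> ` {0..1}"
      "\<forall>t\<in>{0..1}. (\<gamma> has_vector_derivative \<gamma>' t) (at t within {0..1})"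
      "\<forall>t\<in>{0..1}. (\<gamma>' has_vector_derivative \<gamma>'' t) (at t within {0..1})"
      "\<forall>t\<in>{0..1}. \<gamma>' t \<noteq> 0" "\<forall>t\<in>{0<..<1}. \<bar>planar_curvature (\<gamma>' t) (\<gamma>'' t)\<bar> \<le> \<nu>"
      unfolding curves_curvature_le_def by blast
    with \<Gamma> show ?thesis by (intro that[of \<gamma> g \<alpha> \<beta> \<gamma>' \<gamma>'']) auto
  qed
  have cD0: "closure D0 \<subseteq> cball z R"
    using R(2) by (intro closure_minimal) (auto intro: less_imp_le)
  have cOm: "closure Om \<subseteq> closure D0" using \<open>Om \<subseteq> D0\<close> by (rule closure_mono)
  have disc: "cball (vector [l, 0]) r \<subseteq> closure Om" "cball (vector [- l, 0]) r \<subseteq> closure Om"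
    unfolding Om_def using r by (auto simp: closure_Un simp flip: closure_ball)
  have lr: "l < 1 / \<nu> - r"
  proof -
    define p where "p = (vector [l + r, 0] :: real^2)"
    have "p \<in> cball (vector [l, 0]) r" "- p \<in> cball (vector [- l, 0]) r"
      using r by (auto simp: p_def dist_norm norm_le_2_iff)
    then have "p \<in> cball z R" "- p \<in> cball z R" using disc cOm cD0 by blast+
    then have "norm (p - (- p)) \<le> 2 * R"
      using norm_triangle_ineq4[of "p - z" "- p - z"] by (simp add: dist_norm norm_minus_commute)
    moreover have "norm (p - (- p)) = 2 * (l + r)"
    proof -
      have "(norm (p - (- p)))\<^sup>2 = (2 * (l + r))\<^sup>2"
        unfolding norm_squared_2 by (simp add: p_def power2_eq_square)
      then show ?thesis using l r by simp
    qed
    ultimately have "l + r \<le> R" by simp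
    then have "l + r < 1 / \<nu>" using R(1) by (rule order.strict_trans1)
    then show ?thesis by (simp add: less_diff_eq)
  qed
  have R0: "0 \<le> R"
  proof -
    have "vector [l, 0] \<in> Om" using r by (simp add: Om_def)
    then show ?thesis using \<open>Om \<subseteq> D0\<close> R(2) by (force simp: dist_norm intro: order.trans[OF norm_ge_zero less_imp_le])
  qed
  have inA: "norm (x - y) < 1 / \<nu>" if "x \<in> interior A" "Om \<subseteq> cball y (1 / \<nu>)" for x y
  proof -
    have "interior A \<subseteq> interior (cball y (1 / \<nu>))"
      using that(2) by (intro interior_mono) (auto simp: A_def)
    then show ?thesis using that(1) by (auto simp: dist_norm norm_minus_commute)
  qed
  have notA: "\<exists>y. Om \<subseteq> cball y (1 / \<nu>) \<and> 1 / \<nu> < norm (x - y)" if "x \<notin> A" for x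
    using that by (auto simp: A_def dist_norm norm_minus_commute not_le)
  obtain \<Psi>m \<Psi>p u where dataD: "level_set_data \<nu> \<Psi>m \<Psi>p u" and OmD: "Om = {x. \<Psi>m x > 0}"
    and OpD: "UNIV = {x. \<Psi>p x > 0}" and D': "\<forall>t\<ge>0. D t = {x. u (x, t) > 0}"
    using assms(10) unfolding open_evolution_def by (elim exE conjE) (rule that)
  have D: "D t = {x. u (x, t) > 0}" and OmDt: "Om \<subseteq> D t" if "t \<ge> 0" for t
    using D' assms(10) that by (simp_all add: open_evolution_def)
  have DD0: "D 0 = D0" using assms(10) by (simp add: open_evolution_def)
  obtain \<Phi>m \<Phi>p w where dataE: "level_set_data \<nu> \<Phi>m \<Phi>p w" and CmE: "closure Om = {x. \<Phi>m x \<ge> 0}"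
    and CpE: "UNIV = {x. \<Phi>p x \<ge> 0}" and E': "\<forall>t\<ge>0. E t = {x. w (x, t) \<ge> 0}"
    using assms(11) unfolding closed_evolution_def by (elim exE conjE) (rule that)
  have E: "E t = {x. w (x, t) \<ge> 0}" and CmEt: "closure Om \<subseteq> E t" if "t \<ge> 0" for t
    using E' assms(11) that by (simp_all add: closed_evolution_def)
  have EE0: "E 0 = closure D0" using assms(11) by (simp add: closed_evolution_def)
  obtain u0 a where u: "viscosity_subsolution \<nu> \<Psi>m \<Psi>p u0 u" "viscosity_supersolution \<nu> \<Psi>m \<Psi>p u0 u"
    "continuous_on spacetime u" and a: "a < 0"
    "\<And>T. T > 0 \<Longrightarrow> \<exists>R>0. \<forall>x t. norm x \<ge> R \<and> 0 \<le> t \<and> t \<le> T \<longrightarrow> u (x, t) = a"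
    and c\<Psi>: "continuous_on UNIV \<Psi>m" "continuous_on UNIV \<Psi>p"
    and \<Psi>u: "\<And>x t. t \<ge> 0 \<Longrightarrow> \<Psi>m x \<le> u (x, t)"
    using level_set_data_unfold[OF dataD] by metis
  obtain w0 b where w: "viscosity_subsolution \<nu> \<Phi>m \<Phi>p w0 w" "viscosity_supersolution \<nu> \<Phi>m \<Phi>p w0 w"
    "continuous_on spacetime w" and b: "b < 0"
    "\<And>T. T > 0 \<Longrightarrow> \<exists>R>0. \<forall>x t. norm x \<ge> R \<and> 0 \<le> t \<and> t \<le> T \<longrightarrow> w (x, t) = b"
    and c\<Phi>: "continuous_on UNIV \<Phi>m" "continuous_on UNIV \<Phi>p"
    and \<Phi>w: "\<And>x t. t \<ge> 0 \<Longrightarrow> \<Phi>m x \<le> w (x, t)"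
    using level_set_data_unfold[OF dataE] by metis
  have u0D: "u (y, 0) > 0 \<longleftrightarrow> y \<in> D0" for y using D[of 0] DD0 by auto
  have w0E: "w (y, 0) \<ge> 0 \<longleftrightarrow> y \<in> closure D0" for y using E[of 0] EE0 by auto
  have cu0: "continuous_on UNIV (\<lambda>y. u (y, 0))"
    by (rule continuous_on_compose2[OF u(3)]) (auto intro!: continuous_intros)
  have cw0: "continuous_on UNIV (\<lambda>y. w (y, 0))"
    by (rule continuous_on_compose2[OF w(3)]) (auto intro!: continuous_intros)

  have "interior A \<subseteq> set_liminf D"
  proof
    fix x assume xA: "x \<in> interior A"
    show "x \<in> set_liminf D"
    proof (cases "x \<in> Om")
      case True
      then have "x \<in> D t" if "t > 1" for t using OmDt[of t] that by auto
      then show ?thesis by (intro in_set_liminfI exI[of _ 1]) auto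
    next
      case False
      have "\<exists>\<mu>\<in>{0<..}. \<exists>\<tau>>0. \<forall>t>\<tau>. \<mu> \<le> u (x, t)"
      proof (rule supersolution_eventually_inside_hull[OF u(2,3) \<Psi>u \<nu> l r lr \<gamma> \<gamma>' reg curv graph end1 end2
          \<open>open D0\<close> \<Gamma>D0 inA[OF xA, unfolded Om_def] False[unfolded Om_def]])
        fix r' \<delta> M :: real
        assume r': "0 < r'" "r' < r" and \<delta>: "\<delta> > 0"
          and tube: "\<And>s y. s \<in> {0..1} \<Longrightarrow> norm (y - \<gamma> s) \<le> 2 * \<delta> \<Longrightarrow> y \<in> D0"
        define K where "K = cball (vector [- l, 0] :: real^2) r' \<union> cball (vector [l, 0]) r'"
        have "compact K" by (simp add: K_def compact_Un)
        moreover have "K \<subseteq> Om" using r' by (auto simp: K_def Om_def)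
        then have "\<And>y. y \<in> K \<Longrightarrow> 0 < \<Psi>m y" using OmD by blast
        ultimately obtain m1 where m1: "m1 > 0" "\<And>y. y \<in> K \<Longrightarrow> m1 \<le> \<Psi>m y"
          using compact_positive_lower_bound[of K \<Psi>m] continuous_on_subset[OF c\<Psi>(1)] by blast
        define T where "T = {y + v | y v. y \<in> \<gamma> ` {0..1} \<and> v \<in> cball 0 (2 * \<delta>)}"
        have c\<gamma>: "continuous_on {0..1} \<gamma>"
          using has_vector_derivative_continuous[OF \<gamma>] by (simp add: continuous_on_eq_continuous_within)
        then have "compact T" unfolding T_def
          by (intro compact_sums compact_continuous_image compact_Icc compact_cball)
        moreover have "0 < u (y, 0)" if "y \<in> T" for y
        proof -
          obtain y' v where y': "y = y' + v" "y' \<in> \<gamma> ` {0..1}" "norm v \<le> 2 * \<delta>"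
            using \<open>y \<in> T\<close> unfolding T_def mem_cball_0 by blast
          then obtain s where "s \<in> {0..1}" "y' = \<gamma> s" by blast
          then show ?thesis using tube[of s y] y' u0D by simp
        qed
        ultimately obtain m2 where m2: "m2 > 0" "\<And>y. y \<in> T \<Longrightarrow> m2 \<le> u (y, 0)"
          using compact_positive_lower_bound[of T "\<lambda>y. u (y, 0)"] continuous_on_subset[OF cu0] by blast
        have "\<And>y. 0 < \<Psi>p y" using OpD by auto
        then obtain m3 where m3: "m3 > 0" "\<And>y. y \<in> cball 0 M \<Longrightarrow> m3 \<le> \<Psi>p y"
          using compact_positive_lower_bound[OF compact_cball, of 0 M \<Psi>p] continuous_on_subset[OF c\<Psi>(2)] by blast
        define \<mu> where "\<mu> = min m1 (min m2 m3)"
        show "\<exists>\<mu>\<in>{0<..}. (\<forall>y. norm (y - vector [- l, 0]) \<le> r' \<or> norm (y - vector [l, 0]) \<le> r' \<longrightarrow> \<mu> \<le> \<Psi>m y) \<and>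
          (\<forall>s\<in>{0..1}. \<forall>y. norm (y - \<gamma> s) \<le> 2 * \<delta> \<longrightarrow> \<mu> \<le> u (y, 0)) \<and>
          (\<forall>y. norm y \<le> M \<longrightarrow> \<mu> \<le> \<Psi>p y)"
        proof (intro bexI[of _ \<mu>] conjI allI ballI impI)
          fix y :: "real^2" assume "norm (y - vector [- l, 0]) \<le> r' \<or> norm (y - vector [l, 0]) \<le> r'"
          then show "\<mu> \<le> \<Psi>m y" using m1(2)[of y] by (auto simp: K_def \<mu>_def dist_norm norm_minus_commute min_le_iff_disj)
        next
          fix s y assume "s \<in> {0..1::real}" "norm (y - \<gamma> s) \<le> 2 * \<delta>"
          then have "\<gamma> s + (y - \<gamma> s) \<in> T" unfolding T_def by (intro CollectI exI conjI) auto
          then show "\<mu> \<le> u (y, 0)" using m2(2)[of y] by (simp add: \<mu>_def min_le_iff_disj)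
        next
          fix y :: "real^2" assume "norm y \<le> M"
          then show "\<mu> \<le> \<Psi>p y" using m3(2)[of y] by (simp add: \<mu>_def min_le_iff_disj)
        next
          show "\<mu> \<in> {0<..}" using m1 m2 m3 by (simp add: \<mu>_def)
        qed
      qed
      then obtain \<mu> \<tau> where "\<mu> > 0" and \<tau>: "\<tau> > 0" "\<And>t. t > \<tau> \<Longrightarrow> \<mu> \<le> u (x, t)" by auto
      have "x \<in> D t" if "t > \<tau>" for t using \<open>\<mu> > 0\<close> \<tau>(1) \<tau>(2)[OF that] D[of t] that by auto
      then show ?thesis using \<tau>(1) by (intro in_set_liminfI) blast
    qed
  qed

  moreover have "interior A \<subseteq> set_liminf E"
  proof
    fix x assume xA: "x \<in> interior A"
    show "x \<in> set_liminf E"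
    proof (cases "x \<in> Om")
      case True
      then have "x \<in> E t" if "t > 1" for t using CmEt[of t] closure_subset[of Om] that by auto
      then show ?thesis by (intro in_set_liminfI exI[of _ 1]) auto
    next
      case False
      have "\<exists>\<mu>\<in>{0}. \<exists>\<tau>>0. \<forall>t>\<tau>. \<mu> \<le> w (x, t)"
      proof (rule supersolution_eventually_inside_hull[OF w(2,3) \<Phi>w \<nu> l r lr \<gamma> \<gamma>' reg curv graph end1 end2
          \<open>open D0\<close> \<Gamma>D0 inA[OF xA, unfolded Om_def] False[unfolded Om_def]])
        fix r' \<delta> M :: real
        assume r': "0 < r'" "r' < r" and \<delta>: "\<delta> > 0"
          and tube: "\<And>s y. s \<in> {0..1} \<Longrightarrow> norm (y - \<gamma> s) \<le> 2 * \<delta> \<Longrightarrow> y \<in> D0"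
        show "\<exists>\<mu>\<in>{0}. (\<forall>y. norm (y - vector [- l, 0]) \<le> r' \<or> norm (y - vector [l, 0]) \<le> r' \<longrightarrow> \<mu> \<le> \<Phi>m y) \<and>
          (\<forall>s\<in>{0..1}. \<forall>y. norm (y - \<gamma> s) \<le> 2 * \<delta> \<longrightarrow> \<mu> \<le> w (y, 0)) \<and>
          (\<forall>y. norm y \<le> M \<longrightarrow> \<mu> \<le> \<Phi>p y)"
        proof (intro bexI[of _ 0] conjI allI ballI impI)
          fix y :: "real^2" assume "norm (y - vector [- l, 0]) \<le> r' \<or> norm (y - vector [l, 0]) \<le> r'"
          then have "y \<in> closure Om" using disc r'(2) by (auto simp: dist_norm norm_minus_commute)
          then show "0 \<le> \<Phi>m y" using CmE by blast
        next
          fix s y assume "s \<in> {0..1::real}" "norm (y - \<gamma> s) \<le> 2 * \<delta>"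
          then have "y \<in> closure D0" using tube closure_subset by blast
          then show "0 \<le> w (y, 0)" using w0E by blast
        next
          fix y :: "real^2"
          show "0 \<le> \<Phi>p y" using CpE by blast
        qed simp
      qed
      then obtain \<tau> where \<tau>: "\<tau> > 0" "\<And>t. t > \<tau> \<Longrightarrow> 0 \<le> w (x, t)" by auto
      then have "x \<in> E t" if "t > \<tau>" for t using E[of t] that by auto
      then show ?thesis using \<tau>(1) by (intro in_set_liminfI) blast
    qed
  qed

  moreover have "set_limsup D \<subseteq> A"
  proof (rule subsetI, rule ccontr)
    fix x assume x: "x \<in> set_limsup D" and "x \<notin> A"
    then obtain y where y: "Om \<subseteq> cball y (1 / \<nu>)" "1 / \<nu> < norm (x - y)" using notA by blast
    have "\<exists>\<mu>\<in>{0}. \<exists>\<tau>>0. \<forall>t>\<tau>. u (x, t) \<le> \<mu>"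
    proof (rule subsolution_eventually_outside_hull[OF u(1,3) a(2) \<nu> R0 R(1) y(2), where z = z])
      fix \<delta> :: real and f0 f1 :: "real^2 \<Rightarrow> real"
      assume f0: "\<And>v. norm (v - z) \<le> R \<Longrightarrow> \<delta> < f0 v"
        and f1: "\<And>v. norm (v - z) \<le> R \<Longrightarrow> norm (v - y) \<le> 1 / \<nu> \<Longrightarrow> \<delta> < f1 v"
      show "\<exists>\<mu>\<in>{0}. a < \<mu> \<and> (\<forall>v. \<mu> < \<Psi>m v \<longrightarrow> \<delta> \<le> f0 v \<and> \<delta> \<le> f1 v) \<and> (\<forall>v. \<mu> < u (v, 0) \<longrightarrow> \<delta> \<le> f0 v)"
      proof (intro bexI[of _ 0] conjI allI impI a(1))
        fix v assume "0 < \<Psi>m v"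
        then have "v \<in> Om" using OmD by blast
        then have "norm (v - z) \<le> R" "norm (v - y) \<le> 1 / \<nu>"
          using y(1) \<open>Om \<subseteq> D0\<close> R(2) by (auto simp: dist_norm norm_minus_commute subset_iff less_imp_le)
        then show "\<delta> \<le> f0 v" "\<delta> \<le> f1 v" using f0 f1 by (auto intro: less_imp_le)
      next
        fix v assume "0 < u (v, 0)"
        then have "v \<in> D0" using u0D by blast
        then have "norm (v - z) \<le> R" using R(2) by (auto simp: dist_norm norm_minus_commute subset_iff less_imp_le)
        then show "\<delta> \<le> f0 v" using f0 by (auto intro: less_imp_le)
      qed simp
    qed
    then obtain \<tau> where \<tau>: "\<tau> > 0" "\<And>t. t > \<tau> \<Longrightarrow> u (x, t) \<le> 0" by auto
    have "x \<notin> D t" if "t > \<tau>" for t using D[of t] that \<tau>(1) \<tau>(2)[OF that] by auto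
    then have "x \<notin> set_limsup D" using \<tau>(1) by (intro notin_set_limsupI) blast
    then show False using x by blast
  qed

  moreover have "set_limsup E \<subseteq> A"
  proof (rule subsetI, rule ccontr)
    fix x assume x: "x \<in> set_limsup E" and "x \<notin> A"
    then obtain y where y: "Om \<subseteq> cball y (1 / \<nu>)" "1 / \<nu> < norm (x - y)" using notA by blast
    have y': "closure Om \<subseteq> cball y (1 / \<nu>)" using y(1) by (intro closure_minimal) auto
    obtain Rf where "\<forall>v t. norm v \<ge> Rf \<and> 0 \<le> t \<and> t \<le> 1 \<longrightarrow> w (v, t) = b" using b(2)[of 1] by auto
    then have Rf: "w (v, 0) = b" if "norm v \<ge> Rf" for v using that by simp
    have "\<exists>\<mu>\<in>{..<0}. \<exists>\<tau>>0. \<forall>t>\<tau>. w (x, t) \<le> \<mu>"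
    proof (rule subsolution_eventually_outside_hull[OF w(1,3) b(2) \<nu> R0 R(1) y(2), where z = z])
      fix \<delta> :: real and f0 f1 :: "real^2 \<Rightarrow> real"
      assume c: "continuous_on UNIV f0" "continuous_on UNIV f1"
        and f0: "\<And>v. norm (v - z) \<le> R \<Longrightarrow> \<delta> < f0 v"
        and f1: "\<And>v. norm (v - z) \<le> R \<Longrightarrow> norm (v - y) \<le> 1 / \<nu> \<Longrightarrow> \<delta> < f1 v"
      have cl: "closed {v. f0 v \<le> \<delta>}" "closed {v. f1 v \<le> \<delta>}"
        by (intro closed_Collect_le c continuous_intros)+
      have f0': "w (v, 0) < 0" if "v \<in> {v. f0 v \<le> \<delta>}" for v
      proof (rule ccontr)
        assume "\<not> w (v, 0) < 0"
        then have "v \<in> cball z R" using w0E cD0 by (metis not_less subsetD)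
        then show False using f0[of v] that by (simp add: dist_norm norm_minus_commute)
      qed
      obtain m1 where m1: "m1 < 0" "\<And>v. v \<in> {v. f0 v \<le> \<delta>} \<Longrightarrow> w (v, 0) \<le> m1"
      proof (rule compact_upper_bound_negative[OF cl(1) cw0 f0', where z = 0 and R = Rf and a = b])
        show "w (v, 0) \<le> b" if "Rf \<le> dist v 0" for v using Rf[of v] that by simp
      qed (use b(1) in auto)
      have f1': "\<Phi>m v < 0" if "v \<in> {v. f1 v \<le> \<delta>}" for v
      proof (rule ccontr)
        assume "\<not> \<Phi>m v < 0"
        then have "v \<in> closure Om" using CmE by auto
        then have "v \<in> cball z R" "v \<in> cball y (1 / \<nu>)" using cOm cD0 y' by blast+
        then show False using f1[of v] that by (simp add: dist_norm norm_minus_commute)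
      qed
      obtain m2 where m2: "m2 < 0" "\<And>v. v \<in> {v. f1 v \<le> \<delta>} \<Longrightarrow> \<Phi>m v \<le> m2"
      proof (rule compact_upper_bound_negative[OF cl(2) c\<Phi>(1) f1', where z = 0 and R = Rf and a = b])
        show "\<Phi>m v \<le> b" if "Rf \<le> dist v 0" for v using Rf[of v] \<Phi>w[of 0 v] that by simp
      qed (use b(1) in auto)
      define \<mu> where "\<mu> = max (b / 2) (max m1 m2)"
      have \<mu>: "b < \<mu>" "\<mu> < 0" using b(1) m1(1) m2(1) by (auto simp: \<mu>_def less_max_iff_disj)
      show "\<exists>\<mu>\<in>{..<0}. b < \<mu> \<and> (\<forall>v. \<mu> < \<Phi>m v \<longrightarrow> \<delta> \<le> f0 v \<and> \<delta> \<le> f1 v) \<and> (\<forall>v. \<mu> < w (v, 0) \<longrightarrow> \<delta> \<le> f0 v)"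
      proof (intro bexI[of _ \<mu>] conjI allI impI \<mu>(1))
        fix v assume v: "\<mu> < \<Phi>m v"
        then have "\<mu> < w (v, 0)" using \<Phi>w[of 0 v] by simp
        then show "\<delta> \<le> f0 v" using m1(2)[of v] by (cases "f0 v \<le> \<delta>") (auto simp: \<mu>_def)
        show "\<delta> \<le> f1 v" using v m2(2)[of v] by (cases "f1 v \<le> \<delta>") (auto simp: \<mu>_def)
      next
        fix v assume "\<mu> < w (v, 0)"
        then show "\<delta> \<le> f0 v" using m1(2)[of v] by (cases "f0 v \<le> \<delta>") (auto simp: \<mu>_def)
      qed (use \<mu>(2) in simp)
    qed
    then obtain \<mu> \<tau> where \<mu>: "\<mu> < 0" and \<tau>: "\<tau> > 0" "\<And>t. t > \<tau> \<Longrightarrow> w (x, t) \<le> \<mu>" by auto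
    have "x \<notin> E t" if "t > \<tau>" for t using E[of t] that \<tau>(1) \<tau>(2)[OF that] \<mu> by auto
    then have "x \<notin> set_limsup E" using \<tau>(1) by (intro notin_set_limsupI) blast
    then show False using x by blast
  qed
  ultimately show ?thesis by (simp add: set_liminf_subset_set_limsup)
qed

end
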